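(* Let $N\ge 1$, $Q=2N+2$, $Q^*=\frac{2Q}{Q-2}$. Let $g:\mathbb{H}^N\to\mathbb{R}$ be a positive function with $g\in L^1(\mathbb{H}^N)\cap L^\infty(\mathbb{H}^N)$. Let $f:[0,\infty)\to[0,\infty)$ be continuous with $f(0)=0$, such that $\lim_{s\to0^+}\frac{f(s)}{s}=0$; $\lim_{s\to\infty}\frac{f(s)}{s^{\gamma-1}}\le C(f)$ for some $\gamma\in(2,Q^* )$ and some constant $C(f)>0$; and there exist $\vartheta>2$, $s_0>0$ with $0<\vartheta F(s)\le sf(s)$ for all $s>s_0$, where $F(s)=\int_0^s f(\tau)\,d\tau$. Let $a_1>0$ and the mountain pass solutions $u_a$, $a\in(0,a_1)$, be as in the context. Then there exists $a_2\in(0,a_1)$ such that $u_a\in L^\infty(\mathbb{H}^N)\cap C(\mathbb{H}^N)$ for all $a\in(0,a_2)$.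
   Context: The Heisenberg group $\mathbb{H}^N$ is $\mathbb{R}^{2N+1}$ with points $\xi=(x,y,t)$, $x,y\in\mathbb{R}^N$, $t\in\mathbb{R}$, and group law $\xi\circ\xi'=(x+x',y+y',t+t'+2(x'\cdot y-y'\cdot x))$. Its Haar measure is Lebesgue measure $d\xi$, and $Q=2N+2$ is its homogeneous dimension. Vector fields: $X_j=\partial_{x_j}+2y_j\partial_t$, $Y_j=\partial_{y_j}-2x_j\partial_t$, $j=1,\dots,N$; horizontal gradient $\nabla_{\mathbb{H}}u=(X_1u,\dots,X_Nu,Y_1u,\dots,Y_Nu)$; sub-Laplacian $\Delta_{\mathbb{H}}=\sum_{j=1}^N(X_j^2+Y_j^2)$. $\mathcal{D}^{1,2}(\mathbb{H}^N)$ is the completion of $C_c^\infty(\mathbb{H}^N)$ under $\|u\|=\left(\int_{\mathbb{H}^N}|\nabla_{\mathbb{H}}u|^2\,d\xi\right)^{1/2}$; equivalently $\{u\in L^{Q^*}(\mathbb{H}^N):\int_{\mathbb{H}^N}|\nabla_{\mathbb{H}}u|^2\,d\xi<\infty\}$. It is a Hilbert space. For $a>0$, $f_a:\mathbb{R}\to\mathbb{R}$ is $f_a(s)=f(s)-a$ for $s\ge0$, $f_a(s)=-a(s+1)$ for $s\in[-1,0]$, $f_a(s)=0$ for $s\le-1$; $F_a(s)=\int_0^sf_a(\tau)\,d\tau$. The energy functional on $\mathcal{D}^{1,2}(\mathbb{H}^N)$ is $J_a(u)=\frac12\int_{\mathbb{H}^N}|\nabla_{\mathbb{H}}u|^2\,d\xi-\int_{\mathbb{H}^N}g(\xi)F_a(u)\,d\xi$;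 it is $C^1$. A weak solution of $-\Delta_{\mathbb{H}}u=g(\xi)f_a(u)$ in $\mathbb{H}^N$ is $u\in\mathcal{D}^{1,2}(\mathbb{H}^N)$ with $\int_{\mathbb{H}^N}\nabla_{\mathbb{H}}u\cdot\nabla_{\mathbb{H}}\varphi\,d\xi=\int_{\mathbb{H}^N}g(\xi)f_a(u)\varphi\,d\xi$ for all $\varphi\in\mathcal{D}^{1,2}(\mathbb{H}^N)$; equivalently $J_a'(u)=0$. Mountain pass solutions: fix $\beta,\delta,a_1>0$ such that $J_a(u)\ge\delta$ whenever $\|u\|=\beta$ and $a\in(0,a_1)$, and fix $v=s\varphi$ with $s>0$, $\varphi\in C_c^\infty(\mathbb{H}^N)\setminus\{0\}$, $\varphi\ge0$, $\|\varphi\|=1$, such that $\|v\|>\beta$ and $J_a(v)<0$ for all $a\in(0,a_1)$. For each $a\in(0,a_1)$, $u_a\in\mathcal{D}^{1,2}(\mathbb{H}^N)$ denotes a (fixed) weak solution with $J_a'(u_a)=0$ and $J_a(u_a)=c_a:=\inf_{\Gamma}\max_{\sigma\in[0,1]}J_a(\Gamma(\sigma))\ge\delta$, the infimum being over all $\Gamma\in C([0,1],\mathcal{D}^{1,2}(\mathbb{H}^N))$ with $\Gamma(0)=0$, $\Gamma(1)=v$. (Membership in $C(\mathbb{H}^N)$ means having a continuous representative.) *)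

theory Defs
  imports "HOL-Analysis.Analysis"
begin

text \<open>
  Points of the Heisenberg group of dimension \<open>N = CARD('n)\<close> are triples \<open>(x, y, t)\<close>. Its Haar
  measure is \<^term>\<open>lebesgue\<close>. The group law itself is not needed: the geometry enters only
  through the vector fields \<open>X\<^sub>j\<close>, \<open>Y\<^sub>j\<close> below.
\<close>

type_synonym 'n heis = "(real ^ 'n) \<times> (real ^ 'n) \<times> real"

definition hom_dim :: "'n::finite itself \<Rightarrow> real" where
  "hom_dim _ = 2 * real CARD('n) + 2"

definition crit_exp :: "'n::finite itself \<Rightarrow> real" where
  "crit_exp T = 2 * hom_dim T / (hom_dim T - 2)"

text \<open>\<open>X\<^sub>j\<close> and \<open>Y\<^sub>j\<close> are the derivatives in the directions of these vectors.\<close>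

definition X_dir :: "'n::finite \<Rightarrow> 'n heis \<Rightarrow> 'n heis" where
  "X_dir j = (\<lambda>(x, y, t). (axis j 1, 0, 2 * y $ j))"

definition Y_dir :: "'n::finite \<Rightarrow> 'n heis \<Rightarrow> 'n heis" where
  "Y_dir j = (\<lambda>(x, y, t). (0, axis j 1, - 2 * x $ j))"

definition X_deriv :: "'n::finite \<Rightarrow> ('n heis \<Rightarrow> real) \<Rightarrow> 'n heis \<Rightarrow> real" where
  "X_deriv j \<phi> \<xi> = frechet_derivative \<phi> (at \<xi>) (X_dir j \<xi>)"

definition Y_deriv :: "'n::finite \<Rightarrow> ('n heis \<Rightarrow> real) \<Rightarrow> 'n heis \<Rightarrow> real" where
  "Y_deriv j \<phi> \<xi> = frechet_derivative \<phi> (at \<xi>) (Y_dir j \<xi>)"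

fun times_cont_diff :: "nat \<Rightarrow> ('a::real_normed_vector \<Rightarrow> real) \<Rightarrow> bool" where
  "times_cont_diff 0 f \<longleftrightarrow> continuous_on UNIV f"
| "times_cont_diff (Suc k) f \<longleftrightarrow>
     (\<forall>x. f differentiable (at x)) \<and>
     (\<forall>w. times_cont_diff k (\<lambda>x. frechet_derivative f (at x) w))"

definition test_fun :: "('a::real_normed_vector \<Rightarrow> real) \<Rightarrow> bool" where
  "test_fun \<phi> \<longleftrightarrow> (\<forall>k. times_cont_diff k \<phi>) \<and> compact (closure {x. \<phi> x \<noteq> 0})"

definition Lp_fun :: "real \<Rightarrow> ('a::euclidean_space \<Rightarrow> real) \<Rightarrow> bool" where
  "Lp_fun p u \<longleftrightarrow>
     u \<in> borel_measurable lebesgue \<and> integrable lebesgue (\<lambda>\<xi>. \<bar>u \<xi>\<bar> powr p)"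

definition Linf_fun :: "('a::euclidean_space \<Rightarrow> real) \<Rightarrow> bool" where
  "Linf_fun u \<longleftrightarrow>
     u \<in> borel_measurable lebesgue \<and> (\<exists>C. AE \<xi> in lebesgue. \<bar>u \<xi>\<bar> \<le> C)"

definition has_continuous_rep :: "('a::euclidean_space \<Rightarrow> real) \<Rightarrow> bool" where
  "has_continuous_rep u \<longleftrightarrow>
     (\<exists>w. continuous_on UNIV w \<and> (AE \<xi> in lebesgue. u \<xi> = w \<xi>))"

definition loc_integrable ::
    "('a::euclidean_space \<Rightarrow> 'b::{banach, second_countable_topology}) \<Rightarrow> bool" where
  "loc_integrable u \<longleftrightarrow> (\<forall>K. compact K \<longrightarrow> set_integrable lebesgue K u)"

text \<open>
  The horizontal gradient in the sense of distributions. \<open>X\<^sub>j\<close> and \<open>Y\<^sub>j\<close> are divergence free,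
  so their formal adjoints are \<open>- X\<^sub>j\<close> and \<open>- Y\<^sub>j\<close>. The pair \<open>(X u, Y u)\<close> carries the Euclidean
  norm and inner product of the \<open>2N\<close>-dimensional space.
\<close>

definition is_hgrad ::
    "('n::finite heis \<Rightarrow> real) \<Rightarrow> ('n heis \<Rightarrow> (real ^ 'n) \<times> (real ^ 'n)) \<Rightarrow> bool" where
  "is_hgrad u G \<longleftrightarrow> loc_integrable u \<and> loc_integrable G \<and>
     (\<forall>\<phi>. test_fun \<phi> \<longrightarrow> (\<forall>j.
        (LINT \<xi>|lebesgue. u \<xi> * X_deriv j \<phi> \<xi>) = - (LINT \<xi>|lebesgue. fst (G \<xi>) $ j * \<phi> \<xi>) \<and>
        (LINT \<xi>|lebesgue. u \<xi> * Y_deriv j \<phi> \<xi>) = - (LINT \<xi>|lebesgue. snd (G \<xi>) $ j * \<phi> \<xi>)))"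

text \<open>Unique up to null sets if it exists; unspecified otherwise. For test functions it agrees
  almost everywhere with the classical \<^const>\<open>X_deriv\<close>, \<^const>\<open>Y_deriv\<close>.\<close>

definition hgrad :: "('n::finite heis \<Rightarrow> real) \<Rightarrow> 'n heis \<Rightarrow> (real ^ 'n) \<times> (real ^ 'n)" where
  "hgrad u = (SOME G. is_hgrad u G)"

definition D_norm :: "('n::finite heis \<Rightarrow> real) \<Rightarrow> real" where
  "D_norm u = sqrt (LINT \<xi>|lebesgue. (norm (hgrad u \<xi>))\<^sup>2)"

text \<open>
  The completion of the test functions under \<^const>\<open>D_norm\<close>, realised as a space of functions.
  By the Folland-Stein inequality a \<^const>\<open>D_norm\<close>-Cauchy sequence of test functions converges
  in \<open>L\<^sup>p\<close> for the critical exponent \<open>p\<close>, and its class in the completion is identified with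
  that limit. Elements are representatives: functions equal almost everywhere denote the
  same point of the space.
\<close>

definition D12 :: "('n::finite heis \<Rightarrow> real) set" where
  "D12 = {u. Lp_fun (crit_exp TYPE('n)) u \<and>
     (\<exists>G. is_hgrad u G) \<and> integrable lebesgue (\<lambda>\<xi>. (norm (hgrad u \<xi>))\<^sup>2) \<and>
     (\<exists>\<phi>. (\<forall>k::nat. test_fun (\<phi> k)) \<and>
        (\<lambda>k. D_norm (\<lambda>\<xi>. \<phi> k \<xi> - u \<xi>)) \<longlonglongrightarrow> 0 \<and>
        (\<lambda>k. LINT \<xi>|lebesgue. \<bar>\<phi> k \<xi> - u \<xi>\<bar> powr crit_exp TYPE('n)) \<longlonglongrightarrow> 0)}"

definition f_shift :: "(real \<Rightarrow> real) \<Rightarrow> real \<Rightarrow> real \<Rightarrow> real" where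
  "f_shift f a s = (if s \<ge> 0 then f s - a else if s \<ge> -1 then - a * (s + 1) else 0)"

text \<open>The oriented integral from 0, for either sign of the upper limit.\<close>

definition antideriv :: "(real \<Rightarrow> real) \<Rightarrow> real \<Rightarrow> real" where
  "antideriv h s = (LBINT \<tau>=ereal 0..ereal s. h \<tau>)"

definition energy ::
    "('n::finite heis \<Rightarrow> real) \<Rightarrow> (real \<Rightarrow> real) \<Rightarrow> real \<Rightarrow> ('n heis \<Rightarrow> real) \<Rightarrow> real" where
  "energy g f a u =
     (1/2) * (LINT \<xi>|lebesgue. (norm (hgrad u \<xi>))\<^sup>2)
     - (LINT \<xi>|lebesgue. g \<xi> * antideriv (f_shift f a) (u \<xi>))"

definition weak_solution ::
    "('n::finite heis \<Rightarrow> real) \<Rightarrow> (real \<Rightarrow> real) \<Rightarrow> real \<Rightarrow> ('n heis \<Rightarrow> real) \<Rightarrow> bool" where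
  "weak_solution g f a u \<longleftrightarrow> u \<in> D12 \<and>
     (\<forall>\<phi>\<in>D12. (LINT \<xi>|lebesgue. hgrad u \<xi> \<bullet> hgrad \<phi> \<xi>)
              = (LINT \<xi>|lebesgue. g \<xi> * f_shift f a (u \<xi>) * \<phi> \<xi>))"

text \<open>
  The Frechet derivative of \<open>J\<close> on \<^const>\<open>D12\<close> at \<open>u\<close> exists and is zero. Spelled out because
  \<^const>\<open>D12\<close> is a set of representatives, not a normed type.
\<close>

definition critical_point ::
    "(('n::finite heis \<Rightarrow> real) \<Rightarrow> real) \<Rightarrow> ('n heis \<Rightarrow> real) \<Rightarrow> bool" where
  "critical_point J u \<longleftrightarrow> u \<in> D12 \<and>
     (\<forall>\<epsilon>>0. \<exists>r>0. \<forall>h\<in>D12. D_norm h < r \<longrightarrow>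
        \<bar>J (\<lambda>\<xi>. u \<xi> + h \<xi>) - J u\<bar> \<le> \<epsilon> * D_norm h)"

definition mp_paths :: "('n::finite heis \<Rightarrow> real) \<Rightarrow> (real \<Rightarrow> 'n heis \<Rightarrow> real) set" where
  "mp_paths v = {\<Gamma>. (\<forall>\<sigma>\<in>{0..1}. \<Gamma> \<sigma> \<in> D12) \<and>
     (\<forall>\<sigma>\<in>{0..1}. ((\<lambda>\<tau>. D_norm (\<lambda>\<xi>. \<Gamma> \<tau> \<xi> - \<Gamma> \<sigma> \<xi>)) \<longlongrightarrow> 0) (at \<sigma> within {0..1})) \<and>
     (AE \<xi> in lebesgue. \<Gamma> 0 \<xi> = 0) \<and> (AE \<xi> in lebesgue. \<Gamma> 1 \<xi> = v \<xi>)}"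

text \<open>
  For continuous \<open>J\<close> the supremum over the compact interval is the maximum.
\<close>

definition mp_level ::
    "(('n::finite heis \<Rightarrow> real) \<Rightarrow> real) \<Rightarrow> ('n heis \<Rightarrow> real) \<Rightarrow> real" where
  "mp_level J v = (INF \<Gamma>\<in>mp_paths v. SUP \<sigma>\<in>{0..1}. J (\<Gamma> \<sigma>))"

end

theory Submission imports Defs begin

text \<open>
  Every weak solution is bounded and continuous, whatever its energy. The weak equation is tested
  with truncations of \<open>hgauge e (hdiff \<xi> \<eta>) powr (- N / 2)\<close>, Folland's regularized fundamental
  solution with pole \<open>\<xi>\<close>, whose sub-Laplacian is explicitly minus an approximate identity. Removing
  the truncation and letting \<open>e\<close> tend to \<open>0\<close> represents \<open>u\<close> as the potential of \<open>g f\<^sub>a(u)\<close>. With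
  respect to the finite measure \<open>g d\<xi>\<close> the fundamental solution has uniformly bounded moments of
  every order below \<open>Q / (Q - 2)\<close>, so subcritical growth lets the integrability of \<open>u\<close> improve
  by a fixed factor at each step until \<open>u\<close> is bounded. The potential of a bounded density is then a
  uniform limit of continuous functions.
\<close>

section \<open>Smooth functions\<close>

text \<open>Scaling fixes all exponents. \<open>hgauge\<close> has degree 4 under the dilations
  \<open>hdil\<close>, whose Jacobian is the Q-th power of the factor, so its sublevel set of height
  l has volume proportional to l to the power Q / 4 = (N + 1) / 2, and the kernel
  \<open>hgauge powr (- N / 2)\<close> has degree 2 - Q. Powers of the kernel below R = Q / (Q - 2)
  = 1 + 1 / N are locally integrable, the critical exponent is 2 R, and s = \<gamma> - 1 < 2 R - 1
  is exactly what leaves room for a gain factor larger than 1. The iteration starts from the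
  critical integrability recorded in \<open>D12\<close>.

  Since \<open>hgrad\<close> is a mere choice, testing with smooth functions first requires
  uniqueness of the weak gradient, hence the fundamental lemma.

  The kernel is delicate at both ends. Its pole is smoothed by adding e to |z|^2 only, which keeps
  the sub-Laplacian explicit. Its tail meets a function u known merely in L^p: the cut-off errors
  decay like the gauge to the power - Q / 4, which is just not integrable, but every conjugate power
  q > 1 of them is.\<close>

lemma times_cont_diff_imp_continuous: "times_cont_diff k f \<Longrightarrow> continuous_on UNIV f"
  by (cases k) (auto intro!: continuous_at_imp_continuous_on differentiable_imp_continuous_within)

lemma times_cont_diff_SucD: "times_cont_diff (Suc k) f \<Longrightarrow> times_cont_diff k f"
proof (induction k arbitrary: f)
  case 0
  then show ?case by (metis times_cont_diff.simps(1) times_cont_diff_imp_continuous)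
next
  case (Suc k)
  show ?case
    unfolding times_cont_diff.simps(2)[of k]
  proof (intro conjI allI)
    show "f differentiable at x" for x using Suc.prems by simp
    show "times_cont_diff k (\<lambda>x. frechet_derivative f (at x) w)" for w
      using Suc.prems by (intro Suc.IH) (simp only: times_cont_diff.simps(2)[of "Suc k"])
  qed
qed

text \<open>Uniqueness of the derivative lets an explicit formula \<open>D\<close> replace the
  chosen \<open>frechet_derivative\<close>; the closure properties below are inductions on k through
  this rule.\<close>

lemma times_cont_diff_SucI:
  assumes "\<And>x. (f has_derivative D x) (at x)" "\<And>w. times_cont_diff k (\<lambda>x. D x w)"
  shows "times_cont_diff (Suc k) f"
proof -
  have "frechet_derivative f (at x) = D x" for x
    using frechet_derivative_at[OF assms(1)] by simp
  then show ?thesis using assms by (auto simp: differentiable_def)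
qed

lemma times_cont_diff_has_derivative:
  "times_cont_diff (Suc k) f \<Longrightarrow> (f has_derivative frechet_derivative f (at x)) (at x)"
  by (simp add: frechet_derivative_works[symmetric])

lemma times_cont_diff_const [simp]: "times_cont_diff k (\<lambda>_. c)"
proof (induction k arbitrary: c)
  case (Suc k)
  then show ?case by (intro times_cont_diff_SucI[where D="\<lambda>_ _. 0"]) auto
qed simp

lemma times_cont_diff_linear:
  assumes "bounded_linear f" shows "times_cont_diff k f"
proof (cases k)
  case 0
  then show ?thesis using assms by (simp add: linear_continuous_on)
next
  case (Suc k)
  then show ?thesis
    using times_cont_diff_SucI[where D="\<lambda>_. f", OF bounded_linear_imp_has_derivative[OF assms]]
    by simp
qed

lemma times_cont_diff_add:
  "times_cont_diff k f \<Longrightarrow> times_cont_diff k g \<Longrightarrow> times_cont_diff k (\<lambda>x. f x + g x)"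
proof (induction k arbitrary: f g)
  case (Suc k)
  show ?case
    by (rule times_cont_diff_SucI[OF has_derivative_add[OF Suc.prems[THEN times_cont_diff_has_derivative]]])
       (use Suc in auto)
qed (simp add: continuous_on_add)

lemma times_cont_diff_mult:
  "times_cont_diff k f \<Longrightarrow> times_cont_diff k g \<Longrightarrow> times_cont_diff k (\<lambda>x. f x * g x)"
proof (induction k arbitrary: f g)
  case (Suc k)
  note d = Suc.prems[THEN times_cont_diff_SucD]
  show ?case
    by (rule times_cont_diff_SucI[OF has_derivative_mult[OF Suc.prems[THEN times_cont_diff_has_derivative]]])
       (use Suc d in \<open>auto intro!: times_cont_diff_add\<close>)
qed (simp add: continuous_on_mult)

text \<open>The derivatives of the outer function are passed as a sequence and are only required on a
  set containing the range of the inner one, so that negative powers are covered.\<close>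

lemma times_cont_diff_compose:
  fixes h :: "nat \<Rightarrow> real \<Rightarrow> real"
  assumes h: "\<And>n s. s \<in> S \<Longrightarrow> (h n has_real_derivative h (Suc n) s) (at s)"
    and S: "\<And>x. f x \<in> S"
  shows "times_cont_diff k f \<Longrightarrow> times_cont_diff k (\<lambda>x. h n (f x))"
proof (induction k arbitrary: n)
  case 0
  have "continuous_on S (h n)"
    using h by (intro continuous_at_imp_continuous_on) (auto intro: DERIV_isCont)
  then show ?case using 0 S by (auto intro: continuous_on_compose2)
next
  case (Suc k)
  have "((\<lambda>x. h n (f x)) has_derivative
      (\<lambda>w. frechet_derivative f (at x) w * h (Suc n) (f x))) (at x)" for x
    by (rule DERIV_compose_FDERIV[OF h[OF S] times_cont_diff_has_derivative[OF Suc.prems]])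
  then show ?case
    by (rule times_cont_diff_SucI)
       (use Suc times_cont_diff_SucD[OF Suc.prems] in \<open>auto intro!: times_cont_diff_mult\<close>)
qed

lemma times_cont_diff_sum:
  "(\<And>i. i \<in> I \<Longrightarrow> times_cont_diff k (f i)) \<Longrightarrow> times_cont_diff k (\<lambda>x. \<Sum>i\<in>I. f i x)"
  by (induction I rule: infinite_finite_induct) (auto intro!: times_cont_diff_add)

lemma times_cont_diff_prod:
  "(\<And>i. i \<in> I \<Longrightarrow> times_cont_diff k (f i)) \<Longrightarrow> times_cont_diff k (\<lambda>x. \<Prod>i\<in>I. f i x)"
  by (induction I rule: infinite_finite_induct) (auto intro!: times_cont_diff_mult)

lemma times_cont_diff_power:
  "times_cont_diff k f \<Longrightarrow> times_cont_diff k (\<lambda>x. f x ^ n)"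
  by (induction n) (auto intro!: times_cont_diff_mult)

lemma times_cont_diff_minus: "times_cont_diff k f \<Longrightarrow> times_cont_diff k (\<lambda>x. - f x)"
  using times_cont_diff_mult[of k "\<lambda>_. -1" f] by simp

lemma times_cont_diff_diff:
  "times_cont_diff k f \<Longrightarrow> times_cont_diff k g \<Longrightarrow> times_cont_diff k (\<lambda>x. f x - g x)"
  using times_cont_diff_add[OF _ times_cont_diff_minus, of k f g] by simp

section \<open>A smooth function on the line that vanishes on one half-line\<close>

definition flat :: "real poly \<Rightarrow> real \<Rightarrow> real" where
  "flat p x = (if x \<le> 0 then 0 else poly p (1 / x) * exp (- 1 / x))"

lemma poly_exp_tendsto_0: "((\<lambda>y. poly p y * exp (- y)) \<longlongrightarrow> 0) at_top" for p :: "real poly"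
proof -
  have "((\<lambda>y::real. \<Sum>i\<le>degree p. coeff p i * (y ^ i / exp y)) \<longlongrightarrow> (\<Sum>i\<le>degree p. coeff p i * 0)) at_top"
    by (intro tendsto_intros tendsto_power_div_exp_0)
  moreover have "(\<Sum>i\<le>degree p. coeff p i * (y ^ i / exp y)) = poly p y * exp (- y)" for y
    by (simp add: poly_altdef exp_minus sum_distrib_right divide_inverse mult.assoc)
  ultimately show ?thesis by simp
qed

text \<open>The class is closed under differentiation: with y = 1 / x, the x-derivative of p(y)
  exp(- y) is y^2 (p - p')(y) exp(- y), and \<open>[:0,0,1:]\<close> is y^2. At 0 the exponential
  beats every polynomial in 1 / x.\<close>

lemma flat_has_derivative:
  "(flat p has_real_derivative flat ([:0,0,1:] * (p - pderiv p)) x) (at x)"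
proof (cases x "0::real" rule: linorder_cases)
  case less
  have "((\<lambda>_. 0) has_real_derivative 0) (at x)" by simp
  moreover have "\<forall>\<^sub>F y in nhds x. flat p y = 0"
    using less
    by (intro eventually_nhds[THEN iffD2] exI[of _ "{..<0}"]) (auto simp: flat_def)
  ultimately show ?thesis
    using less by (subst DERIV_cong_ev[OF refl _ refl]) (auto simp: flat_def)
next
  case greater
  have "((\<lambda>x. poly p (1 / x) * exp (- 1 / x)) has_real_derivative
      poly ([:0,0,1:] * (p - pderiv p)) (1 / x) * exp (- 1 / x)) (at x)"
    using greater
    by (auto intro!: derivative_eq_intros DERIV_chain2[OF poly_DERIV] simp: power2_eq_square algebra_simps)
  moreover have "\<forall>\<^sub>F y in nhds x. flat p y = poly p (1 / y) * exp (- 1 / y)"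
    using greater
    by (intro eventually_nhds[THEN iffD2] exI[of _ "{0<..}"]) (auto simp: flat_def)
  ultimately show ?thesis
    using greater by (subst DERIV_cong_ev[OF refl _ refl]) (auto simp: flat_def)
next
  case equal
  have "((\<lambda>y. flat p y / y) \<longlongrightarrow> 0) (at 0)"
    unfolding filterlim_at_split
  proof
    show "((\<lambda>y. flat p y / y) \<longlongrightarrow> 0) (at_left 0)"
      by (rule tendsto_eventually) (auto simp: flat_def eventually_at_left_field intro!: exI[of _ "-1"])
    \<comment> \<open>Dividing by y multiplies the polynomial in 1 / y by its variable
      \<open>[:0,1:]\<close>, so the difference quotient has the same form and decays as
      well.\<close>
    have "((\<lambda>y. poly ([:0,1:] * p) (inverse y) * exp (- inverse y)) \<longlongrightarrow> 0) (at_right 0)"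
      by (rule filterlim_compose[OF poly_exp_tendsto_0 filterlim_inverse_at_top_right])
    then show "((\<lambda>y. flat p y / y) \<longlongrightarrow> 0) (at_right 0)"
      by (rule Lim_transform_eventually)
         (auto simp: flat_def eventually_at_right_field field_simps intro!: exI[of _ 1])
  qed
  then show ?thesis
    using equal by (simp add: has_field_derivative_iff flat_def)
qed

primrec flat_poly :: "nat \<Rightarrow> real poly" where
  "flat_poly 0 = 1"
| "flat_poly (Suc n) = [:0,0,1:] * (flat_poly n - pderiv (flat_poly n))"

text \<open>The n-th derivative of exp(- 1 / x), extended by 0 to x \<le> 0. It is kept as a
  sequence of derivatives because \<open>times_cont_diff_compose\<close> takes its outer function in
  that form.\<close>

definition bump :: "nat \<Rightarrow> real \<Rightarrow> real" where "bump n = flat (flat_poly n)"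

lemma bump_has_derivative: "(bump n has_real_derivative bump (Suc n) x) (at x)"
  unfolding bump_def by (simp only: flat_poly.simps) (rule flat_has_derivative)

lemma bump_nonpos [simp]: "x \<le> 0 \<Longrightarrow> bump n x = 0"
  by (simp add: bump_def flat_def)

lemma bump_0_eq: "x > 0 \<Longrightarrow> bump 0 x = exp (- 1 / x)"
  by (simp add: bump_def flat_def)

lemma bump_0_nonneg: "bump 0 x \<ge> 0"
  by (simp add: bump_def flat_def)

lemma bump_0_pos_iff: "bump 0 x > 0 \<longleftrightarrow> x > 0"
  by (simp add: bump_def flat_def)

lemma continuous_on_bump [continuous_intros]:
  "continuous_on A f \<Longrightarrow> continuous_on A (\<lambda>x. bump n (f x))"
  by (rule continuous_on_compose2[of UNIV "bump n"])
     (auto intro!: continuous_at_imp_continuous_on DERIV_isCont[OF bump_has_derivative])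

lemma times_cont_diff_bump: "times_cont_diff k f \<Longrightarrow> times_cont_diff k (\<lambda>x. bump n (f x))"
  by (rule times_cont_diff_compose[where S=UNIV]) (auto intro: bump_has_derivative)

section \<open>Test functions\<close>

lemma test_fun_smooth: "test_fun \<phi> \<Longrightarrow> times_cont_diff k \<phi>"
  by (simp add: test_fun_def)

lemma test_funI:
  fixes \<phi> :: "'a::euclidean_space \<Rightarrow> real"
  assumes "\<And>k. times_cont_diff k \<phi>" "bounded {x. \<phi> x \<noteq> 0}"
  shows "test_fun \<phi>"
  using assms by (simp add: test_fun_def compact_closure)

lemma test_fun_bounded_support: "test_fun \<phi> \<Longrightarrow> bounded {x. \<phi> x \<noteq> 0}"
  unfolding test_fun_def by (meson bounded_subset closure_subset compact_imp_bounded)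

lemma test_fun_continuous: "test_fun \<phi> \<Longrightarrow> continuous_on UNIV \<phi>"
  by (metis times_cont_diff.simps(1) test_fun_smooth)

lemma test_fun_has_derivative:
  "test_fun \<phi> \<Longrightarrow> (\<phi> has_derivative frechet_derivative \<phi> (at x)) (at x)"
  by (rule times_cont_diff_has_derivative[OF test_fun_smooth])

lemma test_fun_mult:
  fixes \<phi> :: "'a::euclidean_space \<Rightarrow> real"
  assumes "test_fun \<phi>" "\<And>k. times_cont_diff k g"
  shows "test_fun (\<lambda>x. g x * \<phi> x)"
  using assms by (intro test_funI times_cont_diff_mult)
    (auto intro: test_fun_smooth bounded_subset[OF test_fun_bounded_support])

lemma test_fun_add:
  fixes \<phi> \<psi> :: "'a::euclidean_space \<Rightarrow> real"
  assumes "test_fun \<phi>" "test_fun \<psi>"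
  shows "test_fun (\<lambda>x. \<phi> x + \<psi> x)"
proof (intro test_funI times_cont_diff_add)
  show "bounded {x. \<phi> x + \<psi> x \<noteq> 0}"
    by (rule bounded_subset[of "{x. \<phi> x \<noteq> 0} \<union> {x. \<psi> x \<noteq> 0}"])
       (use assms[THEN test_fun_bounded_support] in auto)
qed (use assms in \<open>auto intro: test_fun_smooth\<close>)

lemma test_fun_frechet_derivative:
  fixes \<phi> :: "'a::euclidean_space \<Rightarrow> real"
  assumes "test_fun \<phi>"
  shows "test_fun (\<lambda>x. frechet_derivative \<phi> (at x) w)"
proof (rule test_funI)
  show "times_cont_diff k (\<lambda>x. frechet_derivative \<phi> (at x) w)" for k
    using test_fun_smooth[OF assms, of "Suc k"] by simp
  have "frechet_derivative \<phi> (at x) w = 0" if "x \<notin> closure {x. \<phi> x \<noteq> 0}" for x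
  proof -
    have "open (- closure {x. \<phi> x \<noteq> 0})" by auto
    then have "(\<phi> has_derivative (\<lambda>_. 0)) (at x)"
      by (rule has_derivative_transform_within_open[of "\<lambda>_. 0", rotated 1])
         (use that closure_subset[of "{x. \<phi> x \<noteq> 0}"] in auto)
    then show ?thesis using frechet_derivative_at by metis
  qed
  then show "bounded {x. frechet_derivative \<phi> (at x) w \<noteq> 0}"
    by (intro bounded_subset[OF bounded_closure[OF test_fun_bounded_support[OF assms]]]) auto
qed

section \<open>Local integrability and continuous functions of bounded support\<close>

lemma continuous_bounded_support_bounded:
  fixes f :: "'a::euclidean_space \<Rightarrow> real"
  assumes "continuous_on UNIV f" "bounded {x. f x \<noteq> 0}"
  obtains B where "B > 0" "\<And>x. \<bar>f x\<bar> \<le> B"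
proof -
  have "compact (f ` closure {x. f x \<noteq> 0})"
    using assms by (intro compact_continuous_image) (auto intro: continuous_on_subset simp: compact_closure)
  then obtain B where B: "\<And>x. x \<in> closure {x. f x \<noteq> 0} \<Longrightarrow> \<bar>f x\<bar> \<le> B"
    by (force dest!: compact_imp_bounded simp: bounded_iff)
  have "\<bar>f x\<bar> \<le> max B 1" for x
    using B[of x] closure_subset[of "{x. f x \<noteq> 0}"] by (cases "f x = 0") auto
  then show ?thesis by (intro that[of "max B 1"]) auto
qed

lemma loc_integrable_mult:
  fixes u :: "'a::euclidean_space \<Rightarrow> real"
  assumes u: "loc_integrable u" and f: "continuous_on UNIV f" "bounded {x. f x \<noteq> 0}"
  shows "integrable lebesgue (\<lambda>x. u x * f x)"
proof -
  obtain B where B: "B > 0" "\<And>x. \<bar>f x\<bar> \<le> B"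
    using continuous_bounded_support_bounded[OF f] by blast
  let ?K = "closure {x. f x \<noteq> 0}"
  have "compact ?K" using f by (simp add: compact_closure)
  then have *: "integrable lebesgue (\<lambda>x. indicator ?K x * u x)"
    using u by (simp add: loc_integrable_def set_integrable_def)
  have fm: "f \<in> borel_measurable lebesgue"
    using borel_measurable_continuous_onI[OF f(1)] by (simp add: measurable_completion)
  have eq: "u x * f x = (indicator ?K x * u x) * f x" for x
    using closure_subset[of "{x. f x \<noteq> 0}"] by (cases "f x = 0") auto
  show ?thesis
  proof (rule Bochner_Integration.integrable_bound)
    show "integrable lebesgue (\<lambda>x. B * (indicator ?K x * u x))" using * by simp
    show "(\<lambda>x. u x * f x) \<in> borel_measurable lebesgue"
      unfolding eq by (intro borel_measurable_times fm borel_measurable_integrable[OF *])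
    show "AE x in lebesgue. norm (u x * f x) \<le> norm (B * (indicator ?K x * u x))"
      unfolding eq using B by (intro AE_I2) (simp add: abs_mult mult.commute mult_right_mono mult_mono)
  qed
qed

lemma continuous_loc_integrable:
  fixes f :: "'a::euclidean_space \<Rightarrow> 'b::{banach,second_countable_topology}"
  assumes "continuous_on UNIV f" shows "loc_integrable f"
  unfolding loc_integrable_def set_integrable_def
proof (intro allI impI)
  fix K :: "'a set" assume "compact K"
  then have "integrable lborel (\<lambda>x. indicator K x *\<^sub>R f x)"
    using assms by (intro borel_integrable_compact) (auto intro: continuous_on_subset)
  then show "integrable lebesgue (\<lambda>x. indicat_real K x *\<^sub>R f x)"
    by (subst integrable_completion) (auto dest: borel_measurable_integrable)
qed

lemma continuous_bounded_support_integrable: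
  fixes f :: "'a::euclidean_space \<Rightarrow> real"
  assumes "continuous_on UNIV f" "bounded {x. f x \<noteq> 0}"
  shows "integrable lebesgue f"
  using loc_integrable_mult[OF continuous_loc_integrable[of "\<lambda>_. 1"] assms] by simp

lemma test_fun_integrable:
  fixes \<phi> :: "'a::euclidean_space \<Rightarrow> real"
  shows "test_fun \<phi> \<Longrightarrow> integrable lebesgue \<phi>"
  by (intro continuous_bounded_support_integrable test_fun_continuous test_fun_bounded_support)

lemma lebesgue_integral_eq_lborel:
  fixes f :: "'a::euclidean_space \<Rightarrow> 'b::{banach,second_countable_topology}"
  assumes "f \<in> borel_measurable borel"
  shows "integral\<^sup>L lebesgue f = integral\<^sup>L lborel f"
  using assms by (intro integral_completion) simp

section \<open>Integration by parts along the horizontal fields\<close>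

lemma integral_translation:
  fixes f :: "'a::euclidean_space \<Rightarrow> real"
  assumes [measurable]: "f \<in> borel_measurable borel"
  shows "(LINT x|lborel. f (x + a)) = integral\<^sup>L lborel f"
proof -
  have "integral\<^sup>L lborel f = integral\<^sup>L (distr lborel borel ((+) a)) f"
    by (simp add: lborel_distr_plus)
  also have "\<dots> = (LINT x|lborel. f (a + x))" by (rule integral_distr) auto
  finally show ?thesis by (simp add: add.commute)
qed

text \<open>Every difference quotient has integral zero by translation invariance, and the quotients
  converge to the derivative, dominated by a constant on a fixed ball.\<close>

lemma integral_test_fun_derivative:
  fixes \<phi> :: "'a::euclidean_space \<Rightarrow> real"
  assumes \<phi>: "test_fun \<phi>"
  shows "(LINT x|lebesgue. frechet_derivative \<phi> (at x) w) = 0"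
proof -
  let ?D = "\<lambda>x. frechet_derivative \<phi> (at x) w"
  define h :: "nat \<Rightarrow> real" where "h n = inverse (real (Suc n))" for n
  define q where "q n x = (\<phi> (x + h n *\<^sub>R w) - \<phi> x) / h n" for n x
  have [measurable]: "\<phi> \<in> borel_measurable borel"
    by (intro borel_measurable_continuous_onI test_fun_continuous \<phi>)
  then have [measurable]: "q n \<in> borel_measurable borel" for n
    unfolding q_def[abs_def] by measurable
  have h: "h n > 0" "h n \<le> 1" for n by (auto simp: h_def field_simps)
  have cont: "continuous_on UNIV \<phi>" "continuous_on UNIV ?D"
    using test_fun_continuous[OF \<phi>] test_fun_continuous[OF test_fun_frechet_derivative[OF \<phi>]] .
  have [measurable]: "?D \<in> borel_measurable borel"
    using cont by (auto intro: borel_measurable_continuous_onI)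
  have int: "integrable lborel \<phi>"
    using test_fun_integrable[OF \<phi>] by (simp add: integrable_completion)
  obtain B where B: "B > 0" "\<And>x. \<bar>?D x\<bar> \<le> B"
    using continuous_bounded_support_bounded[OF cont(2)
        test_fun_bounded_support[OF test_fun_frechet_derivative[OF \<phi>]]] by blast
  obtain R where R: "\<And>x. \<phi> x \<noteq> 0 \<Longrightarrow> norm x \<le> R"
    using test_fun_bounded_support[OF \<phi>] by (auto simp: bounded_iff)
  have line: "((\<lambda>s. \<phi> (x + s *\<^sub>R w)) has_real_derivative ?D (x + s *\<^sub>R w)) (at s)" for x s
  proof -
    have "((\<lambda>s. \<phi> (x + s *\<^sub>R w)) has_derivative
        (\<lambda>r. frechet_derivative \<phi> (at (x + s *\<^sub>R w)) (r *\<^sub>R w))) (at s)"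
      by (rule has_derivative_compose[OF _ test_fun_has_derivative[OF \<phi>]])
         (auto intro!: derivative_eq_intros)
    then show ?thesis
      unfolding has_field_derivative_def
      using has_derivative_linear[OF test_fun_has_derivative[OF \<phi>, of "x + s *\<^sub>R w"]]
      by (elim has_derivative_eq_rhs) (simp add: linear_cmul fun_eq_iff mult.commute)
  qed
  have qbound: "\<bar>q n x\<bar> \<le> B" for n x
  proof -
    obtain z where "\<phi> (x + h n *\<^sub>R w) - \<phi> (x + 0 *\<^sub>R w) = (h n - 0) * ?D (x + z *\<^sub>R w)"
      using MVT2[OF h(1)[of n], of "\<lambda>s. \<phi> (x + s *\<^sub>R w)" "\<lambda>s. ?D (x + s *\<^sub>R w)"] line by metis
    then have "q n x = ?D (x + z *\<^sub>R w)" using h(1)[of n] by (simp add: q_def)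
    then show ?thesis using B by simp
  qed
  have lim: "(\<lambda>n. integral\<^sup>L lborel (q n)) \<longlonglongrightarrow> integral\<^sup>L lborel ?D"
  proof (rule integral_dominated_convergence)
    \<comment> \<open>The step sizes are at most 1, so the supports of all quotients stay within
      distance \<open>norm w\<close> of the support of \<phi>.\<close>
    let ?C = "cball (0::'a) (R + norm w)"
    show "integrable lborel (\<lambda>x. indicator ?C x *\<^sub>R B)"
      by (rule borel_integrable_compact) auto
    show "AE x in lborel. (\<lambda>n. q n x) \<longlonglongrightarrow> ?D x"
    proof (rule AE_I2)
      fix x
      have "h \<longlonglongrightarrow> 0" unfolding h_def by (rule LIMSEQ_inverse_real_of_nat)
      then have "filterlim h (at 0) sequentially"
        by (intro filterlim_atI always_eventually) (use h(1) in \<open>auto simp: less_imp_neq[symmetric]\<close>)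
      from filterlim_compose[OF line[of x 0, unfolded has_field_derivative_iff] this]
      show "(\<lambda>n. q n x) \<longlonglongrightarrow> ?D x" by (simp add: q_def)
    qed
    show "AE x in lborel. norm (q n x) \<le> indicator ?C x *\<^sub>R B" for n
    proof (rule AE_I2)
      fix x
      have "norm (h n *\<^sub>R w) \<le> norm w" using h[of n] by (simp add: mult_left_le_one_le)
      then have "\<phi> x = 0 \<and> \<phi> (x + h n *\<^sub>R w) = 0" if "x \<notin> ?C"
      proof -
        have "norm x \<le> norm (x + h n *\<^sub>R w) + norm (h n *\<^sub>R w)"
          using norm_triangle_ineq4[of "x + h n *\<^sub>R w" "h n *\<^sub>R w"] by simp
        moreover have "R + norm w < norm x" using that by (simp add: dist_norm)
        ultimately show ?thesis
          using \<open>norm (h n *\<^sub>R w) \<le> norm w\<close> R[of x] R[of "x + h n *\<^sub>R w"] norm_ge_zero[of w]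
          by linarith
      qed
      then have "x \<notin> ?C \<Longrightarrow> q n x = 0" by (simp add: q_def)
      then show "norm (q n x) \<le> indicator ?C x *\<^sub>R B"
        using qbound[of n x] B by (cases "x \<in> ?C") auto
    qed
  qed auto
  have "integral\<^sup>L lborel (q n) = 0" for n
  proof -
    have "integrable (distr lborel borel ((+) (h n *\<^sub>R w))) \<phi>"
      using int by (simp add: lborel_distr_plus)
    then have "integrable lborel (\<lambda>x. \<phi> (x + h n *\<^sub>R w))"
      by (subst (asm) integrable_distr_eq) (auto simp: add.commute)
    then show ?thesis
      unfolding q_def using int integral_translation[of \<phi>] by simp
  qed
  with lim have "integral\<^sup>L lborel ?D = 0" by (simp add: LIMSEQ_const_iff)
  then show ?thesis by (simp add: lebesgue_integral_eq_lborel)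
qed

text \<open>The field splits into a constant direction and a linear multiple of the t-direction.
  This is the shape that \<open>integral_field_derivative\<close> accepts, and it shows that the
  derivative of a test function is again one.\<close>

lemma X_deriv_eq:
  assumes "\<phi> differentiable at \<xi>"
  shows "X_deriv j \<phi> \<xi> = frechet_derivative \<phi> (at \<xi>) (axis j 1, 0, 0)
    + (2 * fst (snd \<xi>) $ j) * frechet_derivative \<phi> (at \<xi>) (0, 0, 1)"
proof -
  have "X_dir j \<xi> = (axis j 1, 0, 0) + (2 * fst (snd \<xi>) $ j) *\<^sub>R (0, 0, 1)"
    by (simp add: X_dir_def split_beta)
  then show ?thesis
    using linear_frechet_derivative[OF assms] by (simp only: X_deriv_def linear_add linear_cmul real_scaleR_def)
qed

lemma Y_deriv_eq:
  assumes "\<phi> differentiable at \<xi>"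
  shows "Y_deriv j \<phi> \<xi> = frechet_derivative \<phi> (at \<xi>) (0, axis j 1, 0)
    + (- 2 * fst \<xi> $ j) * frechet_derivative \<phi> (at \<xi>) (0, 0, 1)"
proof -
  have "Y_dir j \<xi> = (0, axis j 1, 0) + (- 2 * fst \<xi> $ j) *\<^sub>R (0, 0, 1)"
    by (simp add: Y_dir_def split_beta)
  then show ?thesis
    using linear_frechet_derivative[OF assms] by (simp only: Y_deriv_def linear_add linear_cmul real_scaleR_def)
qed

lemma test_fun_differentiable: "test_fun \<phi> \<Longrightarrow> \<phi> differentiable at \<xi>"
  using test_fun_has_derivative by (auto simp: differentiable_def)

lemma bounded_linear_coords:
  "bounded_linear (\<lambda>\<xi>::'n::finite heis. c * fst \<xi> $ j)"
  "bounded_linear (\<lambda>\<xi>::'n::finite heis. c * fst (snd \<xi>) $ j)"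
  "bounded_linear (\<lambda>\<xi>::'n::finite heis. c * snd (snd \<xi>))"
  by (auto intro!: bounded_linear_const_mult bounded_linear_compose[OF bounded_linear_vec_nth]
      bounded_linear_compose[OF bounded_linear_fst] bounded_linear_compose[OF bounded_linear_snd]
      bounded_linear_fst bounded_linear_snd)

lemma test_fun_X_deriv:
  assumes "test_fun \<phi>" shows "test_fun (X_deriv j \<phi>)"
  unfolding X_deriv_eq[OF test_fun_differentiable[OF assms], abs_def]
  by (intro test_fun_add test_fun_mult test_fun_frechet_derivative times_cont_diff_linear
      bounded_linear_coords assms)

lemma test_fun_Y_deriv:
  assumes "test_fun \<phi>" shows "test_fun (Y_deriv j \<phi>)"
  unfolding Y_deriv_eq[OF test_fun_differentiable[OF assms], abs_def]
  by (intro test_fun_add test_fun_mult test_fun_frechet_derivative times_cont_diff_linear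
      bounded_linear_coords assms)

text \<open>The coefficient is constant in the direction of the last coordinate, hence the
  derivative along the field is a divergence.\<close>

lemma integral_field_derivative:
  fixes \<phi> :: "'a::euclidean_space \<Rightarrow> real"
  assumes \<phi>: "test_fun \<phi>" and c: "bounded_linear c" "c w0 = 0"
  shows "(LINT \<xi>|lebesgue. frechet_derivative \<phi> (at \<xi>) w + c \<xi> * frechet_derivative \<phi> (at \<xi>) w0) = 0"
proof -
  have c\<phi>: "test_fun (\<lambda>\<xi>. c \<xi> * \<phi> \<xi>)"
    using \<phi> times_cont_diff_linear[OF c(1)] by (rule test_fun_mult)
  have D: "((\<lambda>\<xi>. c \<xi> * \<phi> \<xi>) has_derivative (\<lambda>h. c \<xi> * frechet_derivative \<phi> (at \<xi>) h + c h * \<phi> \<xi>)) (at \<xi>)" for \<xi>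
    by (rule has_derivative_mult[OF bounded_linear_imp_has_derivative[OF c(1)] test_fun_has_derivative[OF \<phi>]])
  have "frechet_derivative (\<lambda>\<xi>. c \<xi> * \<phi> \<xi>) (at \<xi>) w0 = c \<xi> * frechet_derivative \<phi> (at \<xi>) w0" for \<xi>
    using c(2) by (simp add: frechet_derivative_at[OF D, symmetric])
  then have "(LINT \<xi>|lebesgue. c \<xi> * frechet_derivative \<phi> (at \<xi>) w0) = 0"
    using integral_test_fun_derivative[OF c\<phi>, of w0] by simp
  moreover have "integrable lebesgue (\<lambda>\<xi>. c \<xi> * frechet_derivative \<phi> (at \<xi>) w0)"
    by (intro test_fun_integrable test_fun_mult test_fun_frechet_derivative \<phi> times_cont_diff_linear c)
  ultimately show ?thesis
    using integral_test_fun_derivative[OF \<phi>, of w] test_fun_integrable[OF test_fun_frechet_derivative[OF \<phi>]]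
    by simp
qed

lemma integral_X_deriv: "test_fun \<phi> \<Longrightarrow> (LINT \<xi>|lebesgue. X_deriv j \<phi> \<xi>) = 0"
  using integral_field_derivative[OF _ bounded_linear_coords(2)[of 2 j]]
  by (simp add: X_deriv_eq test_fun_differentiable)

lemma integral_Y_deriv: "test_fun \<phi> \<Longrightarrow> (LINT \<xi>|lebesgue. Y_deriv j \<phi> \<xi>) = 0"
  using integral_field_derivative[OF _ bounded_linear_coords(1)[of "-2" j]]
  by (simp add: Y_deriv_eq test_fun_differentiable)

lemma frechet_derivative_mult:
  fixes \<phi> \<psi> :: "'a::real_normed_vector \<Rightarrow> real"
  assumes "\<phi> differentiable at x" "\<psi> differentiable at x"
  shows "frechet_derivative (\<lambda>x. \<phi> x * \<psi> x) (at x) h =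
    \<phi> x * frechet_derivative \<psi> (at x) h + frechet_derivative \<phi> (at x) h * \<psi> x"
  by (simp add: frechet_derivative_at[OF has_derivative_mult[OF assms[unfolded frechet_derivative_works]], symmetric])

text \<open>The classical horizontal gradient, an explicit counterpart of the chosen
  \<open>hgrad\<close> on smooth functions.\<close>

definition cgrad :: "('n::finite heis \<Rightarrow> real) \<Rightarrow> 'n heis \<Rightarrow> (real ^ 'n) \<times> (real ^ 'n)" where
  "cgrad \<phi> \<xi> = (\<chi> j. X_deriv j \<phi> \<xi>, \<chi> j. Y_deriv j \<phi> \<xi>)"

lemma continuous_cgrad: "test_fun \<phi> \<Longrightarrow> continuous_on UNIV (cgrad \<phi>)"
  unfolding cgrad_def
  by (intro continuous_intros test_fun_continuous test_fun_X_deriv test_fun_Y_deriv)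

text \<open>By the product rule the horizontal derivative of \<phi> \<psi> is the sum of the two
  integrands, and its integral vanishes.\<close>

lemma is_hgrad_test_fun:
  fixes \<phi> :: "'n::finite heis \<Rightarrow> real"
  assumes \<phi>: "test_fun \<phi>"
  shows "is_hgrad \<phi> (cgrad \<phi>)"
  unfolding is_hgrad_def
proof (intro conjI allI impI)
  show "loc_integrable \<phi>" "loc_integrable (cgrad \<phi>)"
    using \<phi> by (auto intro!: continuous_loc_integrable test_fun_continuous continuous_cgrad)
next
  fix \<psi> :: "'n heis \<Rightarrow> real" and j :: 'n
  assume \<psi>: "test_fun \<psi>"
  have prod: "test_fun (\<lambda>\<xi>. \<alpha> \<xi> * \<beta> \<xi>)"
    if "test_fun \<alpha>" "test_fun \<beta>" for \<alpha> \<beta> :: "'n heis \<Rightarrow> real"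
    using that by (auto intro: test_fun_mult test_fun_smooth)
  have "X_deriv j (\<lambda>\<xi>. \<phi> \<xi> * \<psi> \<xi>) \<xi> = \<phi> \<xi> * X_deriv j \<psi> \<xi> + X_deriv j \<phi> \<xi> * \<psi> \<xi>" for \<xi>
    unfolding X_deriv_def using \<phi> \<psi> by (simp add: frechet_derivative_mult test_fun_differentiable)
  then have "(LINT \<xi>|lebesgue. \<phi> \<xi> * X_deriv j \<psi> \<xi> + X_deriv j \<phi> \<xi> * \<psi> \<xi>) = 0"
    using integral_X_deriv[OF prod[OF \<phi> \<psi>], of j] by simp
  then show "(LINT \<xi>|lebesgue. \<phi> \<xi> * X_deriv j \<psi> \<xi>) = - (LINT \<xi>|lebesgue. fst (cgrad \<phi> \<xi>) $ j * \<psi> \<xi>)"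
    by (subst (asm) Bochner_Integration.integral_add)
       (auto intro!: test_fun_integrable prod test_fun_X_deriv \<phi> \<psi> simp: cgrad_def)
  have "Y_deriv j (\<lambda>\<xi>. \<phi> \<xi> * \<psi> \<xi>) \<xi> = \<phi> \<xi> * Y_deriv j \<psi> \<xi> + Y_deriv j \<phi> \<xi> * \<psi> \<xi>" for \<xi>
    unfolding Y_deriv_def using \<phi> \<psi> by (simp add: frechet_derivative_mult test_fun_differentiable)
  then have "(LINT \<xi>|lebesgue. \<phi> \<xi> * Y_deriv j \<psi> \<xi> + Y_deriv j \<phi> \<xi> * \<psi> \<xi>) = 0"
    using integral_Y_deriv[OF prod[OF \<phi> \<psi>], of j] by simp
  then show "(LINT \<xi>|lebesgue. \<phi> \<xi> * Y_deriv j \<psi> \<xi>) = - (LINT \<xi>|lebesgue. snd (cgrad \<phi> \<xi>) $ j * \<psi> \<xi>)"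
    by (subst (asm) Bochner_Integration.integral_add)
       (auto intro!: test_fun_integrable prod test_fun_Y_deriv \<phi> \<psi> simp: cgrad_def)
qed

section \<open>The fundamental lemma of the calculus of variations\<close>

definition box_bump :: "'a::euclidean_space \<Rightarrow> 'a \<Rightarrow> 'a \<Rightarrow> real" where
  "box_bump a b x = (\<Prod>i\<in>Basis. bump 0 (x \<bullet> i - a \<bullet> i) * bump 0 (b \<bullet> i - x \<bullet> i))"

lemma box_bump_nonneg: "box_bump a b x \<ge> 0"
  unfolding box_bump_def by (intro prod_nonneg) (simp add: bump_0_nonneg)

lemma box_bump_nonzero_iff: "box_bump a b x \<noteq> 0 \<longleftrightarrow> x \<in> box a b"
proof -
  have "bump 0 r \<noteq> 0 \<longleftrightarrow> r > 0" for r
    using bump_0_pos_iff[of r] bump_0_nonneg[of r] by linarith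
  then show ?thesis by (auto simp: box_bump_def mem_box)
qed

text \<open>\<open>box_bump\<close> is positive exactly on the open box, so as k grows these
  functions increase to its indicator, which carries test-function identities over to boxes.\<close>

lemma test_fun_box_approx: "test_fun (\<lambda>x. 1 - exp (- real k * box_bump a b x))"
proof (rule test_funI)
  fix n
  have "times_cont_diff n (box_bump a b)"
    unfolding box_bump_def [abs_def]
    by (intro times_cont_diff_prod times_cont_diff_mult times_cont_diff_bump times_cont_diff_diff
        times_cont_diff_const times_cont_diff_linear bounded_linear_inner_left)
  then have "times_cont_diff n (\<lambda>x. - real k * box_bump a b x)"
    by (intro times_cont_diff_mult times_cont_diff_const)
  then have "times_cont_diff n (\<lambda>x. exp (- real k * box_bump a b x))"
    by (rule times_cont_diff_compose[of UNIV "\<lambda>_. exp", rotated 2]) auto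
  then show "times_cont_diff n (\<lambda>x. 1 - exp (- real k * box_bump a b x))"
    by (intro times_cont_diff_diff times_cont_diff_const)
  show "bounded {x. 1 - exp (- real k * box_bump a b x) \<noteq> 0}"
    by (rule bounded_subset[OF bounded_box[of a b]]) (auto simp: box_bump_nonzero_iff)
qed

lemma loc_integrable_box:
  assumes "loc_integrable G"
  shows "set_integrable lebesgue (box a b) G"
proof (rule set_integrable_subset)
  show "set_integrable lebesgue (cbox a b) G"
    using assms by (auto simp: loc_integrable_def)
qed (auto simp: box_subset_cbox)

lemma integral_box_zero:
  fixes G :: "'a::euclidean_space \<Rightarrow> real"
  assumes G: "loc_integrable G" and 0: "\<And>\<phi>. test_fun \<phi> \<Longrightarrow> (LINT x|lebesgue. G x * \<phi> x) = 0"
  shows "(LINT x:box a b|lebesgue. G x) = 0"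
proof -
  let ?\<phi> = "\<lambda>k x. 1 - exp (- real k * box_bump a b x)"
  have *: "set_integrable lebesgue (box a b) G" by (rule loc_integrable_box[OF G])
  have "(\<lambda>k. LINT x|lebesgue. G x * ?\<phi> k x) \<longlonglongrightarrow> (LINT x|lebesgue. indicator (box a b) x *\<^sub>R G x)"
  proof (rule integral_dominated_convergence)
    show "integrable lebesgue (\<lambda>x. \<bar>indicator (box a b) x *\<^sub>R G x\<bar>)"
      using * unfolding set_integrable_def by (rule integrable_abs)
    show "(\<lambda>x. indicator (box a b) x *\<^sub>R G x) \<in> borel_measurable lebesgue"
      using * unfolding set_integrable_def by (rule borel_measurable_integrable)
    show "(\<lambda>x. G x * ?\<phi> k x) \<in> borel_measurable lebesgue" for k
      using loc_integrable_mult[OF G test_fun_continuous test_fun_bounded_support] test_fun_box_approx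
      by (blast intro: borel_measurable_integrable)
    show "AE x in lebesgue. (\<lambda>k. G x * ?\<phi> k x) \<longlonglongrightarrow> indicator (box a b) x *\<^sub>R G x"
    proof (rule AE_I2)
      fix x
      show "(\<lambda>k. G x * ?\<phi> k x) \<longlonglongrightarrow> indicator (box a b) x *\<^sub>R G x"
      proof (cases "x \<in> box a b")
        case True
        then have "box_bump a b x > 0" using box_bump_nonneg[of a b x] box_bump_nonzero_iff[of a b x] by linarith
        then have "filterlim (\<lambda>k. real k * box_bump a b x) at_top sequentially"
          by (intro filterlim_at_top_mult_tendsto_pos[OF tendsto_const] filterlim_real_sequentially)
        then have "filterlim (\<lambda>k. - (real k * box_bump a b x)) at_bot sequentially"
          by (rule filterlim_compose[OF filterlim_uminus_at_bot_at_top])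
        then have "(\<lambda>k. G x * (1 - exp (- (real k * box_bump a b x)))) \<longlonglongrightarrow> G x * (1 - 0)"
          by (intro tendsto_intros filterlim_compose[OF exp_at_bot])
        then show ?thesis using True by simp
      next
        case False
        then show ?thesis using box_bump_nonzero_iff[of a b x] by simp
      qed
    qed
    show "AE x in lebesgue. norm (G x * ?\<phi> k x) \<le> \<bar>indicator (box a b) x *\<^sub>R G x\<bar>" for k
    proof (rule AE_I2)
      fix x
      show "norm (G x * ?\<phi> k x) \<le> \<bar>indicator (box a b) x *\<^sub>R G x\<bar>"
        using box_bump_nonzero_iff[of a b x] box_bump_nonneg[of a b x]
        by (cases "x \<in> box a b") (auto simp: abs_mult intro!: mult_left_le)
    qed
  qed
  then show ?thesis
    using 0[OF test_fun_box_approx] by (simp add: LIMSEQ_const_iff set_lebesgue_integral_def)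
qed

text \<open>A Dynkin argument: open boxes are closed under intersection and generate the Borel sets,
  and a density whose integral over every Borel set is 0 vanishes almost everywhere.\<close>

lemma AE_zero_if_box_integrals_zero:
  fixes G :: "'a::euclidean_space \<Rightarrow> real"
  assumes G: "integrable lborel G" and 0: "\<And>a b. (LINT x:box a b|lborel. G x) = 0"
    and univ: "integral\<^sup>L lborel G = 0"
  shows "AE x in lborel. G x = 0"
proof (rule density_unique_real[OF G])
  fix A assume "A \<in> sets (lborel :: 'a measure)"
  then have A: "A \<in> sigma_sets UNIV (range (\<lambda>(a, b). box a b :: 'a set))"
    by (simp add: borel_eq_box)
  have Is: "Int_stable (range (\<lambda>(a, b). box a b :: 'a set))"
    by (auto simp: Int_stable_def box_Int_box)
  have "range (\<lambda>(a, b). box a b :: 'a set) \<subseteq> Pow UNIV" by simp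
  from Is this A have "A \<in> sets lborel \<and> (LINT x:A|lborel. G x) = 0"
  proof (induction A rule: sigma_sets_induct_disjoint[consumes 3])
    case (basic A)
    then show ?case using 0 by auto
  next
    case empty
    then show ?case by (simp add: set_lebesgue_integral_def)
  next
    \<comment> \<open>The whole space is not a box, so its integral has to enter separately through
      \<open>univ\<close>.\<close>
    case (compl A)
    have "(LINT x:UNIV|lborel. G x) = (LINT x:A|lborel. G x) + (LINT x:UNIV - A|lborel. G x)"
      using compl integrable_mult_indicator[OF _ G]
      by (subst set_integral_Un[symmetric]) (auto simp: set_integrable_def)
    then show ?case using compl univ by (auto simp: set_lebesgue_integral_def)
  next
    case (union A)
    then have "set_integrable lborel (\<Union>i. A i) G"
      unfolding set_integrable_def by (intro integrable_mult_indicator G) auto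
    then have "(LINT x:(\<Union>i. A i)|lborel. G x) = (\<Sum>i. (LINT x:A i|lborel. G x))"
      using union by (intro lebesgue_integral_countable_add) (auto simp: disjoint_family_on_def)
    then show ?case using union by auto
  qed
  then show "(LINT x:A|lborel. G x) = (LINT x:A|lborel. 0)" by simp
qed simp

text \<open>Restricting \<open>G\<close> to growing boxes makes it integrable; intersections of
  boxes are boxes, so the restriction inherits vanishing box integrals. A Borel representative
  \<open>H\<close> is inserted because the Dynkin argument runs over Borel sets.\<close>

lemma fundamental_lemma:
  fixes G :: "'a::euclidean_space \<Rightarrow> real"
  assumes G: "loc_integrable G" and 0: "\<And>\<phi>. test_fun \<phi> \<Longrightarrow> (LINT x|lebesgue. G x * \<phi> x) = 0"
  shows "AE x in lebesgue. G x = 0"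
proof -
  have "AE x in lebesgue. indicator (box (- (real k *\<^sub>R One)) (real k *\<^sub>R One)) x *\<^sub>R G x = 0" for k
  proof -
    let ?B = "box (- (real k *\<^sub>R One)) (real k *\<^sub>R One) :: 'a set"
    let ?H = "\<lambda>x. indicator ?B x *\<^sub>R G x"
    have int: "integrable lebesgue ?H"
      using loc_integrable_box[OF G] by (simp add: set_integrable_def)
    obtain H where H: "H \<in> borel_measurable lborel" "AE x in lborel. ?H x = H x"
      using completion_ex_borel_measurable_real[OF borel_measurable_integrable[OF int]] by blast
    have H': "AE x in lebesgue. ?H x = H x" using H(2) by (rule AE_completion)
    have Hm: "H \<in> borel_measurable lebesgue" using H(1) by (rule measurable_completion)
    have "integrable lebesgue H"
      using int integrable_cong_AE[OF borel_measurable_integrable[OF int] Hm H'] by simp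
    then have Hint: "integrable lborel H" using H(1) by (simp add: integrable_completion)
    have box: "(LINT x:box a b|lborel. H x) = 0" for a b
    proof -
      have "(LINT x:box a b|lborel. H x) = (LINT x|lebesgue. indicator (box a b) x *\<^sub>R H x)"
        unfolding set_lebesgue_integral_def using H(1) by (subst integral_completion) auto
      also have "\<dots> = (LINT x|lebesgue. indicator (box a b) x *\<^sub>R ?H x)"
      proof (rule integral_cong_AE)
        show "(\<lambda>x. indicat_real (box a b) x *\<^sub>R H x) \<in> borel_measurable lebesgue"
          using Hm by (intro borel_measurable_scaleR borel_measurable_indicator) auto
        show "(\<lambda>x. indicat_real (box a b) x *\<^sub>R ?H x) \<in> borel_measurable lebesgue"
          by (rule borel_measurable_scaleR[OF borel_measurable_indicator borel_measurable_integrable[OF int]]) auto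
        show "AE x in lebesgue. indicat_real (box a b) x *\<^sub>R H x = indicat_real (box a b) x *\<^sub>R ?H x"
          using H' by eventually_elim simp
      qed
      also have "\<dots> = (LINT x:(box a b \<inter> ?B)|lebesgue. G x)"
        unfolding set_lebesgue_integral_def by (simp add: indicator_inter_arith mult.assoc)
      also have "\<dots> = 0" unfolding box_Int_box by (rule integral_box_zero[OF assms])
      finally show ?thesis .
    qed
    have "integral\<^sup>L lborel H = integral\<^sup>L lebesgue H" using H(1) by (simp add: integral_completion)
    also have "\<dots> = integral\<^sup>L lebesgue ?H"
      using H' by (intro integral_cong_AE Hm borel_measurable_integrable[OF int]) (auto elim: eventually_mono)
    also have "\<dots> = 0" using integral_box_zero[OF assms] by (simp add: set_lebesgue_integral_def)
    finally have "AE x in lborel. H x = 0"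
      by (intro AE_zero_if_box_integrals_zero Hint box)
    then have "AE x in lebesgue. H x = 0" by (rule AE_completion)
    with H' show ?thesis by eventually_elim simp
  qed
  then have "AE x in lebesgue. \<forall>k. indicator (box (- (real k *\<^sub>R One)) (real k *\<^sub>R One)) x *\<^sub>R G x = 0"
    unfolding AE_all_countable by blast
  then show ?thesis
  proof eventually_elim
    case (elim x)
    have "x \<in> (\<Union>k. box (- (real k *\<^sub>R One)) (real k *\<^sub>R One))"
      using UN_box_eq_UNIV by blast
    then obtain k :: nat where "x \<in> box (- (real k *\<^sub>R One)) (real k *\<^sub>R One)" by blast
    then show ?case using spec[OF elim, of k] by simp
  qed
qed

section \<open>Weak horizontal gradients and the space of finite energy\<close>

lemma hgrad_is_hgrad: "\<exists>G. is_hgrad u G \<Longrightarrow> is_hgrad u (hgrad u)"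
  unfolding hgrad_def by (rule someI_ex[of "is_hgrad u"])

lemma loc_integrable_bounded_linear:
  assumes "bounded_linear T" "loc_integrable G"
  shows "loc_integrable (\<lambda>x. T (G x))"
proof -
  interpret bounded_linear T by fact
  show ?thesis
    using assms integrable_bounded_linear[OF assms(1), of lebesgue "\<lambda>x. indicator K x *\<^sub>R G x" for K]
    by (auto simp: loc_integrable_def set_integrable_def scaleR)
qed

lemma loc_integrable_diff:
  "loc_integrable f \<Longrightarrow> loc_integrable g \<Longrightarrow> loc_integrable (\<lambda>x. f x - g x)"
  by (simp add: loc_integrable_def set_integral_diff)

lemma bounded_linear_components:
  "bounded_linear (\<lambda>G::(real ^ 'n::finite) \<times> (real ^ 'n). fst G $ j)"
  "bounded_linear (\<lambda>G::(real ^ 'n::finite) \<times> (real ^ 'n). snd G $ j)"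
  by (auto intro!: bounded_linear_compose[OF bounded_linear_vec_nth] bounded_linear_fst bounded_linear_snd)

lemma is_hgradD:
  assumes "is_hgrad u G" "test_fun \<phi>"
  shows "(LINT \<xi>|lebesgue. fst (G \<xi>) $ j * \<phi> \<xi>) = - (LINT \<xi>|lebesgue. u \<xi> * X_deriv j \<phi> \<xi>)"
    "(LINT \<xi>|lebesgue. snd (G \<xi>) $ j * \<phi> \<xi>) = - (LINT \<xi>|lebesgue. u \<xi> * Y_deriv j \<phi> \<xi>)"
  using assms unfolding is_hgrad_def by auto

text \<open>Each component of the difference of two weak gradients is orthogonal to all test
  functions. This is what allows computing with the unspecified choice \<open>hgrad\<close>.\<close>

lemma is_hgrad_unique:
  fixes u :: "'n::finite heis \<Rightarrow> real"
  assumes G: "is_hgrad u G" and H: "is_hgrad u H"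
  shows "AE \<xi> in lebesgue. G \<xi> = H \<xi>"
proof -
  have li: "loc_integrable (\<lambda>\<xi>. fst (G \<xi>) $ j)" "loc_integrable (\<lambda>\<xi>. snd (G \<xi>) $ j)"
    "loc_integrable (\<lambda>\<xi>. fst (H \<xi>) $ j)" "loc_integrable (\<lambda>\<xi>. snd (H \<xi>) $ j)" for j
    using G H loc_integrable_bounded_linear[OF bounded_linear_components(1)[of j]]
      loc_integrable_bounded_linear[OF bounded_linear_components(2)[of j]]
    by (auto simp: is_hgrad_def)
  have "AE \<xi> in lebesgue. fst (G \<xi>) $ j - fst (H \<xi>) $ j = 0" for j
  proof (rule fundamental_lemma[OF loc_integrable_diff[OF li(1,3)]])
    fix \<phi> :: "'n heis \<Rightarrow> real" assume \<phi>: "test_fun \<phi>"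
    note i = loc_integrable_mult[OF _ test_fun_continuous[OF \<phi>] test_fun_bounded_support[OF \<phi>]]
    have "(LINT \<xi>|lebesgue. fst (G \<xi>) $ j * \<phi> \<xi>) = (LINT \<xi>|lebesgue. fst (H \<xi>) $ j * \<phi> \<xi>)"
      using is_hgradD[OF G \<phi>] is_hgradD[OF H \<phi>] by simp
    then show "(LINT \<xi>|lebesgue. (fst (G \<xi>) $ j - fst (H \<xi>) $ j) * \<phi> \<xi>) = 0"
      using i[OF li(1)] i[OF li(3)] by (simp add: left_diff_distrib)
  qed
  moreover have "AE \<xi> in lebesgue. snd (G \<xi>) $ j - snd (H \<xi>) $ j = 0" for j
  proof (rule fundamental_lemma[OF loc_integrable_diff[OF li(2,4)]])
    fix \<phi> :: "'n heis \<Rightarrow> real" assume \<phi>: "test_fun \<phi>"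
    note i = loc_integrable_mult[OF _ test_fun_continuous[OF \<phi>] test_fun_bounded_support[OF \<phi>]]
    have "(LINT \<xi>|lebesgue. snd (G \<xi>) $ j * \<phi> \<xi>) = (LINT \<xi>|lebesgue. snd (H \<xi>) $ j * \<phi> \<xi>)"
      using is_hgradD[OF G \<phi>] is_hgradD[OF H \<phi>] by simp
    then show "(LINT \<xi>|lebesgue. (snd (G \<xi>) $ j - snd (H \<xi>) $ j) * \<phi> \<xi>) = 0"
      using i[OF li(2)] i[OF li(4)] by (simp add: left_diff_distrib)
  qed
  ultimately have "AE \<xi> in lebesgue. \<forall>j. fst (G \<xi>) $ j - fst (H \<xi>) $ j = 0 \<and> snd (G \<xi>) $ j - snd (H \<xi>) $ j = 0"
    by (intro eventually_all_finite eventually_conj)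
  then show ?thesis by eventually_elim (simp add: prod_eq_iff vec_eq_iff)
qed

lemma hgrad_test_fun: "test_fun \<phi> \<Longrightarrow> AE \<xi> in lebesgue. hgrad \<phi> \<xi> = cgrad \<phi> \<xi>"
  using is_hgrad_unique[OF hgrad_is_hgrad] is_hgrad_test_fun by blast

lemma borel_measurable_hgrad:
  assumes "\<exists>G. is_hgrad u G" shows "hgrad u \<in> borel_measurable lebesgue"
proof -
  have *: "loc_integrable (hgrad u)" using hgrad_is_hgrad[OF assms] by (simp add: is_hgrad_def)
  show ?thesis
  proof (rule borel_measurable_LIMSEQ_metric)
    show "(\<lambda>\<xi>. indicator (cball 0 (real k)) \<xi> *\<^sub>R hgrad u \<xi>) \<in> borel_measurable lebesgue" for k
      using * by (auto simp: loc_integrable_def set_integrable_def intro: borel_measurable_integrable)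
    show "(\<lambda>k. indicator (cball 0 (real k)) \<xi> *\<^sub>R hgrad u \<xi>) \<longlonglongrightarrow> hgrad u \<xi>" for \<xi>
    proof (rule tendsto_eventually)
      obtain K :: nat where "norm \<xi> \<le> real K" using real_arch_simple by blast
      then show "\<forall>\<^sub>F k in sequentially. indicator (cball 0 (real k)) \<xi> *\<^sub>R hgrad u \<xi> = hgrad u \<xi>"
        by (intro eventually_sequentiallyI[of K]) (auto simp: indicator_def)
    qed
  qed
qed

lemma crit_exp_eq: "crit_exp TYPE('n::finite) = 2 + 2 / real CARD('n)"
  by (simp add: crit_exp_def hom_dim_def field_simps)

lemma test_fun_Lp:
  fixes \<phi> :: "'a::euclidean_space \<Rightarrow> real"
  assumes \<phi>: "test_fun \<phi>" and p: "p > 0"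
  shows "integrable lebesgue (\<lambda>\<xi>. \<bar>\<phi> \<xi>\<bar> powr p)"
proof (rule continuous_bounded_support_integrable)
  show "continuous_on UNIV (\<lambda>\<xi>. \<bar>\<phi> \<xi>\<bar> powr p)"
    using p test_fun_continuous[OF \<phi>]
    by (intro continuous_on_powr' continuous_on_rabs continuous_on_const) auto
  show "bounded {\<xi>. \<bar>\<phi> \<xi>\<bar> powr p \<noteq> 0}"
    using p by (intro bounded_subset[OF test_fun_bounded_support[OF \<phi>]]) auto
qed

text \<open>A test function is approximated by the constant sequence of itself. The lemma makes test
  functions admissible in \<open>weak_solution\<close>.\<close>

lemma test_fun_D12:
  fixes \<phi> :: "'n::finite heis \<Rightarrow> real"
  assumes \<phi>: "test_fun \<phi>"
  shows "\<phi> \<in> D12"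
proof -
  have ex: "\<exists>G. is_hgrad \<phi> G" using is_hgrad_test_fun[OF \<phi>] by blast
  have "integrable lebesgue (\<lambda>\<xi>. (norm (cgrad \<phi> \<xi>))\<^sup>2)"
  proof (rule continuous_bounded_support_integrable)
    show "continuous_on UNIV (\<lambda>\<xi>. (norm (cgrad \<phi> \<xi>))\<^sup>2)"
      by (intro continuous_intros continuous_cgrad \<phi>)
    show "bounded {\<xi>. (norm (cgrad \<phi> \<xi>))\<^sup>2 \<noteq> 0}"
      by (rule bounded_subset[of "(\<Union>j. {\<xi>. X_deriv j \<phi> \<xi> \<noteq> 0}) \<union> (\<Union>j. {\<xi>. Y_deriv j \<phi> \<xi> \<noteq> 0})"])
         (use \<phi> in \<open>auto simp: cgrad_def prod_eq_iff vec_eq_iff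
           intro!: test_fun_bounded_support test_fun_X_deriv test_fun_Y_deriv\<close>)
  qed
  moreover have "AE \<xi> in lebesgue. (norm (cgrad \<phi> \<xi>))\<^sup>2 = (norm (hgrad \<phi> \<xi>))\<^sup>2"
    using hgrad_test_fun[OF \<phi>] by eventually_elim simp
  moreover have "(\<lambda>\<xi>. (norm (hgrad \<phi> \<xi>))\<^sup>2) \<in> borel_measurable lebesgue"
    using borel_measurable_hgrad[OF ex] by measurable
  ultimately have "integrable lebesgue (\<lambda>\<xi>. (norm (hgrad \<phi> \<xi>))\<^sup>2)"
    using integrable_cong_AE_imp by blast
  moreover have "D_norm (\<lambda>\<xi>. \<phi> \<xi> - \<phi> \<xi>) = 0"
  proof -
    \<comment> \<open>Even the gradient of the zero function is a choice and is known to vanish only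
      almost everywhere.\<close>
    have 0: "test_fun (\<lambda>_::'n heis. 0)" by (rule test_funI) auto
    have "AE \<xi> in lebesgue. (norm (hgrad (\<lambda>_::'n heis. 0) \<xi>))\<^sup>2 = 0"
      using hgrad_test_fun[OF 0]
      by eventually_elim (simp add: cgrad_def X_deriv_def Y_deriv_def zero_prod_def zero_vec_def)
    then show ?thesis by (simp add: D_norm_def integral_eq_zero_AE)
  qed
  moreover have "Lp_fun (crit_exp TYPE('n)) \<phi>"
    unfolding Lp_fun_def using test_fun_Lp[OF \<phi>] borel_measurable_integrable[OF test_fun_integrable[OF \<phi>]]
    by (simp add: crit_exp_eq add_pos_nonneg)
  ultimately show ?thesis
    unfolding D12_def using ex \<phi> by (auto intro!: exI[of _ "\<lambda>_. \<phi>"])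
qed

section \<open>The weak equation with both derivatives on the test function\<close>

definition hlap :: "('n::finite heis \<Rightarrow> real) \<Rightarrow> 'n heis \<Rightarrow> real" where
  "hlap \<phi> \<xi> = (\<Sum>j\<in>UNIV. X_deriv j (X_deriv j \<phi>) \<xi> + Y_deriv j (Y_deriv j \<phi>) \<xi>)"

lemma test_fun_hlap:
  fixes \<phi> :: "'n::finite heis \<Rightarrow> real"
  assumes \<phi>: "test_fun \<phi>" shows "test_fun (hlap \<phi>)"
proof -
  have "test_fun (\<lambda>\<eta>. \<Sum>j\<in>A. X_deriv j (X_deriv j \<phi>) \<eta> + Y_deriv j (Y_deriv j \<phi>) \<eta>)" for A :: "'n set"
    by (induction A rule: infinite_finite_induct)
       (auto intro!: test_fun_add test_fun_X_deriv test_fun_Y_deriv \<phi> intro: test_funI)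
  then show ?thesis unfolding hlap_def[abs_def] .
qed

text \<open>The definition of the weak gradient is applied to the test functions
  \<open>X_deriv j \<phi>\<close> and \<open>Y_deriv j \<phi>\<close>; the resulting pairing of
  gradients is the left side of the weak equation, once \<open>hgrad \<phi>\<close> is identified
  with \<open>cgrad \<phi>\<close>.\<close>

lemma weak_solution_hlap:
  assumes u: "weak_solution g f a u" and \<phi>: "test_fun \<phi>"
  shows "(LINT \<xi>|lebesgue. u \<xi> * hlap \<phi> \<xi>) = - (LINT \<xi>|lebesgue. g \<xi> * f_shift f a (u \<xi>) * \<phi> \<xi>)"
proof -
  let ?G = "hgrad u"
  have ex: "\<exists>G. is_hgrad u G" "\<exists>G. is_hgrad \<phi> G"
    using u is_hgrad_test_fun[OF \<phi>] by (auto simp: weak_solution_def D12_def)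
  have G: "is_hgrad u ?G" by (rule hgrad_is_hgrad[OF ex(1)])
  have li: "loc_integrable (\<lambda>\<xi>. fst (?G \<xi>) $ j)" "loc_integrable (\<lambda>\<xi>. snd (?G \<xi>) $ j)" for j
    using G loc_integrable_bounded_linear[OF bounded_linear_components(1)[of j]]
      loc_integrable_bounded_linear[OF bounded_linear_components(2)[of j]]
    by (auto simp: is_hgrad_def)
  have lu: "loc_integrable u" using G by (simp add: is_hgrad_def)
  have i: "integrable lebesgue (\<lambda>\<xi>. w \<xi> * \<psi> \<xi>)" if "loc_integrable w" "test_fun \<psi>" for w \<psi> :: "_ \<Rightarrow> real"
    using loc_integrable_mult that test_fun_continuous test_fun_bounded_support by blast
  note tf = test_fun_X_deriv[OF \<phi>] test_fun_Y_deriv[OF \<phi>]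
    test_fun_X_deriv[OF test_fun_X_deriv[OF \<phi>]] test_fun_Y_deriv[OF test_fun_Y_deriv[OF \<phi>]]
  have "(LINT \<xi>|lebesgue. u \<xi> * hlap \<phi> \<xi>) =
      (\<Sum>j\<in>UNIV. (LINT \<xi>|lebesgue. u \<xi> * X_deriv j (X_deriv j \<phi>) \<xi>) + (LINT \<xi>|lebesgue. u \<xi> * Y_deriv j (Y_deriv j \<phi>) \<xi>))"
    unfolding hlap_def sum_distrib_left distrib_left
    by (simp add: Bochner_Integration.integral_sum i[OF lu] tf)
  also have "\<dots> = - (\<Sum>j\<in>UNIV. (LINT \<xi>|lebesgue. fst (?G \<xi>) $ j * X_deriv j \<phi> \<xi>) + (LINT \<xi>|lebesgue. snd (?G \<xi>) $ j * Y_deriv j \<phi> \<xi>))"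
    using G tf by (simp add: is_hgrad_def sum_negf[symmetric])
  also have "(\<Sum>j\<in>UNIV. (LINT \<xi>|lebesgue. fst (?G \<xi>) $ j * X_deriv j \<phi> \<xi>) + (LINT \<xi>|lebesgue. snd (?G \<xi>) $ j * Y_deriv j \<phi> \<xi>))
      = (LINT \<xi>|lebesgue. ?G \<xi> \<bullet> cgrad \<phi> \<xi>)"
    by (simp add: Bochner_Integration.integral_sum i li tf inner_prod_def inner_vec_def cgrad_def sum.distrib)
  also have "\<dots> = (LINT \<xi>|lebesgue. ?G \<xi> \<bullet> hgrad \<phi> \<xi>)"
  proof (rule integral_cong_AE)
    show "(\<lambda>\<xi>. ?G \<xi> \<bullet> hgrad \<phi> \<xi>) \<in> borel_measurable lebesgue"
      using borel_measurable_hgrad[OF ex(1)] borel_measurable_hgrad[OF ex(2)] by measurable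
    show "(\<lambda>\<xi>. ?G \<xi> \<bullet> cgrad \<phi> \<xi>) \<in> borel_measurable lebesgue"
      using borel_measurable_hgrad[OF ex(1)]
      by (rule borel_measurable_inner)
         (use borel_measurable_continuous_onI[OF continuous_cgrad[OF \<phi>]] in \<open>simp add: measurable_completion\<close>)
    show "AE \<xi> in lebesgue. ?G \<xi> \<bullet> cgrad \<phi> \<xi> = ?G \<xi> \<bullet> hgrad \<phi> \<xi>"
      using hgrad_test_fun[OF \<phi>] by eventually_elim simp
  qed
  also have "\<dots> = (LINT \<xi>|lebesgue. g \<xi> * f_shift f a (u \<xi>) * \<phi> \<xi>)"
    using u test_fun_D12[OF \<phi>] by (simp add: weak_solution_def)
  finally show ?thesis .
qed

section \<open>The gauge and the truncated fundamental solution\<close>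

text \<open>\<open>hmul\<close> is the group law and \<open>hdiff \<xi> \<eta>\<close> is the product of the inverse of \<open>\<xi>\<close> with \<open>\<eta>\<close>.\<close>

definition hdiff :: "'n::finite heis \<Rightarrow> 'n heis \<Rightarrow> 'n heis" where
  "hdiff = (\<lambda>(x, y, t) (x', y', t'). (x' - x, y' - y, t' - t - 2 * (x' \<bullet> y - y' \<bullet> x)))"

definition hmul :: "'n::finite heis \<Rightarrow> 'n heis \<Rightarrow> 'n heis" where
  "hmul = (\<lambda>(x, y, t) (x', y', t'). (x + x', y + y', t + t' + 2 * (x' \<bullet> y - y' \<bullet> x)))"

lemma hdiff_hmul [simp]: "hdiff \<xi> (hmul \<xi> \<zeta>) = \<zeta>"
  by (cases \<xi>; cases \<zeta>) (simp add: hdiff_def hmul_def inner_left_distrib inner_right_distrib inner_commute algebra_simps)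

lemma hmul_hdiff [simp]: "hmul \<xi> (hdiff \<xi> \<eta>) = \<eta>"
  by (cases \<xi>; cases \<eta>) (simp add: hdiff_def hmul_def inner_diff_left inner_diff_right inner_commute algebra_simps)

text \<open>For e = 0 this is the fourth power of the Koranyi gauge. The regularization shifts only
  |z|^2, which removes the zero at the origin and keeps a closed formula for the
  sub-Laplacian.\<close>

definition hgauge :: "real \<Rightarrow> 'n::finite heis \<Rightarrow> real" where
  "hgauge e = (\<lambda>(x, y, t). (x \<bullet> x + y \<bullet> y + e)\<^sup>2 + t\<^sup>2)"

text \<open>Exchanging the points inverts the group element, inversion is negation in these
  coordinates, and the gauge is even.\<close>

lemma hgauge_hdiff_commute: "hgauge e (hdiff \<xi> \<eta>) = hgauge e (hdiff \<eta> \<xi>)"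
proof -
  have "hdiff \<eta> \<xi> = - hdiff \<xi> \<eta>"
    by (simp add: hdiff_def split_beta inner_commute)
  then show ?thesis by (simp add: hgauge_def split_beta)
qed

lemma hgauge_ge:
  assumes "e \<ge> 0" shows "(fst \<zeta> \<bullet> fst \<zeta> + fst (snd \<zeta>) \<bullet> fst (snd \<zeta>))\<^sup>2 \<le> hgauge e \<zeta>" "e\<^sup>2 \<le> hgauge e \<zeta>"
proof -
  have "(fst \<zeta> \<bullet> fst \<zeta> + fst (snd \<zeta>) \<bullet> fst (snd \<zeta>))\<^sup>2 \<le> (fst \<zeta> \<bullet> fst \<zeta> + fst (snd \<zeta>) \<bullet> fst (snd \<zeta>) + e)\<^sup>2"
    "e\<^sup>2 \<le> (fst \<zeta> \<bullet> fst \<zeta> + fst (snd \<zeta>) \<bullet> fst (snd \<zeta>) + e)\<^sup>2"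
    using assms by (auto intro!: power_mono)
  then show "(fst \<zeta> \<bullet> fst \<zeta> + fst (snd \<zeta>) \<bullet> fst (snd \<zeta>))\<^sup>2 \<le> hgauge e \<zeta>" "e\<^sup>2 \<le> hgauge e \<zeta>"
    by (simp_all add: hgauge_def split_beta add_increasing2)
qed

lemma hgauge_pos: "e > 0 \<Longrightarrow> hgauge e \<zeta> > 0"
  using hgauge_ge(2)[of e \<zeta>] zero_less_power[of e 2] by linarith

lemma hgauge_nonneg: "hgauge e \<zeta> \<ge> 0"
  by (simp add: hgauge_def split_beta)

lemma hgauge_mono: "0 \<le> e \<Longrightarrow> e \<le> e' \<Longrightarrow> hgauge e \<zeta> \<le> hgauge e' \<zeta>"
  by (auto simp: hgauge_def split_beta intro!: power_mono)

lemma hdiff_affine: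
  "hdiff (x, y, t) \<eta> = (fst \<eta>, fst (snd \<eta>), snd (snd \<eta>) - 2 * (fst \<eta> \<bullet> y - fst (snd \<eta>) \<bullet> x)) - (x, y, t)"
  by (simp add: hdiff_def split_beta)

lemma hdiff_has_derivative:
  "(hdiff (x, y, t) has_derivative (\<lambda>h. (fst h, fst (snd h), snd (snd h) - 2 * (fst h \<bullet> y - fst (snd h) \<bullet> x)))) (at \<eta>)"
  unfolding hdiff_affine by (auto intro!: derivative_eq_intros)

lemma hmul_continuous: "continuous_on UNIV (hmul \<xi>)"
  unfolding hmul_def by (cases \<xi>) (auto simp: split_beta intro!: continuous_intros)

lemma hgauge_has_derivative:
  "(hgauge e has_derivative (\<lambda>h. 4 * (fst \<zeta> \<bullet> fst \<zeta> + fst (snd \<zeta>) \<bullet> fst (snd \<zeta>) + e) *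
     (fst \<zeta> \<bullet> fst h + fst (snd \<zeta>) \<bullet> fst (snd h)) + 2 * snd (snd \<zeta>) * snd (snd h))) (at \<zeta>)"
  unfolding hgauge_def split_beta
  by (auto intro!: derivative_eq_intros simp: inner_commute fun_eq_iff algebra_simps)

text \<open>Left invariance of the fields: the derivative of \<open>hdiff \<xi>\<close> carries the
  direction of the field at \<eta> to its direction at \<open>hdiff \<xi> \<eta>\<close>, because
  the shear lowers the last coordinate by exactly the difference of the coefficients.\<close>

lemma horizontal_deriv_hdiff:
  assumes "F differentiable at (hdiff \<xi> \<eta>)"
  shows "X_deriv j (\<lambda>\<eta>. F (hdiff \<xi> \<eta>)) \<eta> = X_deriv j F (hdiff \<xi> \<eta>)"
    "Y_deriv j (\<lambda>\<eta>. F (hdiff \<xi> \<eta>)) \<eta> = Y_deriv j F (hdiff \<xi> \<eta>)"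
proof -
  obtain x y t where \<xi>: "\<xi> = (x, y, t)" by (cases \<xi>)
  have F: "(F has_derivative frechet_derivative F (at (hdiff \<xi> \<eta>))) (at (hdiff \<xi> \<eta>))"
    using assms by (simp add: frechet_derivative_works)
  note d = frechet_derivative_at[OF has_derivative_compose[OF hdiff_has_derivative F[unfolded \<xi>]], symmetric]
  show "X_deriv j (\<lambda>\<eta>. F (hdiff \<xi> \<eta>)) \<eta> = X_deriv j F (hdiff \<xi> \<eta>)"
    unfolding X_deriv_def \<xi> d
    by (cases \<eta>) (simp add: X_dir_def hdiff_def inner_axis' algebra_simps)
  show "Y_deriv j (\<lambda>\<eta>. F (hdiff \<xi> \<eta>)) \<eta> = Y_deriv j F (hdiff \<xi> \<eta>)"
    unfolding Y_deriv_def \<xi> d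
    by (cases \<eta>) (simp add: Y_dir_def hdiff_def inner_axis' algebra_simps)
qed

lemma hlap_hdiff:
  assumes "\<And>\<zeta>. F differentiable at \<zeta>" "\<And>j \<zeta>. X_deriv j F differentiable at \<zeta>" "\<And>j \<zeta>. Y_deriv j F differentiable at \<zeta>"
  shows "hlap (\<lambda>\<eta>. F (hdiff \<xi> \<eta>)) \<eta> = hlap F (hdiff \<xi> \<eta>)"
proof -
  have "X_deriv j (\<lambda>\<eta>. F (hdiff \<xi> \<eta>)) = (\<lambda>\<eta>. X_deriv j F (hdiff \<xi> \<eta>))"
    "Y_deriv j (\<lambda>\<eta>. F (hdiff \<xi> \<eta>)) = (\<lambda>\<eta>. Y_deriv j F (hdiff \<xi> \<eta>))" for j
    by (rule ext, rule horizontal_deriv_hdiff[OF assms(1)])+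
  then show ?thesis using assms by (simp add: hlap_def horizontal_deriv_hdiff)
qed

lemma X_deriv_eqI: "(\<phi> has_derivative D) (at \<xi>) \<Longrightarrow> X_deriv j \<phi> \<xi> = D (X_dir j \<xi>)"
  by (simp add: X_deriv_def frechet_derivative_at[symmetric])

lemma Y_deriv_eqI: "(\<phi> has_derivative D) (at \<xi>) \<Longrightarrow> Y_deriv j \<phi> \<xi> = D (Y_dir j \<xi>)"
  by (simp add: Y_deriv_def frechet_derivative_at[symmetric])

text \<open>On functions of the gauge the sub-Laplacian is an ordinary differential operator up to the
  factor \<open>|z|\<^sup>2\<close>; the power \<open>s powr (- N / 2)\<close> annihilates the part that survives at \<open>e = 0\<close>.\<close>

lemma hlap_hgauge:
  fixes \<zeta> :: "'n::finite heis"
  assumes e: "e > 0"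
    and h: "\<And>s. s > 0 \<Longrightarrow> (h0 has_real_derivative h1 s) (at s)" "\<And>s. s > 0 \<Longrightarrow> (h1 has_real_derivative h2 s) (at s)"
  defines "r \<equiv> fst \<zeta> \<bullet> fst \<zeta> + fst (snd \<zeta>) \<bullet> fst (snd \<zeta>)" and "s \<equiv> hgauge e \<zeta>"
  shows "hlap (\<lambda>\<zeta>. h0 (hgauge e \<zeta>)) \<zeta> =
    16 * r * (s * h2 s + (1 + real CARD('n) / 2) * h1 s) + 8 * real CARD('n) * e * h1 s" (is ?lap)
    and "(\<lambda>\<zeta>. h0 (hgauge e \<zeta>)) differentiable at \<zeta>"
    and "X_deriv j (\<lambda>\<zeta>. h0 (hgauge e \<zeta>)) differentiable at \<zeta>"
    and "Y_deriv j (\<lambda>\<zeta>. h0 (hgauge e \<zeta>)) differentiable at \<zeta>"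
proof -
  define R :: "'n heis \<Rightarrow> real" where "R \<zeta> = fst \<zeta> \<bullet> fst \<zeta> + fst (snd \<zeta>) \<bullet> fst (snd \<zeta>) + e" for \<zeta>
  define G where "G \<zeta> h = 4 * R \<zeta> * (fst \<zeta> \<bullet> fst h + fst (snd \<zeta>) \<bullet> fst (snd h)) + 2 * snd (snd \<zeta>) * snd (snd h)" for \<zeta> h :: "'n heis"
  define x y t where "x \<zeta> j = fst \<zeta> $ j" and "y \<zeta> j = fst (snd \<zeta>) $ j" and "t \<zeta> = snd (snd \<zeta>)" for \<zeta> :: "'n heis" and j
  have dg: "(hgauge e has_derivative G \<zeta>) (at \<zeta>)" for \<zeta>
    using hgauge_has_derivative[of e \<zeta>] by (simp add: G_def[abs_def] R_def)
  have dh: "((\<lambda>\<zeta>. h0 (hgauge e \<zeta>)) has_derivative (\<lambda>w. G \<zeta> w * h1 (hgauge e \<zeta>))) (at \<zeta>)"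
    "((\<lambda>\<zeta>. h1 (hgauge e \<zeta>)) has_derivative (\<lambda>w. G \<zeta> w * h2 (hgauge e \<zeta>))) (at \<zeta>)" for \<zeta>
    by (rule DERIV_compose_FDERIV[OF h(1)[OF hgauge_pos[OF e]] dg],
        rule DERIV_compose_FDERIV[OF h(2)[OF hgauge_pos[OF e]] dg])
  have GX: "G \<zeta> (X_dir j \<zeta>) = 4 * (R \<zeta> * x \<zeta> j + t \<zeta> * y \<zeta> j)"
    and GY: "G \<zeta> (Y_dir j \<zeta>) = 4 * (R \<zeta> * y \<zeta> j - t \<zeta> * x \<zeta> j)" for \<zeta> j
    by (simp_all add: G_def X_dir_def Y_dir_def split_beta inner_axis x_def y_def t_def algebra_simps)
  have dR: "(R has_derivative (\<lambda>h. 2 * (fst \<zeta> \<bullet> fst h + fst (snd \<zeta>) \<bullet> fst (snd h)))) (at \<zeta>)" for \<zeta>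
    unfolding R_def[abs_def] by (auto intro!: derivative_eq_intros simp: inner_commute fun_eq_iff)
  have dx: "((\<lambda>\<zeta>. x \<zeta> j) has_derivative (\<lambda>h. fst h $ j)) (at \<zeta>)"
    "((\<lambda>\<zeta>. y \<zeta> j) has_derivative (\<lambda>h. fst (snd h) $ j)) (at \<zeta>)"
    "(t has_derivative (\<lambda>h. snd (snd h))) (at \<zeta>)" for \<zeta> j
    unfolding x_def y_def t_def[abs_def]
    by (auto intro!: derivative_eq_intros bounded_linear.has_derivative[OF bounded_linear_vec_nth])
  have XE: "X_deriv j (\<lambda>\<zeta>. h0 (hgauge e \<zeta>)) = (\<lambda>\<zeta>. 4 * (R \<zeta> * x \<zeta> j + t \<zeta> * y \<zeta> j) * h1 (hgauge e \<zeta>))"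
    and YE: "Y_deriv j (\<lambda>\<zeta>. h0 (hgauge e \<zeta>)) = (\<lambda>\<zeta>. 4 * (R \<zeta> * y \<zeta> j - t \<zeta> * x \<zeta> j) * h1 (hgauge e \<zeta>))" for j
    using X_deriv_eqI[OF dh(1)] Y_deriv_eqI[OF dh(1)] by (auto simp: GX GY fun_eq_iff)
  have dX: "(X_deriv j (\<lambda>\<zeta>. h0 (hgauge e \<zeta>)) has_derivative
      (\<lambda>w. 4 * (R \<zeta> * x \<zeta> j + t \<zeta> * y \<zeta> j) * (G \<zeta> w * h2 (hgauge e \<zeta>)) +
        4 * (R \<zeta> * fst w $ j + 2 * (fst \<zeta> \<bullet> fst w + fst (snd \<zeta>) \<bullet> fst (snd w)) * x \<zeta> j
          + (t \<zeta> * fst (snd w) $ j + snd (snd w) * y \<zeta> j)) * h1 (hgauge e \<zeta>))) (at \<zeta>)" for \<zeta> j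
    unfolding XE
    by (intro has_derivative_mult has_derivative_mult_right has_derivative_add dR dx dh)
  have dY: "(Y_deriv j (\<lambda>\<zeta>. h0 (hgauge e \<zeta>)) has_derivative
      (\<lambda>w. 4 * (R \<zeta> * y \<zeta> j - t \<zeta> * x \<zeta> j) * (G \<zeta> w * h2 (hgauge e \<zeta>)) +
        4 * (R \<zeta> * fst (snd w) $ j + 2 * (fst \<zeta> \<bullet> fst w + fst (snd \<zeta>) \<bullet> fst (snd w)) * y \<zeta> j
          - (t \<zeta> * fst w $ j + snd (snd w) * x \<zeta> j)) * h1 (hgauge e \<zeta>))) (at \<zeta>)" for \<zeta> j
    unfolding YE
    by (intro has_derivative_mult has_derivative_mult_right has_derivative_diff dR dx dh)
  show "(\<lambda>\<zeta>. h0 (hgauge e \<zeta>)) differentiable at \<zeta>"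
    "X_deriv j (\<lambda>\<zeta>. h0 (hgauge e \<zeta>)) differentiable at \<zeta>"
    "Y_deriv j (\<lambda>\<zeta>. h0 (hgauge e \<zeta>)) differentiable at \<zeta>"
    using dh(1) dX dY unfolding differentiable_def by blast+
  have XX: "X_deriv j (X_deriv j (\<lambda>\<zeta>. h0 (hgauge e \<zeta>))) \<zeta> =
      16 * (R \<zeta> * x \<zeta> j + t \<zeta> * y \<zeta> j)\<^sup>2 * h2 s + 4 * (R \<zeta> + 2 * (x \<zeta> j)\<^sup>2 + 2 * (y \<zeta> j)\<^sup>2) * h1 s" for j
    unfolding X_deriv_eqI[OF dX] GX s_def
    by (simp add: X_dir_def split_beta inner_axis x_def y_def power2_eq_square algebra_simps)
  have YY: "Y_deriv j (Y_deriv j (\<lambda>\<zeta>. h0 (hgauge e \<zeta>))) \<zeta> =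
      16 * (R \<zeta> * y \<zeta> j - t \<zeta> * x \<zeta> j)\<^sup>2 * h2 s + 4 * (R \<zeta> + 2 * (x \<zeta> j)\<^sup>2 + 2 * (y \<zeta> j)\<^sup>2) * h1 s" for j
    unfolding Y_deriv_eqI[OF dY] GY s_def
    by (simp add: Y_dir_def split_beta inner_axis x_def y_def power2_eq_square algebra_simps)
  have sR: "s = (R \<zeta>)\<^sup>2 + (t \<zeta>)\<^sup>2" "R \<zeta> = r + e"
    by (simp_all add: s_def hgauge_def R_def t_def r_def split_beta)
  have r: "(\<Sum>j\<in>UNIV. (x \<zeta> j)\<^sup>2 + (y \<zeta> j)\<^sup>2) = r"
    by (simp add: r_def x_def y_def inner_vec_def sum.distrib power2_eq_square)
  \<comment> \<open>The cross terms cancel: (R x + t y)^2 + (R y - t x)^2 = (R^2 + t^2) (x^2 + y^2)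
    for each j, and R^2 + t^2 is the gauge s.\<close>
  have "hlap (\<lambda>\<zeta>. h0 (hgauge e \<zeta>)) \<zeta> =
     (\<Sum>j\<in>UNIV. (16 * s * h2 s + 16 * h1 s) * ((x \<zeta> j)\<^sup>2 + (y \<zeta> j)\<^sup>2) + 8 * R \<zeta> * h1 s)"
    unfolding hlap_def XX YY sR(1) by (intro sum.cong refl) (simp add: power2_eq_square algebra_simps)
  also have "\<dots> = (16 * s * h2 s + 16 * h1 s) * r + real CARD('n) * (8 * R \<zeta> * h1 s)"
  proof -
    have "(\<Sum>j\<in>UNIV. (16 * s * h2 s + 16 * h1 s) * ((x \<zeta> j)\<^sup>2 + (y \<zeta> j)\<^sup>2)) = (16 * s * h2 s + 16 * h1 s) * r"
      by (simp only: sum_distrib_left[symmetric] r)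
    then show ?thesis by (simp only: sum.distrib sum_constant)
  qed
  \<comment> \<open>Writing R = r + e splits 8 N R: the part with r supplies the coefficient N / 2
    of the differential operator, the part with e is the only term left for the fundamental
    solution.\<close>
  also have "\<dots> = 16 * r * (s * h2 s + (1 + real CARD('n) / 2) * h1 s) + 8 * real CARD('n) * e * h1 s"
    unfolding sR(2) by (simp add: algebra_simps)
  finally show ?lap .
qed

lemma bounded_hgauge_le:
  assumes "e \<ge> 0" shows "bounded {\<zeta>::'n::finite heis. hgauge e \<zeta> \<le> L}"
proof (rule bounded_subset[OF bounded_cball])
  show "{\<zeta>::'n heis. hgauge e \<zeta> \<le> L} \<subseteq> cball 0 (3 * (L + 1))"
  proof
    fix \<zeta> :: "'n heis" assume "\<zeta> \<in> {\<zeta>. hgauge e \<zeta> \<le> L}"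
    then have L: "hgauge e \<zeta> \<le> L" by simp
    obtain x y t where \<zeta>: "\<zeta> = (x, y, t)" by (cases \<zeta>)
    have "L \<ge> 0" using L hgauge_nonneg[of e \<zeta>] by linarith
    have le: "a \<le> L + 1" if "a\<^sup>2 \<le> L + 1" for a :: real
    proof (rule power2_le_imp_le)
      have "(L + 1)\<^sup>2 = L\<^sup>2 + L + (L + 1)" by (simp add: power2_eq_square algebra_simps)
      then show "a\<^sup>2 \<le> (L + 1)\<^sup>2" using that \<open>L \<ge> 0\<close> zero_le_power2[of L] by linarith
    qed (use \<open>L \<ge> 0\<close> in simp)
    have "(x \<bullet> x + y \<bullet> y)\<^sup>2 \<le> L"
      using hgauge_ge(1)[OF assms, of \<zeta>] L by (simp add: \<zeta>)
    then have xy: "x \<bullet> x + y \<bullet> y \<le> L + 1" using le[of "x \<bullet> x + y \<bullet> y"] by linarith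
    have "t\<^sup>2 \<le> hgauge e \<zeta>" by (simp add: \<zeta> hgauge_def)
    with L have "\<bar>t\<bar> \<le> L + 1" using le[of "\<bar>t\<bar>"] by simp
    have "(norm x)\<^sup>2 \<le> L + 1" "(norm y)\<^sup>2 \<le> L + 1"
      unfolding power2_norm_eq_inner using xy inner_ge_zero[of x] inner_ge_zero[of y] by linarith+
    then have "norm x \<le> L + 1" "norm y \<le> L + 1" by (auto intro: le)
    with \<open>\<bar>t\<bar> \<le> L + 1\<close> have "norm \<zeta> \<le> 3 * (L + 1)"
      using norm_Pair_le[of x "(y, t)"] norm_Pair_le[of y t] by (simp add: \<zeta>)
    then show "\<zeta> \<in> cball 0 (3 * (L + 1))" by simp
  qed
qed

lemma bounded_hdiff_vimage:
  assumes "bounded A" shows "bounded {\<eta>. hdiff \<xi> \<eta> \<in> A}"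
proof (rule bounded_subset)
  show "bounded (hmul \<xi> ` closure A)"
    using assms by (intro compact_imp_bounded compact_continuous_image continuous_on_subset[OF hmul_continuous])
      (auto simp: compact_closure)
  show "{\<eta>. hdiff \<xi> \<eta> \<in> A} \<subseteq> hmul \<xi> ` closure A"
    using closure_subset[of A] by (auto intro!: image_eqI[of _ _ "hdiff \<xi> _"])
qed

section \<open>Powers of the gauge with a smooth cut-off\<close>

text \<open>The bump factor vanishes for s \<ge> L and tends to \<open>bump 0 1\<close>, which is
  exp(- 1), as L grows; the factor \<open>exp 1\<close> normalizes this limit to 1. The cut-off is
  not constant near the pole, it only converges pointwise.\<close>

definition cutoff_powr :: "real \<Rightarrow> real \<Rightarrow> real \<Rightarrow> real" where
  "cutoff_powr m L s = exp 1 * (s powr - m * bump 0 (1 - s / L))"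

definition cutoff_powr1 :: "real \<Rightarrow> real \<Rightarrow> real \<Rightarrow> real" where
  "cutoff_powr1 m L s = exp 1 * (- m * s powr (- m - 1) * bump 0 (1 - s / L) - s powr - m * bump 1 (1 - s / L) / L)"

definition cutoff_powr2 :: "real \<Rightarrow> real \<Rightarrow> real \<Rightarrow> real" where
  "cutoff_powr2 m L s = exp 1 * (m * (m + 1) * s powr (- m - 2) * bump 0 (1 - s / L)
     + 2 * m * s powr (- m - 1) * bump 1 (1 - s / L) / L + s powr - m * bump 2 (1 - s / L) / L\<^sup>2)"

lemma cutoff_powr_derivative:
  assumes "s > 0" "L > 0"
  shows "(cutoff_powr m L has_real_derivative cutoff_powr1 m L s) (at s)"
    and "(cutoff_powr1 m L has_real_derivative cutoff_powr2 m L s) (at s)"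
proof -
  have b: "((\<lambda>s. bump n (1 - s / L)) has_real_derivative - bump (Suc n) (1 - s / L) / L) (at s)" for n
    using assms by (auto intro!: DERIV_chain2[OF bump_has_derivative, THEN DERIV_cong] derivative_eq_intros)
  have p: "((\<lambda>s. s powr k) has_real_derivative k * s powr (k - 1)) (at s)" for k
    using assms by (auto intro!: derivative_eq_intros)
  show "(cutoff_powr m L has_real_derivative cutoff_powr1 m L s) (at s)"
    unfolding cutoff_powr_def[abs_def] cutoff_powr1_def
    by (rule DERIV_cong[OF DERIV_cmult[OF DERIV_mult[OF p b]]]) simp
  show "(cutoff_powr1 m L has_real_derivative cutoff_powr2 m L s) (at s)"
    unfolding cutoff_powr1_def[abs_def] cutoff_powr2_def
    by (rule DERIV_cong[OF DERIV_cmult[OF DERIV_diff[OF DERIV_mult[OF DERIV_cmult[OF p] b]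
              DERIV_cdivide[OF DERIV_mult[OF p b]]]]])
       (use assms in \<open>simp add: field_simps power2_eq_square numeral_2_eq_2\<close>)
qed

text \<open>The pure power solves s h'' + (1 + m) h' = 0, so only terms in which a derivative has
  fallen on the cut-off survive.\<close>

lemma cutoff_powr_operator:
  assumes "s > 0" "L > 0"
  shows "s * cutoff_powr2 m L s + (1 + m) * cutoff_powr1 m L s =
    exp 1 * s powr - m * ((m - 1) * bump 1 (1 - s / L) / L + s * bump 2 (1 - s / L) / L\<^sup>2)"
proof -
  have "s powr - m = s * s powr (- m - 1)" "s powr (- m - 1) = s * s powr (- m - 2)"
  proof -
    have *: "1 + (- m - 1) = - m" "1 + (- m - 2) = - m - 1" by simp_all
    show "s powr - m = s * s powr (- m - 1)" "s powr (- m - 1) = s * s powr (- m - 2)"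
      using assms powr_mult_base[of s "- m - 1", unfolded *(1)] powr_mult_base[of s "- m - 2", unfolded *(2)]
      by simp_all
  qed
  then show ?thesis
    using assms unfolding cutoff_powr1_def cutoff_powr2_def
    by (simp add: field_simps power2_eq_square)
qed

lemma times_cont_diff_hgauge_hdiff: "times_cont_diff k (\<lambda>\<eta>. hgauge e (hdiff \<xi> \<eta>))"
proof -
  obtain x y t where \<xi>: "\<xi> = (x, y, t)" by (cases \<xi>)
  have lin: "bounded_linear (\<lambda>\<eta>::'a heis. fst \<eta> \<bullet> i)" "bounded_linear (\<lambda>\<eta>::'a heis. fst (snd \<eta>) \<bullet> i)"
    "bounded_linear (\<lambda>\<eta>::'a heis. snd (snd \<eta>))" for i
    by (auto intro!: bounded_linear_compose[OF bounded_linear_inner_left] bounded_linear_fst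
        bounded_linear_compose[OF bounded_linear_fst] bounded_linear_snd bounded_linear_compose[OF bounded_linear_snd])
  have *: "z \<bullet> z = (\<Sum>i\<in>Basis. (z \<bullet> i) ^ 2)" for z :: "real ^ 'a"
    by (simp add: euclidean_inner[of z z] power2_eq_square)
  show ?thesis
    unfolding \<xi> hgauge_def hdiff_def split_beta fst_conv snd_conv * inner_diff_left
    by (intro times_cont_diff_add times_cont_diff_power times_cont_diff_sum times_cont_diff_diff
        times_cont_diff_mult times_cont_diff_const times_cont_diff_linear lin)
qed

lemma test_fun_cutoff_powr:
  assumes e: "e > 0" and L: "L > 0"
  shows "test_fun (\<lambda>\<eta>. cutoff_powr m L (hgauge e (hdiff \<xi> \<eta>)))"
proof (rule test_funI)
  fix k
  have "times_cont_diff k (\<lambda>\<eta>. hgauge e (hdiff \<xi> \<eta>) powr - m)"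
  \<comment> \<open>The product gives the n-th derivative of \<open>s powr - m\<close>, valid for s
    > 0 only; the gauge stays in this range because e > 0.\<close>
  proof (rule times_cont_diff_compose[where S="{0<..}" and n=0
        and h="\<lambda>n s. (\<Prod>i<n. - m - real i) * s powr (- m - real n)", simplified])
    fix n :: nat and s :: real assume "s > 0"
    then show "((\<lambda>s. (\<Prod>i<n. - m - real i) * s powr (- m - real n)) has_real_derivative
        (\<Prod>i<n. - m - real i) * (- m - real n) * s powr (- m - (1 + real n))) (at s)"
      by (auto intro!: derivative_eq_intros simp: algebra_simps)
  qed (auto intro: hgauge_pos e times_cont_diff_hgauge_hdiff)
  then show "times_cont_diff k (\<lambda>\<eta>. cutoff_powr m L (hgauge e (hdiff \<xi> \<eta>)))"
    unfolding cutoff_powr_def divide_inverse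
    by (intro times_cont_diff_mult times_cont_diff_const times_cont_diff_bump times_cont_diff_diff
        times_cont_diff_hgauge_hdiff)
next
  have "cutoff_powr m L (hgauge e (hdiff \<xi> \<eta>)) = 0" if "\<not> hgauge e (hdiff \<xi> \<eta>) \<le> L" for \<eta>
    using that L by (simp add: cutoff_powr_def)
  then show "bounded {\<eta>. cutoff_powr m L (hgauge e (hdiff \<xi> \<eta>)) \<noteq> 0}"
    using e by (intro bounded_subset[OF bounded_hdiff_vimage[OF bounded_hgauge_le[of e L], of \<xi>]]) auto
qed

lemma bump_bounded: obtains B where "B > 0" "\<And>x. x \<le> 1 \<Longrightarrow> \<bar>bump n x\<bar> \<le> B"
proof -
  have "compact (bump n ` {0..1})"
    by (intro compact_continuous_image continuous_on_bump continuous_on_id) auto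
  then obtain B where B: "\<And>x. x \<in> {0..1} \<Longrightarrow> \<bar>bump n x\<bar> \<le> B"
    by (force dest!: compact_imp_bounded simp: bounded_iff)
  have "\<bar>bump n x\<bar> \<le> max B 1" if "x \<le> 1" for x
    using B[of x] that by (cases "x \<le> 0") auto
  then show ?thesis by (intro that[of "max B 1"]) auto
qed

section \<open>Volume and kernel estimates\<close>

text \<open>The anisotropic dilations of the group: t has weight 2, so the Jacobian is r to the
  power Q = 2 N + 2.\<close>

definition hdil :: "real \<Rightarrow> 'n::finite heis \<Rightarrow> 'n heis" where
  "hdil r = (\<lambda>(x, y, t). (r *\<^sub>R x, r *\<^sub>R y, r\<^sup>2 * t))"

lemma hdiff_0 [simp]: "hdiff 0 \<eta> = \<eta>"
  by (cases \<eta>) (simp add: hdiff_def zero_prod_def)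

lemma continuous_hmul_hdil: "continuous_on UNIV (\<lambda>\<zeta>. hmul \<xi> (hdil r \<zeta>))"
  unfolding hdil_def by (intro continuous_on_compose2[OF hmul_continuous]) (auto simp: split_beta intro!: continuous_intros)

lemma hgauge_hdil: "hgauge (r\<^sup>2 * e) (hdil r \<zeta>) = r ^ 4 * hgauge e \<zeta>"
  by (simp add: hgauge_def hdil_def split_beta power2_eq_square power4_eq_xxxx algebra_simps)

lemma continuous_hgauge_hdiff:
  "continuous_on UNIV (\<lambda>\<eta>. hgauge e (hdiff \<xi> \<eta>))"
  "continuous_on UNIV (\<lambda>\<xi>. hgauge e (hdiff \<xi> \<eta>))"
  "continuous_on UNIV (\<lambda>z. hgauge e (hdiff (fst z) (snd z)))"
  unfolding hgauge_def hdiff_def split_beta by (auto intro!: continuous_intros)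

lemma measurable_hgauge_hdiff [measurable]:
  "(\<lambda>\<eta>. hgauge e (hdiff \<xi> \<eta>)) \<in> borel_measurable borel"
  "(\<lambda>\<xi>. hgauge e (hdiff \<xi> \<eta>)) \<in> borel_measurable borel"
  "(\<lambda>z. hgauge e (hdiff (fst z) (snd z))) \<in> borel_measurable (borel \<Otimes>\<^sub>M borel)"
  unfolding borel_prod by (intro borel_measurable_continuous_onI continuous_hgauge_hdiff)+

lemma nn_integral_affine:
  fixes F :: "'a::euclidean_space \<Rightarrow> ennreal"
  assumes [measurable]: "F \<in> borel_measurable borel" and r: "r > 0"
  shows "(\<integral>\<^sup>+x. F x \<partial>lborel) = ennreal (r ^ DIM('a)) * (\<integral>\<^sup>+x. F (a + r *\<^sub>R x) \<partial>lborel)"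
  using r by (subst lborel_affine[of r a])
    (simp_all add: nn_integral_density nn_integral_distr nn_integral_cmult)

lemma nn_integral_triple:
  fixes F :: "'a::euclidean_space \<times> 'b::euclidean_space \<times> 'c::euclidean_space \<Rightarrow> ennreal"
  assumes [measurable]: "F \<in> borel_measurable borel"
  shows "(\<integral>\<^sup>+z. F z \<partial>lborel) = (\<integral>\<^sup>+x. \<integral>\<^sup>+y. \<integral>\<^sup>+t. F (x, y, t) \<partial>lborel \<partial>lborel \<partial>lborel)"
proof -
  have [measurable]: "F \<in> borel_measurable (lborel \<Otimes>\<^sub>M lborel)"
    unfolding lborel_prod by simp
  have [measurable]: "(\<lambda>yt. F (x, yt)) \<in> borel_measurable (lborel \<Otimes>\<^sub>M lborel)" for x
    unfolding lborel_prod by simp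
  have "(\<integral>\<^sup>+z. F z \<partial>lborel) = (\<integral>\<^sup>+x. \<integral>\<^sup>+yt. F (x, yt) \<partial>lborel \<partial>lborel)"
    by (subst lborel.nn_integral_fst) (simp_all add: lborel_prod)
  also have "\<dots> = (\<integral>\<^sup>+x. \<integral>\<^sup>+y. \<integral>\<^sup>+t. F (x, y, t) \<partial>lborel \<partial>lborel \<partial>lborel)"
    by (subst lborel.nn_integral_fst) (simp_all add: lborel_prod)
  finally show ?thesis .
qed

text \<open>Group translation shears the t-coordinate by an amount depending only on the other two
  coordinates. With t integrated innermost by Tonelli, the shear becomes an ordinary translation of
  the line.\<close>

lemma nn_integral_hmul_hdil:
  fixes F :: "'n::finite heis \<Rightarrow> ennreal"
  assumes F [measurable]: "F \<in> borel_measurable borel" and r: "r > 0"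
  shows "(\<integral>\<^sup>+\<eta>. F \<eta> \<partial>lborel) = ennreal (r ^ (2 * CARD('n) + 2)) * (\<integral>\<^sup>+\<zeta>. F (hmul \<xi> (hdil r \<zeta>)) \<partial>lborel)"
proof -
  obtain x y t where \<xi>: "\<xi> = (x, y, t)" by (cases \<xi>)
  have m [measurable]: "(\<lambda>\<zeta>. F (hmul \<xi> (hdil r \<zeta>))) \<in> borel_measurable borel"
    by (rule measurable_compose[OF borel_measurable_continuous_onI[OF continuous_hmul_hdil] F])
  have [measurable]: "F \<in> borel_measurable (borel \<Otimes>\<^sub>M (borel \<Otimes>\<^sub>M borel))"
    by (simp add: borel_prod)
  define F1 where "F1 x' y' = (\<integral>\<^sup>+t'. F (x', y', t') \<partial>lborel)" for x' y'
  have F1 [measurable]: "(\<lambda>z. F1 (fst z) (snd z)) \<in> borel_measurable (borel \<Otimes>\<^sub>M borel)"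
    unfolding F1_def by measurable
  define c where "c x' y' = t + 2 * ((r *\<^sub>R x') \<bullet> y - (r *\<^sub>R y') \<bullet> x)" for x' y'
  have [measurable]: "F1 x' \<in> borel_measurable borel" for x'
    unfolding F1_def by measurable
  have [measurable]: "(\<lambda>z. c (fst z) (snd z)) \<in> borel_measurable (borel \<Otimes>\<^sub>M borel)"
    unfolding c_def by measurable
  \<comment> \<open>The offset b is left free because it will be the shear \<open>c x' y'\<close>,
    which differs from slice to slice.\<close>
  have F1_eq: "F1 x' y' = ennreal (r\<^sup>2) * (\<integral>\<^sup>+t'. F (x', y', b + r\<^sup>2 * t') \<partial>lborel)" for x' y' b
    unfolding F1_def using r by (subst nn_integral_affine[of _ "r\<^sup>2" b]) simp_all
  have "(\<integral>\<^sup>+\<eta>. F \<eta> \<partial>lborel) = (\<integral>\<^sup>+x'. \<integral>\<^sup>+y'. F1 x' y' \<partial>lborel \<partial>lborel)"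
    unfolding F1_def by (rule nn_integral_triple[OF F])
  also have "\<dots> = ennreal (r ^ CARD('n)) * (\<integral>\<^sup>+x'. \<integral>\<^sup>+y'. F1 (x + r *\<^sub>R x') y' \<partial>lborel \<partial>lborel)"
    using r by (subst nn_integral_affine[of _ r x]) simp_all
  also have "(\<integral>\<^sup>+x'. \<integral>\<^sup>+y'. F1 (x + r *\<^sub>R x') y' \<partial>lborel \<partial>lborel) =
      (\<integral>\<^sup>+x'. ennreal (r ^ CARD('n)) * (\<integral>\<^sup>+y'. F1 (x + r *\<^sub>R x') (y + r *\<^sub>R y') \<partial>lborel) \<partial>lborel)"
    using r by (intro nn_integral_cong, subst nn_integral_affine[of _ r y]) simp_all
  also have "\<dots> = ennreal (r ^ CARD('n)) * (\<integral>\<^sup>+x'. \<integral>\<^sup>+y'. F1 (x + r *\<^sub>R x') (y + r *\<^sub>R y') \<partial>lborel \<partial>lborel)"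
    unfolding F1_def by (rule nn_integral_cmult) measurable
  also have "(\<integral>\<^sup>+x'. \<integral>\<^sup>+y'. F1 (x + r *\<^sub>R x') (y + r *\<^sub>R y') \<partial>lborel \<partial>lborel) =
      (\<integral>\<^sup>+x'. \<integral>\<^sup>+y'. ennreal (r\<^sup>2) * (\<integral>\<^sup>+t'. F (x + r *\<^sub>R x', y + r *\<^sub>R y', c x' y' + r\<^sup>2 * t') \<partial>lborel) \<partial>lborel \<partial>lborel)"
    by (intro nn_integral_cong F1_eq)
  also have "\<dots> = (\<integral>\<^sup>+x'. ennreal (r\<^sup>2) * (\<integral>\<^sup>+y'. \<integral>\<^sup>+t'. F (x + r *\<^sub>R x', y + r *\<^sub>R y', c x' y' + r\<^sup>2 * t') \<partial>lborel \<partial>lborel) \<partial>lborel)"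
    unfolding c_def by (intro nn_integral_cong nn_integral_cmult) measurable
  also have "\<dots> = ennreal (r\<^sup>2) * (\<integral>\<^sup>+x'. \<integral>\<^sup>+y'. \<integral>\<^sup>+t'. F (x + r *\<^sub>R x', y + r *\<^sub>R y', c x' y' + r\<^sup>2 * t') \<partial>lborel \<partial>lborel \<partial>lborel)"
    unfolding c_def by (rule nn_integral_cmult) measurable
  also have "(\<integral>\<^sup>+x'. \<integral>\<^sup>+y'. \<integral>\<^sup>+t'. F (x + r *\<^sub>R x', y + r *\<^sub>R y', c x' y' + r\<^sup>2 * t') \<partial>lborel \<partial>lborel \<partial>lborel)
      = (\<integral>\<^sup>+\<zeta>. F (hmul \<xi> (hdil r \<zeta>)) \<partial>lborel)"
    by (subst nn_integral_triple[OF m]) (simp add: \<xi> hmul_def hdil_def c_def algebra_simps)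
  finally have "(\<integral>\<^sup>+\<eta>. F \<eta> \<partial>lborel) = ennreal (r ^ CARD('n)) * (ennreal (r ^ CARD('n)) *
      (ennreal (r\<^sup>2) * (\<integral>\<^sup>+\<zeta>. F (hmul \<xi> (hdil r \<zeta>)) \<partial>lborel)))" .
  moreover have "r ^ (2 * CARD('n) + 2) = r ^ CARD('n) * (r ^ CARD('n) * r\<^sup>2)"
    by (simp only: power_add mult_2 mult.assoc)
  ultimately show ?thesis using r by (simp add: ennreal_mult mult.assoc)
qed

definition hvol :: "'n::finite itself \<Rightarrow> real" where
  "hvol _ = measure lborel {\<zeta>::'n heis. hgauge 0 \<zeta> < 1}"

text \<open>The set is the unit gauge ball, dilated by the fourth root r of l and translated. The
  Jacobian turns into l to the power Q / 4.\<close>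

lemma emeasure_hgauge_less:
  fixes \<xi> :: "'n::finite heis"
  assumes l: "l > 0"
  shows "emeasure lborel {\<eta>. hgauge 0 (hdiff \<xi> \<eta>) < l} = ennreal (hvol TYPE('n) * l powr ((real CARD('n) + 1) / 2))"
proof -
  define r where "r = l powr (1/4)"
  have r: "r > 0" "r ^ 4 = l" using l by (auto simp: r_def powr_realpow[symmetric] powr_powr)
  have [measurable]: "{\<eta>. hgauge 0 (hdiff \<xi> \<eta>) < l} \<in> sets borel" by measurable
  have "emeasure lborel {\<eta>. hgauge 0 (hdiff \<xi> \<eta>) < l} = (\<integral>\<^sup>+\<eta>. indicator {\<eta>. hgauge 0 (hdiff \<xi> \<eta>) < l} \<eta> \<partial>lborel)"
    by simp
  also have "\<dots> = ennreal (r ^ (2 * CARD('n) + 2)) * (\<integral>\<^sup>+\<zeta>. indicator {\<eta>. hgauge 0 (hdiff \<xi> \<eta>) < l} (hmul \<xi> (hdil r \<zeta>)) \<partial>lborel)"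
    by (rule nn_integral_hmul_hdil) (use r in auto)
  also have "(\<integral>\<^sup>+\<zeta>. indicator {\<eta>. hgauge 0 (hdiff \<xi> \<eta>) < l} (hmul \<xi> (hdil r \<zeta>)) \<partial>lborel)
      = (\<integral>\<^sup>+\<zeta>. indicator {\<zeta>::'n heis. hgauge 0 \<zeta> < 1} \<zeta> \<partial>lborel)"
  proof (intro nn_integral_cong)
    fix \<zeta> :: "'n heis"
    have "hgauge 0 (hdil r \<zeta>) < l \<longleftrightarrow> hgauge 0 \<zeta> < 1"
      using hgauge_hdil[of r 0 \<zeta>] r(1) unfolding r(2)[symmetric] by (simp add: mult_less_cancel_left1)
    then show "indicator {\<eta>. hgauge 0 (hdiff \<xi> \<eta>) < l} (hmul \<xi> (hdil r \<zeta>)) = (indicator {\<zeta>. hgauge 0 \<zeta> < 1} \<zeta> :: ennreal)"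
      by (simp add: indicator_def)
  qed
  also have "\<dots> = emeasure lborel {\<zeta>::'n heis. hgauge 0 \<zeta> < 1}"
  proof (intro nn_integral_indicator)
    have "hgauge 0 \<in> borel_measurable (lborel :: 'n heis measure)"
      using measurable_hgauge_hdiff(1)[of 0 0] by simp
    from borel_measurable_less[OF this borel_measurable_const] show "{\<zeta>::'n heis. hgauge 0 \<zeta> < 1} \<in> sets lborel"
      by simp
  qed
  also have "\<dots> = ennreal (hvol TYPE('n))"
    unfolding hvol_def
  proof (rule emeasure_eq_ennreal_measure)
    have "bounded {\<zeta>::'n heis. hgauge 0 \<zeta> < 1}"
      by (rule bounded_subset[OF bounded_hgauge_le[of 0 1]]) auto
    then show "emeasure lborel {\<zeta>::'n heis. hgauge 0 \<zeta> < 1} \<noteq> top"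
      using emeasure_bounded_finite by force
  qed
  also have "r ^ (2 * CARD('n) + 2) = l powr ((real CARD('n) + 1) / 2)"
  proof -
    have "r ^ (2 * CARD('n) + 2) = r powr real (2 * CARD('n) + 2)"
      using r(1) by (rule powr_realpow[symmetric])
    also have "\<dots> = l powr ((real CARD('n) + 1) / 2)"
      unfolding r_def powr_powr by (rule arg_cong[of _ _ "\<lambda>z. l powr z"]) simp
    finally show ?thesis .
  qed
  finally show ?thesis by (simp add: ennreal_mult[symmetric] hvol_def mult.commute)
qed

lemma suminf_ge_single: "f k \<le> suminf f" for f :: "nat \<Rightarrow> ennreal"
  using sum_le_suminf[of f "{k}"] by simp

text \<open>Dyadic decomposition of the range of \<open>P\<close>.\<close>

lemma nn_integral_powr_near:
  fixes P :: "'a \<Rightarrow> real"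
  assumes [measurable]: "P \<in> borel_measurable M" and P: "\<And>x. P x \<ge> 0"
    and vol: "\<And>l. l > 0 \<Longrightarrow> emeasure M {x \<in> space M. P x < l} \<le> ennreal (C * l powr d)"
    and C: "C \<ge> 0" and bd: "0 \<le> b" "b < d" and L: "L > 0"
  shows "(\<integral>\<^sup>+x. ennreal (indicator {x. P x < L} x * P x powr - b) \<partial>M)
    \<le> ennreal (C * 2 powr b / (1 - 2 powr (b - d)) * L powr (d - b))"
proof -
  define q :: real where "q = 2 powr (b - d)"
  have q: "0 < q" "q < 1" using bd by (auto simp: q_def powr_less_one)
  define A where "A k = {x \<in> space M. P x < 2 powr (- real k) * L}" for k :: nat
  have [measurable]: "A k \<in> sets M" for k by (simp add: A_def)
  \<comment> \<open>The value of \<open>P powr - b\<close> at the lower end of the shell between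
    2^(- k - 1) L and 2^(- k) L.\<close>
  define w where "w k = 2 powr (b * (real k + 1)) * L powr - b" for k :: nat
  have w: "w k \<ge> 0" for k by (simp add: w_def)
  have "(\<integral>\<^sup>+x. ennreal (indicator {x. P x < L} x * P x powr - b) \<partial>M) \<le> (\<integral>\<^sup>+x. (\<Sum>k. ennreal (w k) * indicator (A k) x) \<partial>M)"
  proof (rule nn_integral_mono)
    fix x assume x: "x \<in> space M"
    show "ennreal (indicator {x. P x < L} x * P x powr - b) \<le> (\<Sum>k. ennreal (w k) * indicator (A k) x)"
    proof (cases "0 < P x \<and> P x < L")
      case True
      obtain n where "(1/2) ^ n < P x / L" using real_arch_pow_inv[of "P x / L" "1/2"] True by auto
      then have "\<not> P x < 2 powr (- real n) * L"
        using L by (simp add: powr_minus powr_realpow power_one_over field_simps)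
      then have ex: "\<exists>n. \<not> P x < 2 powr (- real n) * L" by blast
      define n where "n = (LEAST n. \<not> P x < 2 powr (- real n) * L)"
      have n: "\<not> P x < 2 powr (- real n) * L" unfolding n_def by (rule LeastI_ex[OF ex])
      then have "n \<noteq> 0" using True by (cases n) auto
      then obtain k where k: "n = Suc k" by (cases n) auto
      have "P x < 2 powr (- real k) * L"
        using not_less_Least[of k "\<lambda>n. \<not> P x < 2 powr (- real n) * L"] by (simp add: n_def[symmetric] k)
      then have "x \<in> A k" using x by (simp add: A_def)
      have "P x powr - b \<le> (2 powr (- real n) * L) powr - b"
        using n bd L True by (intro powr_mono2') auto
      also have "\<dots> = w k" using L by (simp add: w_def powr_mult powr_powr k algebra_simps)
      finally have "ennreal (indicator {x. P x < L} x * P x powr - b) \<le> ennreal (w k) * indicator (A k) x"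
        using True \<open>x \<in> A k\<close> by (simp add: ennreal_leI)
      also have "\<dots> \<le> (\<Sum>k. ennreal (w k) * indicator (A k) x)" by (rule suminf_ge_single)
      finally show ?thesis .
    next
      \<comment> \<open>Besides points outside the sublevel set this covers P = 0, where the
        integrand has the default value \<open>0 powr _ = 0\<close>.\<close>
      case False
      then show ?thesis using P[of x] by (auto simp: indicator_def not_less)
    qed
  qed
  also have "\<dots> = (\<Sum>k. ennreal (w k) * emeasure M (A k))"
    by (subst nn_integral_suminf) (auto simp: nn_integral_cmult_indicator)
  also have "\<dots> \<le> (\<Sum>k. ennreal (C * 2 powr b * L powr (d - b) * q ^ k))"
  proof (intro suminf_le summableI)
    fix k
    have "ennreal (w k) * emeasure M (A k) \<le> ennreal (w k) * ennreal (C * (2 powr (- real k) * L) powr d)"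
      unfolding A_def using L by (intro mult_left_mono vol) auto
    also have "\<dots> = ennreal (w k * (C * (2 powr (- real k) * L) powr d))"
      using C by (simp add: ennreal_mult w)
    also have "w k * (C * (2 powr (- real k) * L) powr d) = C * 2 powr b * L powr (d - b) * q ^ k"
    proof -
      have *: "(2 powr (- real k) * L) powr d = 2 powr (- (d * real k)) * L powr d"
        using L by (simp only: powr_mult powr_powr) (simp add: mult.commute)
      show ?thesis
        using L unfolding * by (simp add: w_def q_def powr_powr powr_add powr_diff powr_minus powr_realpow[symmetric] field_simps)
    qed
    finally show "ennreal (w k) * emeasure M (A k) \<le> ennreal (C * 2 powr b * L powr (d - b) * q ^ k)" .
  qed
  also have "\<dots> = ennreal (\<Sum>k. C * 2 powr b * L powr (d - b) * q ^ k)"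
    using q C by (intro suminf_ennreal2) (auto intro!: summable_mult summable_geometric)
  also have "(\<Sum>k. C * 2 powr b * L powr (d - b) * q ^ k) = C * 2 powr b / (1 - q) * L powr (d - b)"
    using q by (subst suminf_mult) (auto simp: suminf_geometric summable_geometric)
  finally show ?thesis by (simp add: q_def)
qed

text \<open>The same decomposition with growing shells: volume of order 2^(d k) against decay of
  order 2^(- b k) is a convergent geometric series for b > d.\<close>

lemma nn_integral_powr_far:
  fixes P :: "'a \<Rightarrow> real"
  assumes [measurable]: "P \<in> borel_measurable M" and P: "\<And>x. P x \<ge> 0"
    and vol: "\<And>l. l > 0 \<Longrightarrow> emeasure M {x \<in> space M. P x < l} \<le> ennreal (C * l powr d)"
    and C: "C \<ge> 0" and bd: "0 < d" "d < b"
  shows "(\<integral>\<^sup>+x. ennreal ((1 + P x) powr - b) \<partial>M) \<le> ennreal (C * 2 powr b / (1 - 2 powr (d - b)))"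
proof -
  define q :: real where "q = 2 powr (d - b)"
  have q: "0 < q" "q < 1" using bd by (auto simp: q_def powr_less_one)
  define A where "A k = {x \<in> space M. P x < 2 powr (real k)}" for k :: nat
  have [measurable]: "A k \<in> sets M" for k by (simp add: A_def)
  \<comment> \<open>The value of \<open>P powr - b\<close> at P = 2^(k - 1), the lower end of the
    k-th shell; for k = 0 it is 2^b \<ge> 1, which dominates the integrand trivially.\<close>
  define w :: "nat \<Rightarrow> real" where "w k = 2 powr (b - b * real k)" for k
  have w: "w k \<ge> 0" for k by (simp add: w_def)
  have "(\<integral>\<^sup>+x. ennreal ((1 + P x) powr - b) \<partial>M) \<le> (\<integral>\<^sup>+x. (\<Sum>k. ennreal (w k) * indicator (A k) x) \<partial>M)"
  proof (rule nn_integral_mono)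
    fix x assume x: "x \<in> space M"
    have ex: "\<exists>n. P x < 2 powr (real n)"
      using real_arch_pow[of 2 "P x"] by (auto simp: powr_realpow)
    define n where "n = (LEAST n. P x < 2 powr (real n))"
    have n: "P x < 2 powr (real n)" unfolding n_def by (rule LeastI_ex[OF ex])
    have "(1 + P x) powr - b \<le> w n"
    proof (cases n)
      case 0
      have "(1 + P x) powr - b \<le> 1 powr - b" using bd P[of x] by (intro powr_mono2') auto
      then have "(1 + P x) powr - b \<le> 1" by simp
      also have "1 \<le> (2::real) powr b" using bd by (intro ge_one_powr_ge_zero) auto
      finally show ?thesis by (simp add: 0 w_def)
    next
      case (Suc k)
      have "2 powr real k \<le> P x"
        using not_less_Least[of k "\<lambda>n. P x < 2 powr (real n)"] by (simp add: n_def[symmetric] Suc)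
      then have "(1 + P x) powr - b \<le> (2 powr real k) powr - b"
        using bd by (intro powr_mono2') auto
      also have "\<dots> = w n" by (simp add: w_def powr_powr Suc algebra_simps)
      finally show ?thesis .
    qed
    then have "ennreal ((1 + P x) powr - b) \<le> ennreal (w n) * indicator (A n) x"
      using n x by (simp add: ennreal_leI A_def)
    also have "\<dots> \<le> (\<Sum>k. ennreal (w k) * indicator (A k) x)" by (rule suminf_ge_single)
    finally show "ennreal ((1 + P x) powr - b) \<le> (\<Sum>k. ennreal (w k) * indicator (A k) x)" .
  qed
  also have "\<dots> = (\<Sum>k. ennreal (w k) * emeasure M (A k))"
    by (subst nn_integral_suminf) (auto simp: nn_integral_cmult_indicator)
  also have "\<dots> \<le> (\<Sum>k. ennreal (C * 2 powr b * q ^ k))"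
  proof (intro suminf_le summableI)
    fix k
    have "ennreal (w k) * emeasure M (A k) \<le> ennreal (w k) * ennreal (C * (2 powr (real k)) powr d)"
      unfolding A_def by (intro mult_left_mono vol) auto
    also have "\<dots> = ennreal (w k * (C * (2 powr (real k)) powr d))"
      using C by (simp add: ennreal_mult w)
    also have "w k * (C * (2 powr (real k)) powr d) = C * 2 powr b * q ^ k"
      using q by (simp add: w_def q_def powr_powr powr_diff powr_realpow[symmetric] field_simps)
    finally show "ennreal (w k) * emeasure M (A k) \<le> ennreal (C * 2 powr b * q ^ k)" .
  qed
  also have "\<dots> = ennreal (\<Sum>k. C * 2 powr b * q ^ k)"
    using q C by (intro suminf_ennreal2) (auto intro!: summable_mult summable_geometric)
  also have "(\<Sum>k. C * 2 powr b * q ^ k) = C * 2 powr b / (1 - q)"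
    using q by (subst suminf_mult) (auto simp: suminf_geometric summable_geometric)
  finally show ?thesis by (simp add: q_def)
qed

section \<open>Uniform cut-off estimates and the regularized representation\<close>

text \<open>The bounds are uniform in L: each derivative of the cut-off costs 1 / L, which is at
  most 1 / s where the cut-off is supported, and for s \<ge> L everything vanishes.\<close>

lemma cutoff_powr_bounds:
  assumes m: "m \<ge> 0"
  obtains B where "B > 0"
    "\<And>s L. s > 0 \<Longrightarrow> L > 0 \<Longrightarrow> \<bar>cutoff_powr m L s\<bar> \<le> B * s powr - m"
    "\<And>s L. s > 0 \<Longrightarrow> L > 0 \<Longrightarrow> \<bar>cutoff_powr1 m L s\<bar> \<le> B * s powr (- m - 1)"
    "\<And>s L. s > 0 \<Longrightarrow> L > 0 \<Longrightarrow> \<bar>s * cutoff_powr2 m L s + (1 + m) * cutoff_powr1 m L s\<bar> \<le> B * s powr (- m - 1)"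
proof -
  obtain B0 where B0: "B0 > 0" "\<And>x. x \<le> 1 \<Longrightarrow> \<bar>bump 0 x\<bar> \<le> B0" using bump_bounded by blast
  obtain B1 where B1: "B1 > 0" "\<And>x. x \<le> 1 \<Longrightarrow> \<bar>bump 1 x\<bar> \<le> B1" using bump_bounded by blast
  obtain B2 where B2: "B2 > 0" "\<And>x. x \<le> 1 \<Longrightarrow> \<bar>bump 2 x\<bar> \<le> B2" using bump_bounded by blast
  define D where "D = exp 1 * ((m + 1) * (B0 + B1) + B2)"
  show ?thesis
  proof (rule that[of D])
    show "D > 0" using B0 B1 B2 m by (simp add: D_def add_nonneg_pos)
    fix s L :: real assume sL: "s > 0" "L > 0"
    let ?b = "\<lambda>n. bump n (1 - s / L)"
    have b: "\<bar>?b 0\<bar> \<le> B0" "\<bar>?b 1\<bar> \<le> B1" "\<bar>?b 2\<bar> \<le> B2"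
      by (rule B0 B1 B2, use sL in simp)+
    have ps: "s powr - m = s * s powr (- m - 1)"
      using powr_mult_base[of s "- m - 1"] sL by simp
    have "\<bar>cutoff_powr m L s\<bar> = exp 1 * (s powr - m * \<bar>?b 0\<bar>)" by (simp add: cutoff_powr_def abs_mult)
    also have "\<dots> \<le> exp 1 * (s powr - m * ((m + 1) * (B0 + B1) + B2))"
    proof (intro mult_left_mono)
      have "0 \<le> m * (B0 + B1)" using m B0 B1 by simp
      then show "\<bar>?b 0\<bar> \<le> (m + 1) * (B0 + B1) + B2" using b(1) B1 B2 by (simp add: algebra_simps)
    qed auto
    finally show "\<bar>cutoff_powr m L s\<bar> \<le> D * s powr - m" by (simp add: D_def mult_ac)
    show "\<bar>cutoff_powr1 m L s\<bar> \<le> D * s powr (- m - 1)"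
    proof (cases "s < L")
      case True
      have "cutoff_powr1 m L s = exp 1 * s powr (- m - 1) * (- m * ?b 0 - s / L * ?b 1)"
        by (simp add: cutoff_powr1_def ps algebra_simps)
      then have "\<bar>cutoff_powr1 m L s\<bar> = exp 1 * s powr (- m - 1) * \<bar>- m * ?b 0 - s / L * ?b 1\<bar>"
        by (simp add: abs_mult)
      also have "\<dots> \<le> exp 1 * s powr (- m - 1) * ((m + 1) * (B0 + B1) + B2)"
      proof (rule mult_left_mono)
        have "\<bar>- m * ?b 0 - s / L * ?b 1\<bar> \<le> m * \<bar>?b 0\<bar> + s / L * \<bar>?b 1\<bar>"
          using m sL abs_triangle_ineq4[of "- m * ?b 0" "s / L * ?b 1"] by (simp add: abs_mult)
        also have "\<dots> \<le> m * B0 + 1 * B1"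
          using m sL b True by (intro add_mono mult_mono) auto
        also have "\<dots> \<le> (m + 1) * (B0 + B1) + B2"
          using m B0 B1 B2 by (simp add: algebra_simps)
        finally show "\<bar>- m * ?b 0 - s / L * ?b 1\<bar> \<le> (m + 1) * (B0 + B1) + B2" .
      qed simp
      finally show ?thesis by (simp add: D_def mult_ac)
    next
      case False
      then have "cutoff_powr1 m L s = 0" using sL by (simp add: cutoff_powr1_def)
      then show ?thesis using \<open>D > 0\<close> by simp
    qed
    show "\<bar>s * cutoff_powr2 m L s + (1 + m) * cutoff_powr1 m L s\<bar> \<le> D * s powr (- m - 1)"
      unfolding cutoff_powr_operator[OF sL]
    proof (cases "s < L")
      case True
      have "exp 1 * s powr - m * ((m - 1) * ?b 1 / L + s * ?b 2 / L\<^sup>2) =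
          exp 1 * s powr (- m - 1) * ((m - 1) * (s / L * ?b 1) + (s / L)\<^sup>2 * ?b 2)"
        unfolding ps by (simp add: algebra_simps power2_eq_square)
      also have "\<bar>\<dots>\<bar> = exp 1 * s powr (- m - 1) * \<bar>(m - 1) * (s / L * ?b 1) + (s / L)\<^sup>2 * ?b 2\<bar>"
        by (simp add: abs_mult)
      also have "\<dots> \<le> exp 1 * s powr (- m - 1) * ((m + 1) * (B0 + B1) + B2)"
      proof (rule mult_left_mono)
        have "\<bar>(m - 1) * (s / L * ?b 1) + (s / L)\<^sup>2 * ?b 2\<bar> \<le> \<bar>m - 1\<bar> * (s / L * \<bar>?b 1\<bar>) + (s / L)\<^sup>2 * \<bar>?b 2\<bar>"
          using sL abs_triangle_ineq[of "(m - 1) * (s / L * ?b 1)" "(s / L)\<^sup>2 * ?b 2"] by (simp add: abs_mult)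
        also have "\<dots> \<le> (m + 1) * (1 * B1) + 1 * B2"
          using m sL b True by (intro add_mono mult_mono) (auto simp: power_le_one)
        also have "\<dots> \<le> (m + 1) * (B0 + B1) + B2"
          using m B0 by (simp add: algebra_simps)
        finally show "\<bar>(m - 1) * (s / L * ?b 1) + (s / L)\<^sup>2 * ?b 2\<bar> \<le> (m + 1) * (B0 + B1) + B2" .
      qed simp
      finally show "\<bar>exp 1 * s powr - m * ((m - 1) * ?b 1 / L + s * ?b 2 / L\<^sup>2)\<bar> \<le> D * s powr (- m - 1)"
        by (simp add: D_def mult_ac)
    next
      case False
      then show "\<bar>exp 1 * s powr - m * ((m - 1) * ?b 1 / L + s * ?b 2 / L\<^sup>2)\<bar> \<le> D * s powr (- m - 1)"
        using sL \<open>D > 0\<close> by simp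
    qed
  qed
qed

lemma cutoff_powr_limits:
  assumes s: "s > 0"
  shows "(\<lambda>k. cutoff_powr m (real (Suc k)) s) \<longlonglongrightarrow> s powr - m"
    and "(\<lambda>k. cutoff_powr1 m (real (Suc k)) s) \<longlonglongrightarrow> - m * s powr (- m - 1)"
    and "(\<lambda>k. s * cutoff_powr2 m (real (Suc k)) s + (1 + m) * cutoff_powr1 m (real (Suc k)) s) \<longlonglongrightarrow> 0"
proof -
  have inv: "(\<lambda>k. 1 / real (Suc k)) \<longlonglongrightarrow> 0"
    using LIMSEQ_inverse_real_of_nat by (simp add: inverse_eq_divide)
  have "(\<lambda>k. 1 - s * (1 / real (Suc k))) \<longlonglongrightarrow> 1 - s * 0" by (intro tendsto_intros inv)
  then have b: "(\<lambda>k. bump n (1 - s / real (Suc k))) \<longlonglongrightarrow> bump n 1" for n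
    using isCont_tendsto_compose[OF DERIV_isCont[OF bump_has_derivative[of n 1]]] by simp
  have one: "exp 1 * (x * bump 0 1) = x" for x :: real
    by (simp add: bump_0_eq exp_minus)
  have "(\<lambda>k. exp 1 * (s powr - m * bump 0 (1 - s / real (Suc k)))) \<longlonglongrightarrow> exp 1 * (s powr - m * bump 0 1)"
    by (intro tendsto_intros b)
  then show "(\<lambda>k. cutoff_powr m (real (Suc k)) s) \<longlonglongrightarrow> s powr - m"
    by (simp only: one cutoff_powr_def)
  have "(\<lambda>k. exp 1 * (- m * s powr (- m - 1) * bump 0 (1 - s / real (Suc k))
      - s powr - m * bump 1 (1 - s / real (Suc k)) * (1 / real (Suc k))))
      \<longlonglongrightarrow> exp 1 * (- m * s powr (- m - 1) * bump 0 1 - s powr - m * bump 1 1 * 0)"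
    by (intro tendsto_intros b inv)
  moreover have "exp 1 * (- m * s powr (- m - 1) * bump 0 1 - s powr - m * bump 1 1 * 0) = - m * s powr (- m - 1)"
    using one[of "- m * s powr (- m - 1)"] by simp
  moreover have "cutoff_powr1 m (real (Suc k)) s = exp 1 * (- m * s powr (- m - 1) * bump 0 (1 - s / real (Suc k))
      - s powr - m * bump 1 (1 - s / real (Suc k)) * (1 / real (Suc k)))" for k
    by (simp add: cutoff_powr1_def)
  ultimately show "(\<lambda>k. cutoff_powr1 m (real (Suc k)) s) \<longlonglongrightarrow> - m * s powr (- m - 1)"
    by (simp only:)
  have "(\<lambda>k. exp 1 * s powr - m * ((m - 1) * bump 1 (1 - s / real (Suc k)) * (1 / real (Suc k)) +
      s * bump 2 (1 - s / real (Suc k)) * (1 / real (Suc k))\<^sup>2))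
      \<longlonglongrightarrow> exp 1 * s powr - m * ((m - 1) * bump 1 1 * 0 + s * bump 2 1 * 0\<^sup>2)"
    by (intro tendsto_intros b inv)
  then show "(\<lambda>k. s * cutoff_powr2 m (real (Suc k)) s + (1 + m) * cutoff_powr1 m (real (Suc k)) s) \<longlonglongrightarrow> 0"
    using s by (subst cutoff_powr_operator) (simp_all add: power_divide)
qed

lemma hgauge_ge_one_plus:
  assumes e: "e > 0"
  shows "min (e\<^sup>2) 1 / 2 * (1 + hgauge 0 \<zeta>) \<le> hgauge e \<zeta>"
proof -
  have "min (e\<^sup>2) 1 * hgauge 0 \<zeta> \<le> 1 * hgauge 0 \<zeta>"
    by (intro mult_right_mono hgauge_nonneg) auto
  moreover have "hgauge 0 \<zeta> \<le> hgauge e \<zeta>" "e\<^sup>2 \<le> hgauge e \<zeta>"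
    using e by (auto intro: hgauge_mono hgauge_ge(2))
  ultimately show ?thesis by (simp add: algebra_simps)
qed

lemma vol_hgauge:
  fixes \<xi> :: "'n::finite heis"
  shows "l > 0 \<Longrightarrow> emeasure lborel {\<eta> \<in> space lborel. hgauge 0 (hdiff \<xi> \<eta>) < l}
    \<le> ennreal (hvol TYPE('n) * l powr ((real CARD('n) + 1) / 2))"
  using emeasure_hgauge_less[of l \<xi>] by simp

lemma hvol_nonneg: "hvol T \<ge> 0"
  by (simp add: hvol_def)

text \<open>There is no singularity for e > 0; at infinity the gauge is comparable to 1 +
  \<open>hgauge 0\<close>, and Q / 4 = (N + 1) / 2 is the threshold exponent.\<close>

lemma integrable_hgauge_powr:
  fixes \<xi> :: "'n::finite heis"
  assumes e: "e > 0" and b: "b > (real CARD('n) + 1) / 2"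
  shows "integrable lborel (\<lambda>\<eta>. hgauge e (hdiff \<xi> \<eta>) powr - b)"
proof (rule Bochner_Integration.integrable_bound)
  let ?c = "(min (e\<^sup>2) 1 / 2) powr - b"
  have "(\<integral>\<^sup>+\<eta>. ennreal ((1 + hgauge 0 (hdiff \<xi> \<eta>)) powr - b) \<partial>lborel) < top"
    by (rule le_less_trans[OF nn_integral_powr_far[where d="(real CARD('n) + 1) / 2", OF _ _ vol_hgauge hvol_nonneg]])
       (use b in \<open>auto simp: hgauge_nonneg\<close>)
  then have "integrable lborel (\<lambda>\<eta>. (1 + hgauge 0 (hdiff \<xi> \<eta>)) powr - b)"
    by (intro integrableI_bounded) auto
  then show "integrable lborel (\<lambda>\<eta>. ?c * (1 + hgauge 0 (hdiff \<xi> \<eta>)) powr - b)" by simp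
  show "AE \<eta> in lborel. norm (hgauge e (hdiff \<xi> \<eta>) powr - b) \<le> norm (?c * (1 + hgauge 0 (hdiff \<xi> \<eta>)) powr - b)"
  proof (rule AE_I2)
    fix \<eta>
    let ?s = "hgauge 0 (hdiff \<xi> \<eta>)"
    have "hgauge e (hdiff \<xi> \<eta>) powr - b \<le> (min (e\<^sup>2) 1 / 2 * (1 + ?s)) powr - b"
      using b e hgauge_nonneg[of 0 "hdiff \<xi> \<eta>"] by (intro powr_mono2' hgauge_ge_one_plus mult_pos_pos) auto
    also have "\<dots> = ?c * (1 + ?s) powr - b"
      using e hgauge_nonneg[of 0 "hdiff \<xi> \<eta>"] by (intro powr_mult)
    finally show "norm (hgauge e (hdiff \<xi> \<eta>) powr - b) \<le> norm (?c * (1 + hgauge 0 (hdiff \<xi> \<eta>)) powr - b)"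
      by simp
  qed
qed simp

lemma integrable_mult_conjugate:
  fixes u K :: "'a \<Rightarrow> real"
  assumes pq: "p > 1" "q > 1" "1 / p + 1 / q = 1"
    and [measurable]: "u \<in> borel_measurable M" "K \<in> borel_measurable M"
    and "integrable M (\<lambda>x. \<bar>u x\<bar> powr p)" "integrable M (\<lambda>x. \<bar>K x\<bar> powr q)"
  shows "integrable M (\<lambda>x. u x * K x)"
proof (rule Bochner_Integration.integrable_bound)
  show "integrable M (\<lambda>x. \<bar>u x\<bar> powr p / p + \<bar>K x\<bar> powr q / q)" using assms by simp
  show "AE x in M. norm (u x * K x) \<le> norm (\<bar>u x\<bar> powr p / p + \<bar>K x\<bar> powr q / q)"
    using Youngs_inequality[OF pq] pq by (intro AE_I2) (simp add: abs_mult)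
qed simp

text \<open>The truncated fundamental solution with pole \<open>\<xi>\<close> is an admissible test function. The terms
  created by the cut-off are bounded by \<open>hgauge e (hdiff \<xi> \<eta>) powr (- Q / 4)\<close> uniformly in the
  cut-off radius, which is integrable against \<open>u\<close>, and they vanish pointwise in the limit.\<close>

lemma regularized_representation:
  fixes u h :: "'n::finite heis \<Rightarrow> real"
  assumes weak: "\<And>\<phi>. test_fun \<phi> \<Longrightarrow> (LINT \<eta>|lborel. u \<eta> * hlap \<phi> \<eta>) = - (LINT \<eta>|lborel. h \<eta> * \<phi> \<eta>)"
    and u [measurable]: "u \<in> borel_measurable borel" and p: "p > 1" "integrable lborel (\<lambda>\<eta>. \<bar>u \<eta>\<bar> powr p)"
    and h: "integrable lborel h" and e: "e > 0"
  shows "4 * (real CARD('n))\<^sup>2 * e * (LINT \<eta>|lborel. u \<eta> * hgauge e (hdiff \<xi> \<eta>) powr (- (real CARD('n) / 2) - 1)) =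
    (LINT \<eta>|lborel. h \<eta> * hgauge e (hdiff \<xi> \<eta>) powr - (real CARD('n) / 2))"
proof -
  let ?N = "real CARD('n)"
  define m where "m = ?N / 2"
  have m: "m \<ge> 0" "m > 0" by (auto simp: m_def)
  define P where "P \<eta> = hgauge e (hdiff \<xi> \<eta>)" for \<eta>
  define r where "r \<eta> = fst (hdiff \<xi> \<eta>) \<bullet> fst (hdiff \<xi> \<eta>) + fst (snd (hdiff \<xi> \<eta>)) \<bullet> fst (snd (hdiff \<xi> \<eta>))" for \<eta>
  define \<phi> where "\<phi> k \<eta> = cutoff_powr m (real (Suc k)) (P \<eta>)" for k \<eta>
  have [measurable]: "P \<in> borel_measurable borel" unfolding P_def[abs_def] by simp
  have [measurable]: "h \<in> borel_measurable borel" using borel_measurable_integrable[OF h] by simp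
  have P: "P \<eta> > 0" "e\<^sup>2 \<le> P \<eta>" for \<eta> using e by (auto simp: P_def hgauge_pos hgauge_ge)
  have \<phi>: "test_fun (\<phi> k)" for k
    unfolding \<phi>_def P_def by (rule test_fun_cutoff_powr[OF e]) simp
  define l1 l2 where "l1 k \<eta> = P \<eta> * cutoff_powr2 m (real (Suc k)) (P \<eta>) + (1 + m) * cutoff_powr1 m (real (Suc k)) (P \<eta>)"
    and "l2 k \<eta> = cutoff_powr1 m (real (Suc k)) (P \<eta>)" for k \<eta>
  have lap: "hlap (\<phi> k) \<eta> = 16 * r \<eta> * l1 k \<eta> + 8 * ?N * e * l2 k \<eta>" for k \<eta>
  proof -
    note * = cutoff_powr_derivative[of _ "real (Suc k)" m]
    have "hlap (\<phi> k) \<eta> = hlap (\<lambda>\<zeta>. cutoff_powr m (real (Suc k)) (hgauge e \<zeta>)) (hdiff \<xi> \<eta>)"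
      unfolding \<phi>_def P_def by (rule hlap_hdiff) (rule hlap_hgauge(2-4)[OF e *]; simp)+
    also have "\<dots> = 16 * r \<eta> * l1 k \<eta> + 8 * ?N * e * l2 k \<eta>"
      unfolding r_def l1_def l2_def P_def m_def by (rule hlap_hgauge(1)[OF e *[unfolded m_def]]) simp_all
    finally show ?thesis .
  qed
  obtain B where B: "B > 0"
    "\<And>s L. s > 0 \<Longrightarrow> L > 0 \<Longrightarrow> \<bar>cutoff_powr m L s\<bar> \<le> B * s powr - m"
    "\<And>s L. s > 0 \<Longrightarrow> L > 0 \<Longrightarrow> \<bar>cutoff_powr1 m L s\<bar> \<le> B * s powr (- m - 1)"
    "\<And>s L. s > 0 \<Longrightarrow> L > 0 \<Longrightarrow> \<bar>s * cutoff_powr2 m L s + (1 + m) * cutoff_powr1 m L s\<bar> \<le> B * s powr (- m - 1)"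
    using cutoff_powr_bounds[OF m(1)] by blast
  have r: "0 \<le> r \<eta>" "r \<eta> \<le> P \<eta> powr (1/2)" for \<eta>
  proof -
    show "0 \<le> r \<eta>" by (simp add: r_def)
    have "(r \<eta>)\<^sup>2 \<le> P \<eta>" using e by (simp add: r_def P_def hgauge_ge)
    then show "r \<eta> \<le> P \<eta> powr (1/2)" using P[of \<eta>] by (simp add: powr_half_sqrt real_le_rsqrt)
  qed
  \<comment> \<open>Both coefficients r and e are at most P to the power 1/2, so each term regains
    half a power of P and the exponent becomes - m - 1/2 = - Q / 4.\<close>
  have bound: "\<bar>hlap (\<phi> k) \<eta>\<bar> \<le> (16 + 8 * ?N) * B * P \<eta> powr (- m - 1/2)" for k \<eta>
  proof -
    have eP: "e * P \<eta> powr (- 1/2) \<le> 1"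
    proof -
      have "e \<le> sqrt (P \<eta>)" using P[of \<eta>] e by (intro real_le_rsqrt)
      then show ?thesis using P(1)[of \<eta>] by (simp add: powr_minus powr_half_sqrt field_simps)
    qed
    have "\<bar>hlap (\<phi> k) \<eta>\<bar> \<le> 16 * r \<eta> * \<bar>l1 k \<eta>\<bar> + 8 * ?N * e * \<bar>l2 k \<eta>\<bar>"
      unfolding lap using r(1)[of \<eta>] e abs_triangle_ineq[of "16 * r \<eta> * l1 k \<eta>" "8 * ?N * e * l2 k \<eta>"]
      by (simp add: abs_mult)
    also have "\<dots> \<le> 16 * P \<eta> powr (1/2) * (B * P \<eta> powr (- m - 1)) + 8 * ?N * e * (B * P \<eta> powr (- m - 1))"
      unfolding l1_def l2_def using r[of \<eta>] e B P(1)[of \<eta>]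
      by (intro add_mono mult_mono mult_left_mono) auto
    also have "\<dots> = 16 * B * P \<eta> powr (- m - 1/2) + 8 * ?N * B * ((e * P \<eta> powr (- 1/2)) * P \<eta> powr (- m - 1/2))"
    proof -
      have "P \<eta> powr (1/2) * P \<eta> powr (- m - 1) = P \<eta> powr (- m - 1/2)"
        "P \<eta> powr (- 1/2) * P \<eta> powr (- m - 1/2) = P \<eta> powr (- m - 1)"
      proof -
        have *: "1/2 + (- m - 1) = - m - 1/2" "- 1/2 + (- m - 1/2) = - m - 1" by simp_all
        show "P \<eta> powr (1/2) * P \<eta> powr (- m - 1) = P \<eta> powr (- m - 1/2)"
          "P \<eta> powr (- 1/2) * P \<eta> powr (- m - 1/2) = P \<eta> powr (- m - 1)"
          by (simp_all only: powr_add[symmetric] *)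
      qed
      then show ?thesis by (simp add: mult_ac)
    qed
    also have "\<dots> \<le> 16 * B * P \<eta> powr (- m - 1/2) + 8 * ?N * B * (1 * P \<eta> powr (- m - 1/2))"
      using eP B by (intro add_left_mono mult_left_mono mult_right_mono) auto
    finally show ?thesis by (simp add: algebra_simps)
  qed
  define q where "q = p / (p - 1)"
  have q: "q > 1" "1 / p + 1 / q = 1" using p by (auto simp: q_def field_simps)
  have intP: "integrable lborel (\<lambda>\<eta>. u \<eta> * P \<eta> powr (- m - 1/2))"
  proof (rule integrable_mult_conjugate[OF p(1) q _ _ p(2)])
    \<comment> \<open>The exponent m + 1/2 is exactly the threshold; since q > 1 strictly, the q-th
      power lies beyond it.\<close>
    have "(real CARD('n) + 1) / 2 * 1 < (m + 1/2) * q"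
      unfolding m_def add_divide_distrib using q by (intro mult_strict_left_mono) auto
    then have "(real CARD('n) + 1) / 2 < (m + 1/2) * q" by simp
    from integrable_hgauge_powr[OF e this, of \<xi>]
    show "integrable lborel (\<lambda>\<eta>. \<bar>P \<eta> powr (- m - 1/2)\<bar> powr q)"
      by (simp add: P_def powr_powr algebra_simps)
  qed simp_all
  have lim1: "(\<lambda>k. LINT \<eta>|lborel. u \<eta> * hlap (\<phi> k) \<eta>) \<longlonglongrightarrow> (LINT \<eta>|lborel. u \<eta> * (8 * ?N * e * (- m * P \<eta> powr (- m - 1))))"
  proof (rule integral_dominated_convergence)
    show "integrable lborel (\<lambda>\<eta>. (16 + 8 * ?N) * B * \<bar>u \<eta> * P \<eta> powr (- m - 1/2)\<bar>)"
      using intP by simp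
    show "AE \<eta> in lborel. (\<lambda>k. u \<eta> * hlap (\<phi> k) \<eta>) \<longlonglongrightarrow> u \<eta> * (8 * ?N * e * (- m * P \<eta> powr (- m - 1)))"
    proof (rule AE_I2)
      fix \<eta>
      have "(\<lambda>k. u \<eta> * (16 * r \<eta> * l1 k \<eta> + 8 * ?N * e * l2 k \<eta>)) \<longlonglongrightarrow> u \<eta> * (16 * r \<eta> * 0 + 8 * ?N * e * (- m * P \<eta> powr (- m - 1)))"
        unfolding l1_def l2_def by (intro tendsto_intros cutoff_powr_limits P)
      then show "(\<lambda>k. u \<eta> * hlap (\<phi> k) \<eta>) \<longlonglongrightarrow> u \<eta> * (8 * ?N * e * (- m * P \<eta> powr (- m - 1)))"
        by (simp add: lap)
    qed
    show "AE \<eta> in lborel. norm (u \<eta> * hlap (\<phi> k) \<eta>) \<le> (16 + 8 * ?N) * B * \<bar>u \<eta> * P \<eta> powr (- m - 1/2)\<bar>" for k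
    proof (rule AE_I2)
      fix \<eta>
      have "\<bar>u \<eta>\<bar> * \<bar>hlap (\<phi> k) \<eta>\<bar> \<le> \<bar>u \<eta>\<bar> * ((16 + 8 * ?N) * B * P \<eta> powr (- m - 1/2))"
        by (intro mult_left_mono bound) simp
      then show "norm (u \<eta> * hlap (\<phi> k) \<eta>) \<le> (16 + 8 * ?N) * B * \<bar>u \<eta> * P \<eta> powr (- m - 1/2)\<bar>"
        by (simp add: abs_mult mult_ac)
    qed
    have "hlap (\<phi> k) \<in> borel_measurable borel" for k
      by (intro borel_measurable_continuous_onI test_fun_continuous test_fun_hlap \<phi>)
    then show "(\<lambda>\<eta>. u \<eta> * hlap (\<phi> k) \<eta>) \<in> borel_measurable lborel" for k by simp
  qed simp
  have lim2: "(\<lambda>k. LINT \<eta>|lborel. h \<eta> * \<phi> k \<eta>) \<longlonglongrightarrow> (LINT \<eta>|lborel. h \<eta> * P \<eta> powr - m)"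
  proof (rule integral_dominated_convergence)
    show "integrable lborel (\<lambda>\<eta>. B * (e\<^sup>2) powr - m * \<bar>h \<eta>\<bar>)" using h by simp
    show "AE \<eta> in lborel. (\<lambda>k. h \<eta> * \<phi> k \<eta>) \<longlonglongrightarrow> h \<eta> * P \<eta> powr - m"
      unfolding \<phi>_def by (intro AE_I2 tendsto_intros cutoff_powr_limits P)
    show "AE \<eta> in lborel. norm (h \<eta> * \<phi> k \<eta>) \<le> B * (e\<^sup>2) powr - m * \<bar>h \<eta>\<bar>" for k
    proof (rule AE_I2)
      fix \<eta>
      have "\<bar>\<phi> k \<eta>\<bar> \<le> B * P \<eta> powr - m" unfolding \<phi>_def by (intro B P) simp
      also have "\<dots> \<le> B * (e\<^sup>2) powr - m"
        using P[of \<eta>] e m B by (intro mult_left_mono powr_mono2') auto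
      finally show "norm (h \<eta> * \<phi> k \<eta>) \<le> B * (e\<^sup>2) powr - m * \<bar>h \<eta>\<bar>"
        using mult_left_mono[of "\<bar>\<phi> k \<eta>\<bar>" "B * (e\<^sup>2) powr - m" "\<bar>h \<eta>\<bar>"] by (simp add: abs_mult mult.commute)
    qed
    show "(\<lambda>\<eta>. h \<eta> * \<phi> k \<eta>) \<in> borel_measurable lborel" for k
      using borel_measurable_continuous_onI[OF test_fun_continuous[OF \<phi>[of k]]] by simp
  qed simp
  from lim2 have "(\<lambda>k. LINT \<eta>|lborel. u \<eta> * hlap (\<phi> k) \<eta>) \<longlonglongrightarrow> - (LINT \<eta>|lborel. h \<eta> * P \<eta> powr - m)"
    by (simp add: weak[OF \<phi>] tendsto_minus)
  from LIMSEQ_unique[OF lim1 this]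
  have "(LINT \<eta>|lborel. (- (8 * ?N * e * m)) * (u \<eta> * P \<eta> powr (- m - 1))) = - (LINT \<eta>|lborel. h \<eta> * P \<eta> powr - m)"
    by (simp add: mult_ac)
  then have "8 * ?N * e * m * (LINT \<eta>|lborel. u \<eta> * P \<eta> powr (- m - 1)) = (LINT \<eta>|lborel. h \<eta> * P \<eta> powr - m)"
    by (simp only: integral_mult_right_zero) simp
  then show ?thesis by (simp add: m_def P_def power2_eq_square mult_ac)
qed

section \<open>Representation by the fundamental solution\<close>

text \<open>On the diagonal \<open>hker 0\<close> has the junk value \<open>0 powr _ = 0\<close> instead of infinity, which is
  harmless because points are null sets.\<close>

definition hker :: "real \<Rightarrow> 'n::finite heis \<Rightarrow> 'n heis \<Rightarrow> real" where
  "hker e \<xi> \<eta> = hgauge e (hdiff \<xi> \<eta>) powr - (real CARD('n) / 2)"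

text \<open>Minus the sub-Laplacian of \<open>hker e\<close> in either variable.\<close>

definition happrox :: "real \<Rightarrow> 'n::finite heis \<Rightarrow> 'n heis \<Rightarrow> real" where
  "happrox e \<xi> \<eta> = 4 * (real CARD('n))\<^sup>2 * e * hgauge e (hdiff \<xi> \<eta>) powr (- (real CARD('n) / 2) - 1)"

text \<open>The total mass of the approximate identity, the same for every pole and every e > 0 by
  dilation. It is the normalizing constant in the representation of u.\<close>

definition hmass :: "'n::finite itself \<Rightarrow> real" where
  "hmass _ = (LINT \<zeta>|lborel. happrox 1 (0::'n heis) \<zeta>)"

lemma hker_nonneg: "hker e \<xi> \<eta> \<ge> 0" by (simp add: hker_def)

lemma happrox_nonneg: "e \<ge> 0 \<Longrightarrow> happrox e \<xi> \<eta> \<ge> 0" by (simp add: happrox_def)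

lemma hker_commute: "hker e \<xi> \<eta> = hker e \<eta> \<xi>"
  by (simp add: hker_def hgauge_hdiff_commute[of e \<xi>])

lemma happrox_commute: "happrox e \<xi> \<eta> = happrox e \<eta> \<xi>"
  by (simp add: happrox_def hgauge_hdiff_commute[of e \<xi>])

lemma measurable_hker [measurable]:
  "hker e \<xi> \<in> borel_measurable borel"
  "(\<lambda>z. hker e (fst z) (snd z)) \<in> borel_measurable (borel \<Otimes>\<^sub>M borel)"
  unfolding hker_def[abs_def]
  by (intro powr_real_measurable borel_measurable_const measurable_hgauge_hdiff(1,3))+

lemma measurable_happrox [measurable]:
  "happrox e \<xi> \<in> borel_measurable borel"
  "(\<lambda>z. happrox e (fst z) (snd z)) \<in> borel_measurable (borel \<Otimes>\<^sub>M borel)"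
  unfolding happrox_def[abs_def]
  by (intro borel_measurable_times powr_real_measurable borel_measurable_const measurable_hgauge_hdiff(1,3))+

lemma integrable_happrox:
  fixes \<xi> :: "'n::finite heis" assumes "e > 0"
  shows "integrable lborel (happrox e \<xi>)"
proof -
  have "(real CARD('n) + 1) / 2 < real CARD('n) / 2 + 1" by simp
  from integrable_hgauge_powr[OF assms this, of \<xi>] show ?thesis
    by (simp add: happrox_def[abs_def])
qed

lemma hmass_pos: "hmass TYPE('n::finite) > 0"
proof -
  have pos: "happrox 1 (0::'n heis) \<zeta> > 0" for \<zeta>
    using hgauge_pos[of 1 "hdiff 0 \<zeta>"] by (simp add: happrox_def)
  have int: "integrable lborel (happrox 1 (0::'n heis))" by (rule integrable_happrox) simp
  have "hmass TYPE('n) \<noteq> 0"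
  proof
    assume "hmass TYPE('n) = 0"
    then have "AE \<zeta> in lborel. happrox 1 (0::'n heis) \<zeta> = 0"
      using pos integral_nonneg_eq_0_iff_AE[OF int] by (simp add: hmass_def less_imp_le)
    then have "AE \<zeta> in (lborel :: 'n heis measure). False"
      by eventually_elim (use pos in \<open>simp add: less_imp_neq[symmetric]\<close>)
    then have "emeasure lborel (UNIV :: 'n heis set) = 0"
      by (subst (asm) AE_iff_measurable[of UNIV]) auto
    then show False by (simp add: emeasure_lborel_UNIV)
  qed
  moreover have "hmass TYPE('n) \<ge> 0"
    unfolding hmass_def by (intro Bochner_Integration.integral_nonneg) (simp add: pos less_imp_le)
  ultimately show ?thesis by simp
qed

text \<open>The approximate identity of size r^2 is the dilate of the one of size 1. Moving r into
  the argument of \<open>F\<close> yields both the constant mass and the concentration at the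
  pole.\<close>

lemma nn_integral_happrox_dilate:
  fixes F :: "'n::finite heis \<Rightarrow> ennreal"
  assumes F [measurable]: "F \<in> borel_measurable borel" and r: "r > 0"
  shows "(\<integral>\<^sup>+\<eta>. F \<eta> * ennreal (happrox (r\<^sup>2) \<xi> \<eta>) \<partial>lborel) =
    (\<integral>\<^sup>+\<zeta>. F (hmul \<xi> (hdil r \<zeta>)) * ennreal (happrox 1 0 \<zeta>) \<partial>lborel)"
proof -
  have [measurable]: "(\<lambda>\<zeta>. F (hmul \<xi> (hdil r \<zeta>))) \<in> borel_measurable borel"
    by (rule measurable_compose[OF borel_measurable_continuous_onI[OF continuous_hmul_hdil] F])
  have [measurable]: "(\<lambda>\<zeta>. happrox (r\<^sup>2) \<xi> (hmul \<xi> (hdil r \<zeta>))) \<in> borel_measurable borel"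
    by (rule measurable_compose[OF borel_measurable_continuous_onI[OF continuous_hmul_hdil] measurable_happrox(1)])
  have scale: "r ^ (2 * CARD('n) + 2) * happrox (r\<^sup>2) \<xi> (hmul \<xi> (hdil r \<zeta>)) = happrox 1 0 \<zeta>" for \<zeta> :: "'n heis"
  proof -
    let ?b = "- (real CARD('n) / 2) - 1"
    have "r ^ (2 * CARD('n) + 2) * (r\<^sup>2 * (r ^ 4) powr ?b) =
        r powr real (2 * CARD('n) + 2) * (r powr real 2 * (r powr real 4) powr ?b)"
      using r by (simp only: powr_realpow)
    also have "\<dots> = r powr (real (2 * CARD('n) + 2) + (real 2 + real 4 * ?b))"
      by (simp only: powr_powr powr_add)
    \<comment> \<open>The Jacobian contributes 2 N + 2, the prefactor e = r^2 contributes 2, and the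
      gauge of degree 4 to the power - N / 2 - 1 contributes - 2 N - 4.\<close>
    also have "real (2 * CARD('n) + 2) + (real 2 + real 4 * ?b) = 0" by simp
    finally have one: "r ^ (2 * CARD('n) + 2) * (r\<^sup>2 * (r ^ 4) powr ?b) = 1" using r by simp
    have "hgauge (r\<^sup>2) (hdil r \<zeta>) powr ?b = (r ^ 4) powr ?b * hgauge 1 \<zeta> powr ?b"
      using hgauge_hdil[of r 1 \<zeta>] by (simp add: powr_mult)
    then have "r ^ (2 * CARD('n) + 2) * happrox (r\<^sup>2) \<xi> (hmul \<xi> (hdil r \<zeta>))
        = (r ^ (2 * CARD('n) + 2) * (r\<^sup>2 * (r ^ 4) powr ?b)) * happrox 1 0 \<zeta>"
      by (simp only: happrox_def hdiff_hmul hdiff_0 mult_1_right mult_ac)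
    then show ?thesis unfolding one by simp
  qed
  have "(\<integral>\<^sup>+\<eta>. F \<eta> * ennreal (happrox (r\<^sup>2) \<xi> \<eta>) \<partial>lborel) = ennreal (r ^ (2 * CARD('n) + 2)) *
      (\<integral>\<^sup>+\<zeta>. F (hmul \<xi> (hdil r \<zeta>)) * ennreal (happrox (r\<^sup>2) \<xi> (hmul \<xi> (hdil r \<zeta>))) \<partial>lborel)"
    by (rule nn_integral_hmul_hdil) (use r in auto)
  also have "\<dots> = (\<integral>\<^sup>+\<zeta>. ennreal (r ^ (2 * CARD('n) + 2)) * (F (hmul \<xi> (hdil r \<zeta>)) * ennreal (happrox (r\<^sup>2) \<xi> (hmul \<xi> (hdil r \<zeta>)))) \<partial>lborel)"
    by (rule nn_integral_cmult[symmetric]) measurable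
  also have "\<dots> = (\<integral>\<^sup>+\<zeta>. F (hmul \<xi> (hdil r \<zeta>)) * ennreal (happrox 1 0 \<zeta>) \<partial>lborel)"
  proof (intro nn_integral_cong)
    fix \<zeta> :: "'n heis"
    have "ennreal (happrox 1 0 \<zeta>) = ennreal (r ^ (2 * CARD('n) + 2)) * ennreal (happrox (r\<^sup>2) \<xi> (hmul \<xi> (hdil r \<zeta>)))"
      unfolding scale[symmetric] using r by (intro ennreal_mult happrox_nonneg) auto
    then show "ennreal (r ^ (2 * CARD('n) + 2)) * (F (hmul \<xi> (hdil r \<zeta>)) * ennreal (happrox (r\<^sup>2) \<xi> (hmul \<xi> (hdil r \<zeta>))))
        = F (hmul \<xi> (hdil r \<zeta>)) * ennreal (happrox 1 0 \<zeta>)"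
      by (simp only: mult.left_commute)
  qed
  finally show ?thesis .
qed

lemma nn_integral_happrox:
  fixes \<xi> :: "'n::finite heis" assumes r: "r > 0"
  shows "(\<integral>\<^sup>+\<eta>. ennreal (happrox (r\<^sup>2) \<xi> \<eta>) \<partial>lborel) = ennreal (hmass TYPE('n))"
    "(\<integral>\<^sup>+\<eta>. ennreal (happrox (r\<^sup>2) \<eta> \<xi>) \<partial>lborel) = ennreal (hmass TYPE('n))"
proof -
  show *: "(\<integral>\<^sup>+\<eta>. ennreal (happrox (r\<^sup>2) \<xi> \<eta>) \<partial>lborel) = ennreal (hmass TYPE('n))"
    using nn_integral_happrox_dilate[of "\<lambda>_. 1" r \<xi>] r integrable_happrox[of 1 "0 :: 'n heis"]
    by (simp add: hmass_def nn_integral_eq_integral happrox_nonneg)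
  then show "(\<integral>\<^sup>+\<eta>. ennreal (happrox (r\<^sup>2) \<eta> \<xi>) \<partial>lborel) = ennreal (hmass TYPE('n))"
    by (simp only: happrox_commute[of _ _ \<xi>])
qed

text \<open>After dilation the kernel is fixed and \<open>w\<close> is evaluated at points shrinking
  to \<xi>; continuity gives the pointwise limit and boundedness the dominating function.\<close>

lemma happrox_concentrates:
  fixes w :: "'n::finite heis \<Rightarrow> real"
  assumes w: "continuous_on UNIV w" and B: "\<And>\<eta>. \<bar>w \<eta>\<bar> \<le> B"
  shows "(\<lambda>k. \<integral>\<^sup>+\<eta>. ennreal \<bar>w \<eta> - w \<xi>\<bar> * ennreal (happrox ((1 / real (Suc k))\<^sup>2) \<xi> \<eta>) \<partial>lborel) \<longlonglongrightarrow> 0"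
proof -
  have [measurable]: "w \<in> borel_measurable borel" by (rule borel_measurable_continuous_onI[OF w])
  have [measurable]: "(\<lambda>\<zeta>. w (hmul \<xi> (hdil r \<zeta>))) \<in> borel_measurable borel" for r
    by (intro borel_measurable_continuous_onI continuous_on_compose2[OF w continuous_hmul_hdil]) simp
  define f where "f k \<zeta> = ennreal \<bar>w (hmul \<xi> (hdil (1 / real (Suc k)) \<zeta>)) - w \<xi>\<bar> * ennreal (happrox 1 0 \<zeta>)" for k \<zeta>
  have "(\<lambda>k. \<integral>\<^sup>+\<zeta>. f k \<zeta> \<partial>lborel) \<longlonglongrightarrow> (\<integral>\<^sup>+(\<zeta>::'n heis). 0 \<partial>lborel)"
  proof (rule nn_integral_dominated_convergence)
    show "AE \<zeta> in lborel. f k \<zeta> \<le> ennreal (2 * B) * ennreal (happrox 1 0 \<zeta>)" for k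
    proof (rule AE_I2)
      fix \<zeta>
      have "\<bar>w (hmul \<xi> (hdil (1 / real (Suc k)) \<zeta>)) - w \<xi>\<bar> \<le> 2 * B"
        using B[of "hmul \<xi> (hdil (1 / real (Suc k)) \<zeta>)"] B[of \<xi>] by linarith
      then show "f k \<zeta> \<le> ennreal (2 * B) * ennreal (happrox 1 0 \<zeta>)"
        unfolding f_def by (intro mult_right_mono ennreal_leI) auto
    qed
    show "(\<integral>\<^sup>+(\<zeta>::'n heis). ennreal (2 * B) * ennreal (happrox 1 0 \<zeta>) \<partial>lborel) < \<infinity>"
      using nn_integral_happrox(1)[of 1 "0 :: 'n heis"]
      by (subst nn_integral_cmult) (auto simp: ennreal_mult_less_top)
    show "AE \<zeta> in lborel. (\<lambda>k. f k \<zeta>) \<longlonglongrightarrow> 0"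
    proof (rule AE_I2)
      fix \<zeta> :: "'n heis"
      have cont: "continuous_on UNIV (\<lambda>r. hmul \<xi> (hdil r \<zeta>))"
        unfolding hdil_def by (intro continuous_on_compose2[OF hmul_continuous]) (auto simp: split_beta intro!: continuous_intros)
      have "continuous_on UNIV (\<lambda>r. \<bar>w (hmul \<xi> (hdil r \<zeta>)) - w \<xi>\<bar>)"
        by (intro continuous_intros continuous_on_compose2[OF w cont]) simp
      then have "isCont (\<lambda>r. \<bar>w (hmul \<xi> (hdil r \<zeta>)) - w \<xi>\<bar>) 0"
        by (simp add: continuous_on_eq_continuous_at)
      moreover have "(\<lambda>k. 1 / real (Suc k)) \<longlonglongrightarrow> 0"
        using LIMSEQ_inverse_real_of_nat by (simp add: inverse_eq_divide)
      ultimately have "(\<lambda>k. \<bar>w (hmul \<xi> (hdil (1 / real (Suc k)) \<zeta>)) - w \<xi>\<bar>) \<longlonglongrightarrow> \<bar>w (hmul \<xi> (hdil 0 \<zeta>)) - w \<xi>\<bar>"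
        by (rule isCont_tendsto_compose)
      moreover have "hmul \<xi> (hdil 0 \<zeta>) = \<xi>"
        by (cases \<xi>, cases \<zeta>) (simp add: hmul_def hdil_def)
      ultimately have "(\<lambda>k. ennreal (\<bar>w (hmul \<xi> (hdil (1 / real (Suc k)) \<zeta>)) - w \<xi>\<bar> * happrox 1 0 \<zeta>)) \<longlonglongrightarrow> ennreal (0 * happrox 1 0 \<zeta>)"
        by (intro tendsto_ennrealI tendsto_mult tendsto_const) simp
      then show "(\<lambda>k. f k \<zeta>) \<longlonglongrightarrow> 0"
        by (simp add: f_def ennreal_mult' happrox_nonneg)
    qed
  qed (auto simp: f_def)
  then show ?thesis
    by (subst nn_integral_happrox_dilate) (simp_all add: f_def)
qed

lemma hgauge_0_eq_0_iff: "hgauge 0 (hdiff \<xi> \<eta>) = 0 \<longleftrightarrow> \<xi> = \<eta>"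
proof
  assume *: "hgauge 0 (hdiff \<xi> \<eta>) = 0"
  obtain x y t where d: "hdiff \<xi> \<eta> = (x, y, t)" by (cases "hdiff \<xi> \<eta>")
  from * have "(x \<bullet> x + y \<bullet> y)\<^sup>2 + t\<^sup>2 = 0" by (simp add: d hgauge_def)
  then have "x \<bullet> x + y \<bullet> y = 0" "t = 0" by (auto simp: add_nonneg_eq_0_iff)
  then have "hdiff \<xi> \<eta> = 0" by (simp add: d add_nonneg_eq_0_iff zero_prod_def)
  then have "hmul \<xi> 0 = \<eta>" by (metis hmul_hdiff)
  then show "\<xi> = \<eta>" by (cases \<xi>) (simp add: hmul_def zero_prod_def)
qed (simp add: hgauge_def hdiff_def split_beta inner_commute)

text \<open>A substitute for Hoelder's inequality that stays linear in the p-th power: with \<delta>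
  fixed the second term is made small by approximation in L^p, and \<delta> is sent to 0
  last.\<close>

lemma abs_le_powr_split:
  fixes x :: real assumes "\<delta> > 0" "p \<ge> 1"
  shows "\<bar>x\<bar> \<le> \<delta> + \<delta> powr (1 - p) * \<bar>x\<bar> powr p"
proof (cases "\<bar>x\<bar> \<le> \<delta>")
  case False
  then have x: "\<bar>x\<bar> > \<delta>" by simp
  have "\<bar>x\<bar> = \<bar>x\<bar> powr (1 - p) * \<bar>x\<bar> powr p" using x assms by (simp add: powr_add[symmetric])
  also have "\<dots> \<le> \<delta> powr (1 - p) * \<bar>x\<bar> powr p"
    using x assms by (intro mult_right_mono powr_mono2') auto
  finally show ?thesis using assms by simp
qed (use assms in \<open>simp add: add_increasing2\<close>)

lemma integrable_mult_happrox:
  fixes u :: "'n::finite heis \<Rightarrow> real"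
  assumes [measurable]: "u \<in> borel_measurable borel" and p: "p > 1" "integrable lborel (\<lambda>\<eta>. \<bar>u \<eta>\<bar> powr p)"
    and e: "e > 0"
  shows "integrable lborel (\<lambda>\<eta>. u \<eta> * happrox e \<xi> \<eta>)"
proof -
  define q where "q = p / (p - 1)"
  have q: "q > 1" "1 / p + 1 / q = 1" using p by (auto simp: q_def field_simps)
  have "integrable lborel (\<lambda>\<eta>. u \<eta> * hgauge e (hdiff \<xi> \<eta>) powr (- (real CARD('n) / 2) - 1))"
  proof (rule integrable_mult_conjugate[OF p(1) q _ _ p(2)])
    have "(real CARD('n) + 1) / 2 < (real CARD('n) / 2 + 1) * 1" by simp
    also have "\<dots> < (real CARD('n) / 2 + 1) * q"
      using q by (intro mult_strict_left_mono) (auto intro: add_nonneg_pos)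
    finally have "(real CARD('n) + 1) / 2 < (real CARD('n) / 2 + 1) * q" .
    from integrable_hgauge_powr[OF e this, of \<xi>]
    have I: "integrable lborel (\<lambda>\<eta>. hgauge e (hdiff \<xi> \<eta>) powr - ((real CARD('n) / 2 + 1) * q))" .
    show "integrable lborel (\<lambda>\<eta>. \<bar>hgauge e (hdiff \<xi> \<eta>) powr (- (real CARD('n) / 2) - 1)\<bar> powr q)"
    proof -
      have *: "(- (real CARD('n) / 2) - 1) * q = - ((real CARD('n) / 2 + 1) * q)" by (simp add: algebra_simps)
      show ?thesis using I by (simp only: powr_powr abs_of_nonneg[OF powr_ge_zero] *)
    qed
  qed simp_all
  from integrable_mult_right[OF this, of "4 * (real CARD('n))\<^sup>2 * e"] show ?thesis
    by (simp add: happrox_def mult_ac)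
qed

text \<open>Borel measurability and bounds valid everywhere, not only almost everywhere, so that the
  Tonelli arguments stay free of exceptional sets. \<open>weight_representative\<close> produces
  such a weight.\<close>

locale heis_weight =
  fixes g :: "'n::finite heis \<Rightarrow> real" and G :: real
  assumes g_measurable [measurable]: "g \<in> borel_measurable borel"
    and g_pos: "\<And>\<xi>. 0 < g \<xi>" and g_le: "\<And>\<xi>. g \<xi> \<le> G" and g_int: "integrable lborel g"
begin

lemma G_pos: "0 < G" using g_pos[of 0] g_le[of 0] by linarith

text \<open>Where the gauge is below 1, g is bounded and the power of the kernel is integrable;
  elsewhere the power of the kernel is at most 1 and g is integrable. Neither part depends on the
  pole.\<close>

lemma kernel_bound:
  assumes b: "0 \<le> b" "b < (real CARD('n) + 1) / 2"
  obtains M where "M \<ge> 0" "\<And>\<xi>. (\<integral>\<^sup>+\<eta>. ennreal (hgauge 0 (hdiff \<xi> \<eta>) powr - b * g \<eta>) \<partial>lborel) \<le> ennreal M"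
proof
  let ?d = "(real CARD('n) + 1) / 2"
  let ?K = "hvol TYPE('n) * 2 powr b / (1 - 2 powr (b - ?d)) * 1 powr (?d - b)"
  have "2 powr (b - ?d) < 1" using b by (auto simp: powr_less_one)
  then have K: "?K \<ge> 0" using hvol_nonneg[of "TYPE('n)"] by simp
  show "G * ?K + integral\<^sup>L lborel g \<ge> 0"
    using K G_pos g_pos by (intro add_nonneg_nonneg mult_nonneg_nonneg Bochner_Integration.integral_nonneg) (auto intro: less_imp_le)
  fix \<xi> :: "'n heis"
  let ?P = "\<lambda>\<eta>. hgauge 0 (hdiff \<xi> \<eta>)"
  have "(\<integral>\<^sup>+\<eta>. ennreal (?P \<eta> powr - b * g \<eta>) \<partial>lborel) \<le>
      (\<integral>\<^sup>+\<eta>. ennreal G * ennreal (indicator {\<eta>. ?P \<eta> < 1} \<eta> * ?P \<eta> powr - b) + ennreal (g \<eta>) \<partial>lborel)"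
  proof (rule nn_integral_mono)
    fix \<eta>
    have "?P \<eta> powr - b * g \<eta> \<le> G * (indicator {\<eta>. ?P \<eta> < 1} \<eta> * ?P \<eta> powr - b) + g \<eta>"
    proof (cases "?P \<eta> < 1")
      case True
      have "?P \<eta> powr - b * g \<eta> \<le> ?P \<eta> powr - b * G" by (intro mult_left_mono g_le) simp
      then show ?thesis using True g_pos[of \<eta>] by (simp add: mult.commute)
    next
      case False
      then have "?P \<eta> powr - b \<le> 1 powr - b" using b by (intro powr_mono2') auto
      then have "?P \<eta> powr - b * g \<eta> \<le> 1 * g \<eta>" using g_pos[of \<eta>] by (intro mult_right_mono) auto
      then show ?thesis using False by simp
    qed
    then show "ennreal (?P \<eta> powr - b * g \<eta>) \<le> ennreal G * ennreal (indicator {\<eta>. ?P \<eta> < 1} \<eta> * ?P \<eta> powr - b) + ennreal (g \<eta>)"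
      using G_pos g_pos[of \<eta>] by (simp add: ennreal_mult[symmetric] ennreal_plus[symmetric] ennreal_leI del: ennreal_plus)
  qed
  also have "\<dots> = ennreal G * (\<integral>\<^sup>+\<eta>. ennreal (indicator {\<eta>. ?P \<eta> < 1} \<eta> * ?P \<eta> powr - b) \<partial>lborel) + (\<integral>\<^sup>+\<eta>. ennreal (g \<eta>) \<partial>lborel)"
    by (simp add: nn_integral_add nn_integral_cmult)
  also have "\<dots> \<le> ennreal G * ennreal ?K + ennreal (integral\<^sup>L lborel g)"
    using b g_int g_pos
    by (intro add_mono mult_left_mono nn_integral_powr_near vol_hgauge hvol_nonneg)
       (auto simp: hgauge_nonneg nn_integral_eq_integral less_imp_le)
  also have "\<dots> = ennreal (G * ?K + integral\<^sup>L lborel g)"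
  proof -
    have "ennreal G * ennreal k + ennreal i = ennreal (G * k + i)" if "k \<ge> 0" "i \<ge> 0" for k i
      using that G_pos by (simp add: ennreal_mult ennreal_plus)
    from this[OF K] show ?thesis
      using g_pos by (simp add: Bochner_Integration.integral_nonneg less_imp_le)
  qed
  finally show "(\<integral>\<^sup>+\<eta>. ennreal (?P \<eta> powr - b * g \<eta>) \<partial>lborel) \<le> ennreal (G * ?K + integral\<^sup>L lborel g)" .
qed

section \<open>Convergence of the approximate identity in weighted L1\<close>

lemma weighted_L1_le:
  assumes [measurable]: "w \<in> borel_measurable borel" and w: "integrable lborel (\<lambda>\<eta>. \<bar>w \<eta>\<bar> powr p)"
    and p: "p \<ge> 1" and \<delta>: "\<delta> > 0"
  shows "(\<integral>\<^sup>+\<xi>. ennreal (\<bar>w \<xi>\<bar> * g \<xi>) \<partial>lborel) \<le>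
    ennreal (\<delta> * integral\<^sup>L lborel g + \<delta> powr (1 - p) * G * (LINT \<eta>|lborel. \<bar>w \<eta>\<bar> powr p))"
proof -
  have "(\<integral>\<^sup>+\<xi>. ennreal (\<bar>w \<xi>\<bar> * g \<xi>) \<partial>lborel) \<le> (\<integral>\<^sup>+\<xi>. ennreal (\<delta> * g \<xi> + \<delta> powr (1 - p) * G * \<bar>w \<xi>\<bar> powr p) \<partial>lborel)"
  proof (intro nn_integral_mono ennreal_leI)
    fix \<xi>
    have "\<bar>w \<xi>\<bar> * g \<xi> \<le> (\<delta> + \<delta> powr (1 - p) * \<bar>w \<xi>\<bar> powr p) * g \<xi>"
      using g_pos[of \<xi>] by (intro mult_right_mono abs_le_powr_split \<delta> p) auto
    also have "\<dots> \<le> \<delta> * g \<xi> + \<delta> powr (1 - p) * \<bar>w \<xi>\<bar> powr p * G"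
      unfolding distrib_right using g_le[of \<xi>] by (intro add_left_mono mult_left_mono) auto
    finally show "\<bar>w \<xi>\<bar> * g \<xi> \<le> \<delta> * g \<xi> + \<delta> powr (1 - p) * G * \<bar>w \<xi>\<bar> powr p" by (simp add: mult_ac)
  qed
  also have "\<dots> = ennreal (LINT \<xi>|lborel. \<delta> * g \<xi> + \<delta> powr (1 - p) * G * \<bar>w \<xi>\<bar> powr p)"
    using g_int w g_pos G_pos \<delta> by (intro nn_integral_eq_integral) (auto simp: less_imp_le)
  also have "\<dots> = ennreal (\<delta> * integral\<^sup>L lborel g + \<delta> powr (1 - p) * G * (LINT \<eta>|lborel. \<bar>w \<eta>\<bar> powr p))"
    using g_int w by simp
  finally show ?thesis .
qed

text \<open>Smoothing costs only the factor \<open>hmass\<close>: the constant part \<delta>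
  integrates against the kernel in \<eta>, while for the p-th power Tonelli and the symmetry of
  \<open>happrox\<close> allow integration in \<xi> first.\<close>

lemma weighted_L1_happrox_le:
  assumes [measurable]: "w \<in> borel_measurable borel" and w: "integrable lborel (\<lambda>\<eta>. \<bar>w \<eta>\<bar> powr p)"
    and p: "p \<ge> 1" and \<delta>: "\<delta> > 0" and r: "r > 0"
  shows "(\<integral>\<^sup>+\<xi>. (\<integral>\<^sup>+\<eta>. ennreal \<bar>w \<eta>\<bar> * ennreal (happrox (r\<^sup>2) \<xi> \<eta>) \<partial>lborel) * ennreal (g \<xi>) \<partial>lborel) \<le>
    ennreal (hmass TYPE('n) * (\<delta> * integral\<^sup>L lborel g + \<delta> powr (1 - p) * G * (LINT \<eta>|lborel. \<bar>w \<eta>\<bar> powr p)))"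
proof -
  let ?c = "hmass TYPE('n)"
  let ?a = "\<lambda>\<xi> \<eta>. ennreal (happrox (r\<^sup>2) \<xi> \<eta>)"
  let ?A = "\<integral>\<^sup>+\<eta>. ennreal (\<bar>w \<eta>\<bar> powr p) \<partial>lborel"
  have "(\<integral>\<^sup>+\<xi>. (\<integral>\<^sup>+\<eta>. ennreal \<bar>w \<eta>\<bar> * ?a \<xi> \<eta> \<partial>lborel) * ennreal (g \<xi>) \<partial>lborel) \<le>
      (\<integral>\<^sup>+\<xi>. ennreal \<delta> * ennreal ?c * ennreal (g \<xi>) + ennreal (\<delta> powr (1 - p)) * ennreal G * (\<integral>\<^sup>+\<eta>. ennreal (\<bar>w \<eta>\<bar> powr p) * ?a \<xi> \<eta> \<partial>lborel) \<partial>lborel)"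
  proof (rule nn_integral_mono)
    fix \<xi>
    have "(\<integral>\<^sup>+\<eta>. ennreal \<bar>w \<eta>\<bar> * ?a \<xi> \<eta> \<partial>lborel) \<le> (\<integral>\<^sup>+\<eta>. ennreal \<delta> * ?a \<xi> \<eta> + ennreal (\<delta> powr (1 - p)) * (ennreal (\<bar>w \<eta>\<bar> powr p) * ?a \<xi> \<eta>) \<partial>lborel)"
    proof (rule nn_integral_mono)
      fix \<eta>
      have "ennreal \<bar>w \<eta>\<bar> \<le> ennreal \<delta> + ennreal (\<delta> powr (1 - p)) * ennreal (\<bar>w \<eta>\<bar> powr p)"
        using abs_le_powr_split[OF \<delta> p, of "w \<eta>"] \<delta>
        by (simp add: ennreal_mult[symmetric] ennreal_plus[symmetric] ennreal_leI del: ennreal_plus)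
      then have "ennreal \<bar>w \<eta>\<bar> * ?a \<xi> \<eta> \<le> (ennreal \<delta> + ennreal (\<delta> powr (1 - p)) * ennreal (\<bar>w \<eta>\<bar> powr p)) * ?a \<xi> \<eta>"
        by (rule mult_right_mono) simp
      then show "ennreal \<bar>w \<eta>\<bar> * ?a \<xi> \<eta> \<le> ennreal \<delta> * ?a \<xi> \<eta> + ennreal (\<delta> powr (1 - p)) * (ennreal (\<bar>w \<eta>\<bar> powr p) * ?a \<xi> \<eta>)"
        by (simp only: distrib_right mult.assoc)
    qed
    also have "\<dots> = ennreal \<delta> * ennreal ?c + ennreal (\<delta> powr (1 - p)) * (\<integral>\<^sup>+\<eta>. ennreal (\<bar>w \<eta>\<bar> powr p) * ?a \<xi> \<eta> \<partial>lborel)"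
      by (simp add: nn_integral_add nn_integral_cmult nn_integral_happrox(1)[OF r])
    finally have "(\<integral>\<^sup>+\<eta>. ennreal \<bar>w \<eta>\<bar> * ?a \<xi> \<eta> \<partial>lborel) * ennreal (g \<xi>) \<le>
        (ennreal \<delta> * ennreal ?c + ennreal (\<delta> powr (1 - p)) * (\<integral>\<^sup>+\<eta>. ennreal (\<bar>w \<eta>\<bar> powr p) * ?a \<xi> \<eta> \<partial>lborel)) * ennreal (g \<xi>)"
      by (rule mult_right_mono) simp
    also have "\<dots> = ennreal \<delta> * ennreal ?c * ennreal (g \<xi>) + ennreal (\<delta> powr (1 - p)) * ennreal (g \<xi>) * (\<integral>\<^sup>+\<eta>. ennreal (\<bar>w \<eta>\<bar> powr p) * ?a \<xi> \<eta> \<partial>lborel)"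
      unfolding distrib_right by (simp only: mult_ac)
    also have "\<dots> \<le> ennreal \<delta> * ennreal ?c * ennreal (g \<xi>) + ennreal (\<delta> powr (1 - p)) * ennreal G * (\<integral>\<^sup>+\<eta>. ennreal (\<bar>w \<eta>\<bar> powr p) * ?a \<xi> \<eta> \<partial>lborel)"
      by (intro add_left_mono mult_right_mono mult_left_mono ennreal_leI g_le) auto
    finally show "(\<integral>\<^sup>+\<eta>. ennreal \<bar>w \<eta>\<bar> * ?a \<xi> \<eta> \<partial>lborel) * ennreal (g \<xi>) \<le>
       ennreal \<delta> * ennreal ?c * ennreal (g \<xi>) + ennreal (\<delta> powr (1 - p)) * ennreal G * (\<integral>\<^sup>+\<eta>. ennreal (\<bar>w \<eta>\<bar> powr p) * ?a \<xi> \<eta> \<partial>lborel)" .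
  qed
  also have "\<dots> = ennreal \<delta> * ennreal ?c * (\<integral>\<^sup>+\<xi>. ennreal (g \<xi>) \<partial>lborel)
      + ennreal (\<delta> powr (1 - p)) * ennreal G * (\<integral>\<^sup>+\<xi>. \<integral>\<^sup>+\<eta>. ennreal (\<bar>w \<eta>\<bar> powr p) * ?a \<xi> \<eta> \<partial>lborel \<partial>lborel)"
     by (simp add: nn_integral_add nn_integral_cmult split_beta')
  also have "(\<integral>\<^sup>+\<xi>. \<integral>\<^sup>+\<eta>. ennreal (\<bar>w \<eta>\<bar> powr p) * ?a \<xi> \<eta> \<partial>lborel \<partial>lborel) = (\<integral>\<^sup>+\<eta>. \<integral>\<^sup>+\<xi>. ennreal (\<bar>w \<eta>\<bar> powr p) * ?a \<xi> \<eta> \<partial>lborel \<partial>lborel)"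
     by (intro lborel_pair.Fubini'[symmetric]) (simp add: split_beta')
  also have "\<dots> = (\<integral>\<^sup>+\<eta>. ennreal (\<bar>w \<eta>\<bar> powr p) * ennreal ?c \<partial>lborel)"
    by (simp add: nn_integral_cmult nn_integral_happrox(1)[OF r] happrox_commute[of _ _ "\<eta>" for \<eta>])
  also have "\<dots> = ennreal (LINT \<eta>|lborel. \<bar>w \<eta>\<bar> powr p) * ennreal ?c"
    using w by (simp add: nn_integral_multc nn_integral_eq_integral)
  also have "(\<integral>\<^sup>+\<xi>. ennreal (g \<xi>) \<partial>lborel) = ennreal (integral\<^sup>L lborel g)"
    using g_int g_pos by (simp add: nn_integral_eq_integral less_imp_le)
  also have "ennreal \<delta> * ennreal ?c * ennreal (integral\<^sup>L lborel g) + ennreal (\<delta> powr (1 - p)) * ennreal G * (ennreal (LINT \<eta>|lborel. \<bar>w \<eta>\<bar> powr p) * ennreal ?c)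
     = ennreal (?c * (\<delta> * integral\<^sup>L lborel g + \<delta> powr (1 - p) * G * (LINT \<eta>|lborel. \<bar>w \<eta>\<bar> powr p)))"
  proof -
    have nn: "0 \<le> integral\<^sup>L lborel g" "0 \<le> ?c" "0 \<le> (LINT \<eta>|lborel. \<bar>w \<eta>\<bar> powr p)" "0 \<le> \<delta>" "0 \<le> G"
      using g_pos hmass_pos[where 'n='n] \<delta> G_pos by (auto intro!: Bochner_Integration.integral_nonneg simp: less_imp_le)
    then show ?thesis
      by (simp add: ennreal_mult[symmetric] ennreal_plus[symmetric] algebra_simps del: ennreal_plus)
  qed
  finally show ?thesis .
qed

text \<open>The mass is constant, so the error is an average of u(\<eta>) - u(\<xi>). Inserting
  w(\<eta>) and w(\<xi>) leaves two copies of the L^p error w - u and the oscillation of the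
  continuous function w.\<close>

lemma happrox_convolution_le:
  assumes [measurable]: "u \<in> borel_measurable borel" "w \<in> borel_measurable borel"
    and u: "\<And>\<xi>. integrable lborel (\<lambda>\<eta>. u \<eta> * happrox (r\<^sup>2) \<xi> \<eta>)"
    and diff: "integrable lborel (\<lambda>\<eta>. \<bar>w \<eta> - u \<eta>\<bar> powr p)"
    and p: "p \<ge> 1" and \<delta>: "\<delta> > 0" and r: "r > 0"
  shows "(\<integral>\<^sup>+\<xi>. ennreal (\<bar>(LINT \<eta>|lborel. u \<eta> * happrox (r\<^sup>2) \<xi> \<eta>) - hmass TYPE('n) * u \<xi>\<bar> * g \<xi>) \<partial>lborel) \<le>
    ennreal (2 * hmass TYPE('n) * (\<delta> * integral\<^sup>L lborel g + \<delta> powr (1 - p) * G * (LINT \<eta>|lborel. \<bar>w \<eta> - u \<eta>\<bar> powr p)))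
    + (\<integral>\<^sup>+\<xi>. (\<integral>\<^sup>+\<eta>. ennreal \<bar>w \<eta> - w \<xi>\<bar> * ennreal (happrox (r\<^sup>2) \<xi> \<eta>) \<partial>lborel) * ennreal (g \<xi>) \<partial>lborel)"
proof -
  let ?c = "hmass TYPE('n)"
  let ?a = "\<lambda>\<xi> \<eta>. ennreal (happrox (r\<^sup>2) \<xi> \<eta>)"
  let ?S = "\<delta> * integral\<^sup>L lborel g + \<delta> powr (1 - p) * G * (LINT \<eta>|lborel. \<bar>w \<eta> - u \<eta>\<bar> powr p)"
  have [measurable]: "(\<lambda>z. ?a (fst z) (snd z)) \<in> borel_measurable (borel \<Otimes>\<^sub>M borel)"
     by simp
  define A where "A \<xi> = (\<integral>\<^sup>+\<eta>. ennreal \<bar>w \<eta> - u \<eta>\<bar> * ?a \<xi> \<eta> \<partial>lborel)" for \<xi>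
  define B where "B \<xi> = (\<integral>\<^sup>+\<eta>. ennreal \<bar>w \<eta> - w \<xi>\<bar> * ?a \<xi> \<eta> \<partial>lborel)" for \<xi>
  have [measurable]: "A \<in> borel_measurable borel"
    unfolding A_def by (intro lborel.borel_measurable_nn_integral) (simp add: split_beta')
  have [measurable]: "B \<in> borel_measurable borel"
    unfolding B_def by (intro lborel.borel_measurable_nn_integral) (simp add: split_beta')
  have pt: "ennreal (\<bar>(LINT \<eta>|lborel. u \<eta> * happrox (r\<^sup>2) \<xi> \<eta>) - ?c * u \<xi>\<bar> * g \<xi>) \<le>
      A \<xi> * ennreal (g \<xi>) + B \<xi> * ennreal (g \<xi>) + ennreal ?c * ennreal (\<bar>w \<xi> - u \<xi>\<bar> * g \<xi>)" for \<xi>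
  proof -
    have ih: "integrable lborel (happrox (r\<^sup>2) \<xi>)" using r by (intro integrable_happrox) simp
    have ch: "(LINT \<eta>|lborel. happrox (r\<^sup>2) \<xi> \<eta>) = ?c"
      using nn_integral_eq_integral[OF ih] nn_integral_happrox(1)[OF r, of \<xi>] hmass_pos[where 'n='n]
      by (simp add: happrox_nonneg Bochner_Integration.integral_nonneg)
    have "(LINT \<eta>|lborel. u \<eta> * happrox (r\<^sup>2) \<xi> \<eta>) - ?c * u \<xi> = (LINT \<eta>|lborel. (u \<eta> - u \<xi>) * happrox (r\<^sup>2) \<xi> \<eta>)"
      unfolding ch[symmetric] left_diff_distrib using u ih by (simp add: mult.commute[of "u \<xi>"])
    moreover have "integrable lborel (\<lambda>\<eta>. (u \<eta> - u \<xi>) * happrox (r\<^sup>2) \<xi> \<eta>)"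
      unfolding left_diff_distrib using u ih by simp
    ultimately have "ennreal \<bar>(LINT \<eta>|lborel. u \<eta> * happrox (r\<^sup>2) \<xi> \<eta>) - ?c * u \<xi>\<bar> \<le>
        (\<integral>\<^sup>+\<eta>. ennreal \<bar>(u \<eta> - u \<xi>) * happrox (r\<^sup>2) \<xi> \<eta>\<bar> \<partial>lborel)"
      using integral_norm_bound_ennreal[of lborel "\<lambda>\<eta>. (u \<eta> - u \<xi>) * happrox (r\<^sup>2) \<xi> \<eta>"] by simp
    also have "\<dots> \<le> (\<integral>\<^sup>+\<eta>. ennreal \<bar>w \<eta> - u \<eta>\<bar> * ?a \<xi> \<eta> + ennreal \<bar>w \<eta> - w \<xi>\<bar> * ?a \<xi> \<eta> + ennreal \<bar>w \<xi> - u \<xi>\<bar> * ?a \<xi> \<eta> \<partial>lborel)"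
    proof (rule nn_integral_mono)
      fix \<eta>
      have h0: "0 \<le> happrox (r\<^sup>2) \<xi> \<eta>" by (simp add: happrox_nonneg)
      have "\<bar>(u \<eta> - u \<xi>) * happrox (r\<^sup>2) \<xi> \<eta>\<bar> \<le> (\<bar>w \<eta> - u \<eta>\<bar> + \<bar>w \<eta> - w \<xi>\<bar> + \<bar>w \<xi> - u \<xi>\<bar>) * happrox (r\<^sup>2) \<xi> \<eta>"
        unfolding abs_mult abs_of_nonneg[OF h0] by (intro mult_right_mono h0) linarith
      then show "ennreal \<bar>(u \<eta> - u \<xi>) * happrox (r\<^sup>2) \<xi> \<eta>\<bar> \<le>
          ennreal \<bar>w \<eta> - u \<eta>\<bar> * ?a \<xi> \<eta> + ennreal \<bar>w \<eta> - w \<xi>\<bar> * ?a \<xi> \<eta> + ennreal \<bar>w \<xi> - u \<xi>\<bar> * ?a \<xi> \<eta>"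
        using h0 by (simp add: ennreal_mult[symmetric] ennreal_plus[symmetric] distrib_right ennreal_leI del: ennreal_plus)
    qed
    also have "\<dots> = A \<xi> + B \<xi> + ennreal \<bar>w \<xi> - u \<xi>\<bar> * ennreal ?c"
      by (simp add: nn_integral_add nn_integral_cmult nn_integral_happrox(1)[OF r] A_def B_def)
    finally have "ennreal \<bar>(LINT \<eta>|lborel. u \<eta> * happrox (r\<^sup>2) \<xi> \<eta>) - ?c * u \<xi>\<bar> * ennreal (g \<xi>) \<le>
        (A \<xi> + B \<xi> + ennreal \<bar>w \<xi> - u \<xi>\<bar> * ennreal ?c) * ennreal (g \<xi>)"
      by (rule mult_right_mono) simp
    then show ?thesis
      using g_pos[of \<xi>] unfolding distrib_right by (simp add: ennreal_mult' mult_ac)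
  qed
  have "(\<integral>\<^sup>+\<xi>. ennreal (\<bar>(LINT \<eta>|lborel. u \<eta> * happrox (r\<^sup>2) \<xi> \<eta>) - ?c * u \<xi>\<bar> * g \<xi>) \<partial>lborel) \<le>
      (\<integral>\<^sup>+\<xi>. A \<xi> * ennreal (g \<xi>) + B \<xi> * ennreal (g \<xi>) + ennreal ?c * ennreal (\<bar>w \<xi> - u \<xi>\<bar> * g \<xi>) \<partial>lborel)"
    by (intro nn_integral_mono pt)
  also have "\<dots> = (\<integral>\<^sup>+\<xi>. A \<xi> * ennreal (g \<xi>) \<partial>lborel) + (\<integral>\<^sup>+\<xi>. B \<xi> * ennreal (g \<xi>) \<partial>lborel)
      + ennreal ?c * (\<integral>\<^sup>+\<xi>. ennreal (\<bar>w \<xi> - u \<xi>\<bar> * g \<xi>) \<partial>lborel)"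
    by (simp add: nn_integral_add nn_integral_cmult)
  also have "\<dots> \<le> ennreal (?c * ?S) + (\<integral>\<^sup>+\<xi>. B \<xi> * ennreal (g \<xi>) \<partial>lborel) + ennreal ?c * ennreal ?S"
    unfolding A_def
    by (intro add_mono mult_left_mono order_refl weighted_L1_happrox_le weighted_L1_le diff p \<delta> r) auto
  also have "\<dots> = ennreal (2 * ?c * ?S) + (\<integral>\<^sup>+\<xi>. B \<xi> * ennreal (g \<xi>) \<partial>lborel)"
  proof -
    have nn: "0 \<le> integral\<^sup>L lborel g" "0 \<le> (LINT \<eta>|lborel. \<bar>w \<eta> - u \<eta>\<bar> powr p)"
      using g_pos by (auto intro!: Bochner_Integration.integral_nonneg simp: less_imp_le)
    have "0 \<le> ?S" using \<delta> G_pos nn by simp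
    then have "ennreal (?c * ?S) + ennreal ?c * ennreal ?S = ennreal (2 * ?c * ?S)"
      using hmass_pos[where 'n='n]
      by (simp add: ennreal_mult[symmetric] ennreal_plus[symmetric] del: ennreal_plus)
    then show ?thesis by (simp only: add.assoc[symmetric] add.commute[of _ "\<integral>\<^sup>+\<xi>. B \<xi> * ennreal (g \<xi>) \<partial>lborel"]) (simp only: add.assoc)
  qed
  finally show ?thesis unfolding B_def .
qed

text \<open>Integrate first in the pole against g: by symmetry and \<open>kernel_bound\<close> the
  result is at most a constant times the L1 norm of h, so the inner integral is finite for almost
  every pole.\<close>

lemma AE_integrable_hker:
  assumes h: "integrable lborel h"
  shows "AE \<xi>::'n heis in lborel. integrable lborel (\<lambda>\<eta>. h \<eta> * hker 0 \<xi> \<eta>)"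
proof -
  have [measurable]: "h \<in> borel_measurable borel" using borel_measurable_integrable[OF h] by simp
  obtain M where M: "M \<ge> 0" "\<And>\<xi>. (\<integral>\<^sup>+\<eta>. ennreal (hgauge 0 (hdiff \<xi> \<eta>) powr - (real CARD('n) / 2) * g \<eta>) \<partial>lborel) \<le> ennreal M"
    using kernel_bound[of "real CARD('n) / 2"] by auto
  have [measurable]: "(\<lambda>z. hker 0 (fst z) (snd z)) \<in> borel_measurable (borel \<Otimes>\<^sub>M borel)"
    by (rule measurable_hker(2))
  have "(\<integral>\<^sup>+\<xi>. \<integral>\<^sup>+\<eta>. ennreal \<bar>h \<eta>\<bar> * ennreal (hker 0 \<xi> \<eta> * g \<xi>) \<partial>lborel \<partial>lborel)
     = (\<integral>\<^sup>+\<eta>. \<integral>\<^sup>+\<xi>. ennreal \<bar>h \<eta>\<bar> * ennreal (hker 0 \<xi> \<eta> * g \<xi>) \<partial>lborel \<partial>lborel)"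
    by (intro lborel_pair.Fubini'[symmetric]) (simp add: split_beta')
  also have "\<dots> = (\<integral>\<^sup>+\<eta>. ennreal \<bar>h \<eta>\<bar> * (\<integral>\<^sup>+\<xi>. ennreal (hker 0 \<eta> \<xi> * g \<xi>) \<partial>lborel) \<partial>lborel)"
    by (intro nn_integral_cong) (subst nn_integral_cmult, simp_all add: hker_commute)
  also have "\<dots> \<le> (\<integral>\<^sup>+\<eta>. ennreal \<bar>h \<eta>\<bar> * ennreal M \<partial>lborel)"
    unfolding hker_def by (intro nn_integral_mono mult_left_mono M) simp
  also have "\<dots> < \<infinity>"
    using h M by (simp add: nn_integral_multc nn_integral_eq_integral ennreal_mult_less_top)
  finally have "AE \<xi> in lborel. (\<integral>\<^sup>+\<eta>. ennreal \<bar>h \<eta>\<bar> * ennreal (hker 0 \<xi> \<eta> * g \<xi>) \<partial>lborel) \<noteq> \<infinity>"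
    by (intro nn_integral_PInf_AE lborel.borel_measurable_nn_integral) (auto simp: split_beta')
  then show ?thesis
  proof eventually_elim
    case (elim \<xi>)
    have "(\<integral>\<^sup>+\<eta>. ennreal \<bar>h \<eta>\<bar> * ennreal (hker 0 \<xi> \<eta> * g \<xi>) \<partial>lborel)
        = (\<integral>\<^sup>+\<eta>. ennreal (g \<xi>) * ennreal (norm (h \<eta> * hker 0 \<xi> \<eta>)) \<partial>lborel)"
      using g_pos[of \<xi>] by (intro nn_integral_cong) (simp add: abs_mult hker_nonneg ennreal_mult[symmetric] mult_ac)
    also have "\<dots> = ennreal (g \<xi>) * (\<integral>\<^sup>+\<eta>. ennreal (norm (h \<eta> * hker 0 \<xi> \<eta>)) \<partial>lborel)"
      by (rule nn_integral_cmult) simp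
    finally have "(\<integral>\<^sup>+\<eta>. ennreal (norm (h \<eta> * hker 0 \<xi> \<eta>)) \<partial>lborel) \<noteq> \<infinity>"
      using elim g_pos[of \<xi>] by (auto simp: ennreal_mult_eq_top_iff)
    then show ?case by (intro integrableI_bounded) (auto simp: less_top)
  qed
qed

text \<open>The two sides of the regularized representation converge, respectively, in the weighted
  \<open>L\<^sup>1\<close> space and almost everywhere; Fatou's lemma identifies the limits.\<close>

lemma potential_representation:
  fixes u h :: "'n heis \<Rightarrow> real"
  assumes u [measurable]: "u \<in> borel_measurable borel" and p: "p > 1" "integrable lborel (\<lambda>\<eta>. \<bar>u \<eta>\<bar> powr p)"
    and h: "integrable lborel h"
    and rep: "\<And>e \<xi>. e > 0 \<Longrightarrow> (LINT \<eta>|lborel. u \<eta> * happrox e \<xi> \<eta>) = (LINT \<eta>|lborel. h \<eta> * hker e \<xi> \<eta>)"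
    and w: "\<And>j. continuous_on UNIV (w j)" "\<And>j. bounded {\<xi>. w j \<xi> \<noteq> 0}"
      "\<And>j. integrable lborel (\<lambda>\<eta>. \<bar>w j \<eta> - u \<eta>\<bar> powr p)"
      "(\<lambda>j. LINT \<eta>|lborel. \<bar>w j \<eta> - u \<eta>\<bar> powr p) \<longlonglongrightarrow> 0"
  shows "AE \<xi> in lborel. integrable lborel (\<lambda>\<eta>. h \<eta> * hker 0 \<xi> \<eta>) \<and>
    hmass TYPE('n) * u \<xi> = (LINT \<eta>|lborel. h \<eta> * hker 0 \<xi> \<eta>)"
proof -
  let ?c = "hmass TYPE('n)"
  define \<rho> where "\<rho> k = 1 / real (Suc k)" for k
  have \<rho>: "\<rho> k > 0" for k by (simp add: \<rho>_def)
  have [measurable]: "h \<in> borel_measurable borel" using borel_measurable_integrable[OF h] by simp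
  have [measurable]: "w j \<in> borel_measurable borel" for j by (rule borel_measurable_continuous_onI[OF w(1)])
  note ui = integrable_mult_happrox[OF u p]
  define U where "U k \<xi> = (LINT \<eta>|lborel. u \<eta> * happrox ((\<rho> k)\<^sup>2) \<xi> \<eta>)" for k \<xi>
  have [measurable]: "U k \<in> borel_measurable borel" for k
    unfolding U_def
    by (intro lborel.borel_measurable_lebesgue_integral) (simp add: split_beta')
  define V where "V \<xi> = (LINT \<eta>|lborel. h \<eta> * hker 0 \<xi> \<eta>)" for \<xi>
  have [measurable]: "V \<in> borel_measurable borel"
    unfolding V_def
    by (intro lborel.borel_measurable_lebesgue_integral) (simp add: split_beta')
  note int0 = AE_integrable_hker[OF h]
  have UV: "(\<lambda>k. U k \<xi>) \<longlonglongrightarrow> V \<xi>" if int: "integrable lborel (\<lambda>\<eta>. h \<eta> * hker 0 \<xi> \<eta>)" for \<xi>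
  proof -
    have "(\<lambda>k. LINT \<eta>|lborel. h \<eta> * hker ((\<rho> k)\<^sup>2) \<xi> \<eta>) \<longlonglongrightarrow> V \<xi>"
      unfolding V_def
    proof (rule integral_dominated_convergence)
      show "integrable lborel (\<lambda>\<eta>. norm (h \<eta> * hker 0 \<xi> \<eta>))" using int by simp
      \<comment> \<open>At \<eta> = \<xi> the default value of \<open>hker 0\<close> would spoil
        both the pointwise limit and the domination.\<close>
      have ne: "AE \<eta> in lborel. \<xi> \<noteq> \<eta>" using AE_lborel_singleton[of \<xi>] by eventually_elim simp
      show "AE \<eta> in lborel. (\<lambda>k. h \<eta> * hker ((\<rho> k)\<^sup>2) \<xi> \<eta>) \<longlonglongrightarrow> h \<eta> * hker 0 \<xi> \<eta>"
        using ne
      proof eventually_elim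
        case (elim \<eta>)
        have "(\<lambda>k. (\<rho> k)\<^sup>2) \<longlonglongrightarrow> 0\<^sup>2"
          unfolding \<rho>_def using LIMSEQ_inverse_real_of_nat by (intro tendsto_power) (simp add: inverse_eq_divide)
        then have "(\<lambda>k. hgauge ((\<rho> k)\<^sup>2) (hdiff \<xi> \<eta>)) \<longlonglongrightarrow> hgauge 0 (hdiff \<xi> \<eta>)"
          unfolding hgauge_def split_beta by (intro tendsto_intros) simp
        then show ?case
          unfolding hker_def using elim by (intro tendsto_intros) (simp_all add: hgauge_0_eq_0_iff)
      qed
      show "AE \<eta> in lborel. norm (h \<eta> * hker ((\<rho> k)\<^sup>2) \<xi> \<eta>) \<le> norm (h \<eta> * hker 0 \<xi> \<eta>)" for k
        using ne
      proof eventually_elim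
        case (elim \<eta>)
        then have "0 < hgauge 0 (hdiff \<xi> \<eta>)"
          using hgauge_nonneg[of 0 "hdiff \<xi> \<eta>"] hgauge_0_eq_0_iff[of \<xi> \<eta>] by linarith
        then have "hker ((\<rho> k)\<^sup>2) \<xi> \<eta> \<le> hker 0 \<xi> \<eta>"
          unfolding hker_def by (intro powr_mono2' hgauge_mono) auto
        then show ?case by (simp add: abs_mult hker_nonneg mult_left_mono)
      qed
    qed simp_all
    then show ?thesis by (simp add: U_def rep[OF zero_less_power[OF \<rho>]])
  qed
  let ?I = "\<lambda>k. \<integral>\<^sup>+\<xi>. ennreal (\<bar>U k \<xi> - ?c * u \<xi>\<bar> * g \<xi>) \<partial>lborel"
  let ?X = "\<integral>\<^sup>+\<xi>. ennreal (\<bar>V \<xi> - ?c * u \<xi>\<bar> * g \<xi>) \<partial>lborel"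
  have "?X = (\<integral>\<^sup>+\<xi>. liminf (\<lambda>k. ennreal (\<bar>U k \<xi> - ?c * u \<xi>\<bar> * g \<xi>)) \<partial>lborel)"
  proof (rule nn_integral_cong_AE)
    show "AE \<xi> in lborel. ennreal (\<bar>V \<xi> - ?c * u \<xi>\<bar> * g \<xi>) = liminf (\<lambda>k. ennreal (\<bar>U k \<xi> - ?c * u \<xi>\<bar> * g \<xi>))"
      using int0
    proof eventually_elim
      case (elim \<xi>)
      have "(\<lambda>k. ennreal (\<bar>U k \<xi> - ?c * u \<xi>\<bar> * g \<xi>)) \<longlonglongrightarrow> ennreal (\<bar>V \<xi> - ?c * u \<xi>\<bar> * g \<xi>)"
        by (intro tendsto_ennrealI tendsto_intros UV elim)
      then show ?case by (intro lim_imp_Liminf[symmetric]) auto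
    qed
  qed
  also have "\<dots> \<le> liminf ?I" by (rule nn_integral_liminf) simp
  finally have X: "?X \<le> liminf ?I" .
  \<comment> \<open>The order of limits matters: k with j and \<delta> fixed, then j in
    \<open>X3\<close>, then \<delta>. The factor \<delta> powr (1 - p) blows up as \<delta> tends to
    0, so the L^p error must be gone before.\<close>
  have X2: "?X \<le> ennreal (2 * ?c * (\<delta> * integral\<^sup>L lborel g + \<delta> powr (1 - p) * G * (LINT \<eta>|lborel. \<bar>w j \<eta> - u \<eta>\<bar> powr p)))"
    (is "_ \<le> ennreal (?S \<delta> j)") if \<delta>: "\<delta> > 0" for \<delta> j
  proof -
    let ?B = "\<lambda>k \<xi>. (\<integral>\<^sup>+\<eta>. ennreal \<bar>w j \<eta> - w j \<xi>\<bar> * ennreal (happrox ((\<rho> k)\<^sup>2) \<xi> \<eta>) \<partial>lborel)"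
    have [measurable]: "?B k \<in> borel_measurable borel" for k

      by (intro lborel.borel_measurable_nn_integral) (simp add: split_beta')
    obtain b where b: "b > 0" "\<And>\<xi>. \<bar>w j \<xi>\<bar> \<le> b"
      using continuous_bounded_support_bounded[OF w(1,2)] by blast
    have "(\<lambda>k. \<integral>\<^sup>+\<xi>. ?B k \<xi> * ennreal (g \<xi>) \<partial>lborel) \<longlonglongrightarrow> (\<integral>\<^sup>+(\<xi>::'n heis). 0 \<partial>lborel)"
    proof (rule nn_integral_dominated_convergence)
      show "AE \<xi> in lborel. ?B k \<xi> * ennreal (g \<xi>) \<le> ennreal (2 * b) * ennreal ?c * ennreal (g \<xi>)" for k
      proof (intro AE_I2 mult_right_mono)
        fix \<xi>
        have "?B k \<xi> \<le> (\<integral>\<^sup>+\<eta>. ennreal (2 * b) * ennreal (happrox ((\<rho> k)\<^sup>2) \<xi> \<eta>) \<partial>lborel)"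
        proof (intro nn_integral_mono mult_right_mono ennreal_leI)
          fix \<eta> show "\<bar>w j \<eta> - w j \<xi>\<bar> \<le> 2 * b" using b(2)[of \<eta>] b(2)[of \<xi>] by linarith
        qed simp
        also have "\<dots> = ennreal (2 * b) * ennreal ?c"
          by (subst nn_integral_cmult) (simp_all add: nn_integral_happrox(1)[OF \<rho>])
        finally show "?B k \<xi> \<le> ennreal (2 * b) * ennreal ?c" .
      qed simp
      show "(\<integral>\<^sup>+\<xi>. ennreal (2 * b) * ennreal ?c * ennreal (g \<xi>) \<partial>lborel) < \<infinity>"
        using g_int g_pos by (subst nn_integral_cmult) (auto simp: nn_integral_eq_integral less_imp_le ennreal_mult_less_top)
      show "AE \<xi> in lborel. (\<lambda>k. ?B k \<xi> * ennreal (g \<xi>)) \<longlonglongrightarrow> 0"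
      proof (rule AE_I2)
        fix \<xi>
        have "(\<lambda>k. ?B k \<xi>) \<longlonglongrightarrow> 0"
          unfolding \<rho>_def by (rule happrox_concentrates[OF w(1) b(2)])
        then have "(\<lambda>k. ?B k \<xi> * ennreal (g \<xi>)) \<longlonglongrightarrow> 0 * ennreal (g \<xi>)"
          by (intro tendsto_mult_ennreal tendsto_const) auto
        then show "(\<lambda>k. ?B k \<xi> * ennreal (g \<xi>)) \<longlonglongrightarrow> 0" by simp
      qed
    qed simp_all
    then have "(\<lambda>k. ennreal (?S \<delta> j) + (\<integral>\<^sup>+\<xi>. ?B k \<xi> * ennreal (g \<xi>) \<partial>lborel)) \<longlonglongrightarrow> ennreal (?S \<delta> j) + 0"
      by (intro tendsto_add tendsto_const) simp
    then have "liminf (\<lambda>k. ennreal (?S \<delta> j) + (\<integral>\<^sup>+\<xi>. ?B k \<xi> * ennreal (g \<xi>) \<partial>lborel)) = ennreal (?S \<delta> j)"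
      by (intro lim_imp_Liminf) auto
    moreover have "liminf ?I \<le> liminf (\<lambda>k. ennreal (?S \<delta> j) + (\<integral>\<^sup>+\<xi>. ?B k \<xi> * ennreal (g \<xi>) \<partial>lborel))"
      unfolding U_def using \<rho> p(1) \<delta>
      by (intro Liminf_mono always_eventually allI happrox_convolution_le ui w(3)) (auto simp: less_imp_neq[OF \<rho>, symmetric])
    ultimately show ?thesis using X by simp
  qed
  have X3: "?X \<le> ennreal (2 * ?c * (\<delta> * integral\<^sup>L lborel g))" if \<delta>: "\<delta> > 0" for \<delta>
  proof (rule LIMSEQ_le_const)
    have "(\<lambda>j. ennreal (2 * ?c * (\<delta> * integral\<^sup>L lborel g + \<delta> powr (1 - p) * G * (LINT \<eta>|lborel. \<bar>w j \<eta> - u \<eta>\<bar> powr p))))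
      \<longlonglongrightarrow> ennreal (2 * ?c * (\<delta> * integral\<^sup>L lborel g + \<delta> powr (1 - p) * G * 0))"
      by (intro tendsto_ennrealI tendsto_intros w(4))
    then show "(\<lambda>j. ennreal (2 * ?c * (\<delta> * integral\<^sup>L lborel g + \<delta> powr (1 - p) * G * (LINT \<eta>|lborel. \<bar>w j \<eta> - u \<eta>\<bar> powr p))))
      \<longlonglongrightarrow> ennreal (2 * ?c * (\<delta> * integral\<^sup>L lborel g))" by simp
  qed (use X2[OF \<delta>] in blast)
  have "?X \<le> ennreal (2 * ?c * (0 * integral\<^sup>L lborel g))"
  proof (rule LIMSEQ_le_const)
    show "(\<lambda>k. ennreal (2 * ?c * (\<rho> k * integral\<^sup>L lborel g))) \<longlonglongrightarrow> ennreal (2 * ?c * (0 * integral\<^sup>L lborel g))"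
      unfolding \<rho>_def using LIMSEQ_inverse_real_of_nat
      by (intro tendsto_ennrealI tendsto_intros) (simp add: inverse_eq_divide)
  qed (use X3[OF \<rho>] in blast)
  then have "?X = 0" by simp
  then have "AE \<xi> in lborel. ennreal (\<bar>V \<xi> - ?c * u \<xi>\<bar> * g \<xi>) = 0"
    by (subst (asm) nn_integral_0_iff_AE) auto
  with int0 show ?thesis
  proof eventually_elim
    case (elim \<xi>)
    then have "V \<xi> = ?c * u \<xi>" using g_pos[of \<xi>] by (auto simp: ennreal_eq_0_iff mult_le_0_iff)
    then show ?case using elim by (simp add: V_def)
  qed
qed

end

section \<open>Gain of integrability\<close>

text \<open>Hoelder's inequality with a crude constant: the shifts by \<open>1\<close> avoid the degenerate cases.\<close>

lemma nn_integral_mult_le_powr: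
  fixes a b :: "'a \<Rightarrow> real"
  assumes pq: "q > 1" "q' > 1" "1 / q + 1 / q' = 1"
    and [measurable]: "a \<in> borel_measurable M" "b \<in> borel_measurable M"
    and nn: "\<And>x. a x \<ge> 0" "\<And>x. b x \<ge> 0" "A \<ge> 0" "W \<ge> 0"
    and A: "(\<integral>\<^sup>+x. ennreal (a x powr q') \<partial>M) \<le> ennreal A" and W: "(\<integral>\<^sup>+x. ennreal (b x powr q) \<partial>M) \<le> ennreal W"
  shows "(\<integral>\<^sup>+x. ennreal (a x * b x) \<partial>M) \<le> ennreal ((A + 1) * (1 + W) powr (1 / q))"
proof -
  \<comment> \<open>Dividing b by l brings its q-integral below 1 before Young's inequality is
    applied. The exponent 1 / q on W must be sharp for the iteration; the dependence on A need not
    be.\<close>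
  define l where "l = (1 + W) powr (1 / q)"
  have l: "l > 0" "l powr q = 1 + W" using nn pq by (auto simp: l_def powr_powr)
  have "(\<integral>\<^sup>+x. ennreal (a x * b x) \<partial>M) \<le>
      (\<integral>\<^sup>+x. ennreal l * (ennreal (a x powr q') + ennreal (1 / (1 + W)) * ennreal (b x powr q)) \<partial>M)"
  proof (rule nn_integral_mono)
    fix x
    have "a x * (b x / l) \<le> a x powr q' / q' + (b x / l) powr q / q"
      using pq nn l by (intro Youngs_inequality) (auto simp: add.commute)
    also have "\<dots> \<le> a x powr q' / 1 + (b x / l) powr q / 1"
      using pq by (intro add_mono divide_left_mono) auto
    also have "(b x / l) powr q = 1 / (1 + W) * b x powr q"
      using nn l by (simp add: powr_divide)
    finally have "l * (a x * (b x / l)) \<le> l * (a x powr q' + 1 / (1 + W) * b x powr q)"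
      using l by (intro mult_left_mono) auto
    then show "ennreal (a x * b x) \<le> ennreal l * (ennreal (a x powr q') + ennreal (1 / (1 + W)) * ennreal (b x powr q))"
      using l nn by (simp add: ennreal_mult[symmetric] ennreal_plus[symmetric] ennreal_leI del: ennreal_plus)
  qed
  also have "\<dots> = ennreal l * ((\<integral>\<^sup>+x. ennreal (a x powr q') \<partial>M) + ennreal (1 / (1 + W)) * (\<integral>\<^sup>+x. ennreal (b x powr q) \<partial>M))"
    by (simp add: nn_integral_cmult nn_integral_add)
  also have "\<dots> \<le> ennreal l * (ennreal A + ennreal (1 / (1 + W)) * ennreal W)"
    by (intro mult_left_mono add_mono A W) auto
  also have "\<dots> = ennreal (l * (A + W / (1 + W)))"
    using l nn by (simp add: ennreal_mult[symmetric] ennreal_plus[symmetric] del: ennreal_plus)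
  also have "\<dots> \<le> ennreal (l * (A + 1))"
    using l nn by (intro ennreal_leI mult_left_mono add_left_mono) auto
  finally show ?thesis by (simp add: l_def mult.commute)
qed

lemma powr_add_le:
  fixes a b t :: real assumes "a \<ge> 0" "b \<ge> 0" "t \<ge> 0"
  shows "(a + b) powr t \<le> 2 powr t * (a powr t + b powr t)"
proof -
  have "(a + b) powr t \<le> (2 * max a b) powr t" using assms by (intro powr_mono2) auto
  also have "\<dots> = 2 powr t * max a b powr t" using assms by (simp add: powr_mult)
  also have "\<dots> \<le> 2 powr t * (a powr t + b powr t)" by (intro mult_left_mono) (auto simp: max_def)
  finally show ?thesis .
qed

text \<open>The abstract iteration: M stands for g d\<xi>, K for the fundamental solution, s for
  \<gamma> - 1 and R for Q / (Q - 2). Then 2 R is the critical exponent and s < 2 R - 1 is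
  subcritical growth.\<close>

locale subcritical_kernel = finite_measure M for M :: "'a measure" +
  fixes K :: "'a \<Rightarrow> 'a \<Rightarrow> real" and u :: "'a \<Rightarrow> real" and R s A :: real
  assumes K_measurable [measurable]: "(\<lambda>z. K (fst z) (snd z)) \<in> borel_measurable (M \<Otimes>\<^sub>M M)"
    and K_slice [measurable]: "\<And>x. K x \<in> borel_measurable M"
    and K_nonneg: "\<And>x y. 0 \<le> K x y"
    and K_commute: "\<And>x y. K x y = K y x"
    and K_bound: "\<And>r. 0 < r \<Longrightarrow> r < R \<Longrightarrow> \<exists>C\<ge>0. \<forall>x. (\<integral>\<^sup>+y. ennreal (K x y powr r) \<partial>M) \<le> ennreal C"
    and u_measurable [measurable]: "u \<in> borel_measurable M"
    and A_nonneg: "0 \<le> A"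
    and u_le: "AE x in M. ennreal \<bar>u x\<bar> \<le> ennreal A * (\<integral>\<^sup>+y. ennreal (K x y * (1 + \<bar>u y\<bar> powr s)) \<partial>M)"
    and R: "1 < R" and s: "1 < s" "s < 2 * R - 1"
begin

lemma integrable_nonlinearity:
  assumes p: "p \<ge> 2 * R" and int: "integrable M (\<lambda>x. \<bar>u x\<bar> powr p)"
  obtains C where "C \<ge> 0" "(\<integral>\<^sup>+y. ennreal ((1 + \<bar>u y\<bar> powr s) powr (p / s)) \<partial>M) \<le> ennreal C"
proof
  have sp: "s > 0" "p > 0" using s p R by auto
  let ?B = "LINT y|M. 2 powr (p / s) * (1 + \<bar>u y\<bar> powr p)"
  show "?B \<ge> 0" by (intro Bochner_Integration.integral_nonneg) simp
  have "(\<integral>\<^sup>+y. ennreal ((1 + \<bar>u y\<bar> powr s) powr (p / s)) \<partial>M) \<le> (\<integral>\<^sup>+y. ennreal (2 powr (p / s) * (1 + \<bar>u y\<bar> powr p)) \<partial>M)"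
    using powr_add_le[of 1 "\<bar>u y\<bar> powr s" "p / s" for y] sp
    by (intro nn_integral_mono ennreal_leI) (simp add: powr_powr)
  also have "\<dots> = ennreal ?B"
    using int by (intro nn_integral_eq_integral) auto
  finally show "(\<integral>\<^sup>+y. ennreal ((1 + \<bar>u y\<bar> powr s) powr (p / s)) \<partial>M) \<le> ennreal ?B" .
qed

lemma conjugate_exponent:
  assumes p: "p \<ge> 2 * R"
  shows "p / s > 1" "p / (p - s) > 1" "1 / (p / s) + 1 / (p / (p - s)) = 1"
  using assms s R by (auto simp: field_simps)

text \<open>Hoelder with p / s on the nonlinearity and its conjugate p / (p - s) on the kernel: once
  the latter is below R, the bound is uniform in x.\<close>

lemma bounded_of_large_exponent:
  assumes p: "p \<ge> 2 * R" and int: "integrable M (\<lambda>x. \<bar>u x\<bar> powr p)" and large: "p / (p - s) < R"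
  shows "\<exists>C. AE x in M. \<bar>u x\<bar> \<le> C"
proof -
  note c = conjugate_exponent[OF p]
  obtain C where C: "C \<ge> 0" "(\<integral>\<^sup>+y. ennreal ((1 + \<bar>u y\<bar> powr s) powr (p / s)) \<partial>M) \<le> ennreal C"
    using integrable_nonlinearity[OF p int] .
  obtain D where D: "D \<ge> 0" "\<And>x. (\<integral>\<^sup>+y. ennreal (K x y powr (p / (p - s))) \<partial>M) \<le> ennreal D"
    using K_bound[of "p / (p - s)"] c large by auto
  let ?E = "(D + 1) * (1 + C) powr (1 / (p / s))"
  have "(\<integral>\<^sup>+y. ennreal (K x y * (1 + \<bar>u y\<bar> powr s)) \<partial>M) \<le> ennreal ?E" for x
    by (rule nn_integral_mult_le_powr[OF c]) (use C D K_nonneg in \<open>auto intro: add_nonneg_nonneg\<close>)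
  then have "AE x in M. ennreal \<bar>u x\<bar> \<le> ennreal A * ennreal ?E"
    using u_le by (elim eventually_mono) (meson mult_left_mono order_trans zero_le)
  then have "AE x in M. \<bar>u x\<bar> \<le> A * ?E"
    using A_nonneg D by (elim eventually_mono) (simp add: ennreal_mult[symmetric])
  then show ?thesis by blast
qed

text \<open>Splitting \<open>K = K powr (1 - \<alpha>) * K powr \<alpha>\<close>, Hoelder in \<open>y\<close> and then with respect to the finite
  measure \<open>(1 + |u|^s)^(p/s) dM\<close> gains integrability as long as both powers of \<open>K\<close> stay below \<open>R\<close>.\<close>

lemma gain_of_integrability:
  assumes p: "p \<ge> 2 * R" and int: "integrable M (\<lambda>x. \<bar>u x\<bar> powr p)" and small: "p / (p - s) \<ge> R"
    and \<kappa>: "\<kappa> > 1" "s < 2 * R - 2 + 1 / \<kappa>"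
  shows "integrable M (\<lambda>x. \<bar>u x\<bar> powr (\<kappa> * p))"
proof -
  note c = conjugate_exponent[OF p]
  define q q' t where "q = p / s" and "q' = p / (p - s)" and "t = \<kappa> * p"
  have q: "q > 1" "q' > 1" "1 / q + 1 / q' = 1" using c by (auto simp: q_def q'_def)
  have pos: "p > 0" "p > s" using p s R by auto
  have t: "t \<ge> 2 * R" using p \<kappa> R mult_mono[of 1 \<kappa> "2 * R" p] by (simp add: t_def)
  then have t0: "t > 0" using R by linarith
  \<comment> \<open>The conditions (1 - \<alpha>) q' < R and \<alpha> t < R say that \<alpha> lies
    between 1 - R / q' and R / t; the midpoint is taken.\<close>
  define \<alpha> where "\<alpha> = (1 - R / q' + R / t) / 2"
  \<comment> \<open>The interval is nonempty iff R (s - 1 / \<kappa>) < (R - 1) p. The worst case is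
    p = 2 R, where this is the condition imposed on \<kappa>.\<close>
  have gap: "1 - R / q' < R / t"
  proof -
    have "s - 1 / \<kappa> < 2 * R - 2" using \<kappa> by simp
    then have "R * (s - 1 / \<kappa>) < R * (2 * R - 2)" using R by (intro mult_strict_left_mono) auto
    also have "\<dots> = (R - 1) * (2 * R)" by (simp add: algebra_simps)
    also have "\<dots> \<le> (R - 1) * p" using p R by (intro mult_left_mono) auto
    finally have "R * (s - 1 / \<kappa>) < (R - 1) * p" .
    then have "R * (s - 1 / \<kappa>) / p < R - 1" using pos by (simp add: divide_less_eq)
    moreover have "R / q' + R / t = R - R * (s - 1 / \<kappa>) / p"
      using pos \<kappa> by (simp add: q'_def t_def field_simps)
    ultimately show ?thesis by linarith
  qed
  \<comment> \<open>The assumption \<open>small\<close> keeps the left end of the interval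
    nonnegative, which ensures \<alpha> > 0.\<close>
  have Rq: "R / q' \<le> 1" "R / q' > 0" using small q R by (auto simp: q'_def[symmetric])
  have Rt: "R / t \<le> 1 / 2" "R / t > 0" using t t0 R by (auto simp: divide_le_eq)
  have \<alpha>: "0 < \<alpha>" "\<alpha> < 1" "\<alpha> < R / t" "1 - \<alpha> < R / q'"
  proof -
    have "0 < (1 - x + y) / 2 \<and> (1 - x + y) / 2 < 1 \<and> (1 - x + y) / 2 < y \<and> 1 - (1 - x + y) / 2 < x"
      if "1 - x < y" "x \<le> 1" "0 < x" "y \<le> 1 / 2" "0 < y" for x y :: real
      using that by (auto simp: field_simps)
    from this[OF gap Rq Rt] show "0 < \<alpha>" "\<alpha> < 1" "\<alpha> < R / t" "1 - \<alpha> < R / q'"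
      by (auto simp only: \<alpha>_def)
  qed
  have \<alpha>': "\<alpha> * t < R" "(1 - \<alpha>) * q' < R"
    using \<alpha> t0 q by (auto simp: less_divide_eq)
  define \<sigma> where "\<sigma> = t / q"
  have \<sigma>: "\<sigma> > 1" "q * \<sigma> = t"
    using \<kappa> s pos q mult_strict_mono[of 1 \<kappa> 1 s] by (auto simp: \<sigma>_def t_def q_def)
  define \<sigma>' where "\<sigma>' = \<sigma> / (\<sigma> - 1)"
  have \<sigma>': "\<sigma>' > 1" "1 / \<sigma> + 1 / \<sigma>' = 1" using \<sigma> by (auto simp: \<sigma>'_def field_simps)
  define F where "F y = 1 + \<bar>u y\<bar> powr s" for y
  have [measurable]: "F \<in> borel_measurable M" unfolding F_def[abs_def] by measurable
  have F: "F y \<ge> 1" "F y > 0" "F y \<ge> 0" for y by (auto simp: F_def add_pos_nonneg)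
  obtain C where C: "C \<ge> 0" "(\<integral>\<^sup>+y. ennreal (F y powr q) \<partial>M) \<le> ennreal C"
    unfolding F_def q_def using integrable_nonlinearity[OF p int] .
  obtain D1 where D1: "D1 \<ge> 0" "\<And>x. (\<integral>\<^sup>+y. ennreal (K x y powr ((1 - \<alpha>) * q')) \<partial>M) \<le> ennreal D1"
    using K_bound[of "(1 - \<alpha>) * q'"] \<alpha> \<alpha>' q by auto
  obtain D2 where D2: "D2 \<ge> 0" "\<And>x. (\<integral>\<^sup>+y. ennreal (K x y powr (\<alpha> * t)) \<partial>M) \<le> ennreal D2"
    using K_bound[of "\<alpha> * t"] \<alpha> \<alpha>' t0 by auto
  define Z where "Z x = (\<integral>\<^sup>+y. ennreal (K x y powr (\<alpha> * t)) * ennreal (F y powr q) \<partial>M)" for x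
  have [measurable]: "Z \<in> borel_measurable M"
    unfolding Z_def by (intro borel_measurable_nn_integral) (simp add: split_beta')
  have "(\<integral>\<^sup>+x. Z x \<partial>M) = (\<integral>\<^sup>+y. \<integral>\<^sup>+x. ennreal (K x y powr (\<alpha> * t)) * ennreal (F y powr q) \<partial>M \<partial>M)"
    unfolding Z_def by (rule pair_sigma_finite.Fubini'[symmetric])
      (auto simp: split_beta' pair_sigma_finite_def sigma_finite_measure_axioms)
  also have "\<dots> = (\<integral>\<^sup>+y. (\<integral>\<^sup>+x. ennreal (K y x powr (\<alpha> * t)) \<partial>M) * ennreal (F y powr q) \<partial>M)"
    by (intro nn_integral_cong) (subst K_commute, simp add: nn_integral_multc)
  also have "\<dots> \<le> (\<integral>\<^sup>+y. ennreal D2 * ennreal (F y powr q) \<partial>M)"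
    by (intro nn_integral_mono mult_right_mono D2) auto
  also have "\<dots> \<le> ennreal D2 * ennreal C"
    by (subst nn_integral_cmult) (auto intro!: mult_left_mono C)
  finally have Zfin: "(\<integral>\<^sup>+x. Z x \<partial>M) < \<infinity>" by (rule le_less_trans) (simp add: ennreal_mult_less_top)
  then have Zae: "AE x in M. Z x \<noteq> \<infinity>" by (intro nn_integral_PInf_AE) auto
  define c1 c2 c3 where "c1 = (A * (D1 + 1)) powr t" and "c2 = (C + 1) powr \<sigma>" and "c3 = c1 * (2 powr \<sigma>)"
  have c_nn: "c1 \<ge> 0" "c2 \<ge> 0" "c3 \<ge> 0" by (auto simp: c1_def c2_def c3_def)
  have bound: "AE x in M. ennreal (\<bar>u x\<bar> powr t) \<le> ennreal (c3 * (1 + c2)) + ennreal (c3 * c2) * Z x"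
    using u_le Zae
  proof eventually_elim
    case (elim x)
    define z where "z = enn2real (Z x)"
    have z: "z \<ge> 0" "Z x = ennreal z" using elim by (auto simp: z_def less_top)
    \<comment> \<open>Hoelder in y leaves the 1 / q power of an integral against this finite
      measure. To reach the power t of |u|, the exponent \<sigma> = t / q is moved inside by Hoelder
      against the constant 1, with the total mass as the price.\<close>
    define \<nu> where "\<nu> = density M (\<lambda>y. ennreal (F y powr q))"
    have m\<nu>: "measurable \<nu> N = measurable M N" for N :: "real measure"
      by (rule measurable_cong_sets) (simp_all add: \<nu>_def)
    have \<nu>: "(\<integral>\<^sup>+y. ennreal (f y) \<partial>\<nu>) = (\<integral>\<^sup>+y. ennreal (f y) * ennreal (F y powr q) \<partial>M)"
      if "f \<in> borel_measurable M" for f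
      unfolding \<nu>_def using that by (subst nn_integral_density) (auto simp: mult.commute)
    define w where "w = (C + 1) * (1 + z) powr (1 / \<sigma>)"
    have w: "w \<ge> 0" "w powr \<sigma> = c2 * (1 + z)"
      using C z \<sigma> by (auto simp: w_def c2_def powr_mult powr_powr)
    have "(\<integral>\<^sup>+y. ennreal (1 * K x y powr (\<alpha> * q)) \<partial>\<nu>) \<le> ennreal w"
      unfolding w_def
    proof (rule nn_integral_mult_le_powr[OF \<sigma>(1) \<sigma>'])
      show "(\<integral>\<^sup>+y. ennreal (1 powr \<sigma>') \<partial>\<nu>) \<le> ennreal C" using C by (subst \<nu>) auto
      have "(\<integral>\<^sup>+y. ennreal ((K x y powr (\<alpha> * q)) powr \<sigma>) \<partial>\<nu>) = Z x"
        by (subst \<nu>) (simp_all add: Z_def powr_powr mult.assoc \<sigma>(2))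
      then show "(\<integral>\<^sup>+y. ennreal ((K x y powr (\<alpha> * q)) powr \<sigma>) \<partial>\<nu>) \<le> ennreal z" by (simp add: z)
    qed (use C z in \<open>auto simp: m\<nu>\<close>)
    then have Wle: "(\<integral>\<^sup>+y. ennreal ((K x y powr \<alpha> * F y) powr q) \<partial>M) \<le> ennreal w"
      using F by (subst (asm) \<nu>) (simp_all add: powr_mult powr_powr ennreal_mult' less_imp_le)
    have "(\<integral>\<^sup>+y. ennreal (K x y * F y) \<partial>M) = (\<integral>\<^sup>+y. ennreal (K x y powr (1 - \<alpha>) * (K x y powr \<alpha> * F y)) \<partial>M)"
    proof (intro nn_integral_cong arg_cong[of _ _ ennreal])
      fix y
      have "K x y powr (1 - \<alpha>) * K x y powr \<alpha> = K x y"
        using K_nonneg[of x y] by (simp add: powr_add[symmetric])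
      then show "K x y * F y = K x y powr (1 - \<alpha>) * (K x y powr \<alpha> * F y)" by (simp add: mult.assoc[symmetric])
    qed
    also have "\<dots> \<le> ennreal ((D1 + 1) * (1 + w) powr (1 / q))"
      by (rule nn_integral_mult_le_powr[OF q]) (use D1 w Wle F K_nonneg in \<open>auto simp: powr_powr\<close>)
    finally have "ennreal \<bar>u x\<bar> \<le> ennreal A * ennreal ((D1 + 1) * (1 + w) powr (1 / q))"
      using elim(1) unfolding F_def by (meson mult_left_mono order_trans zero_le)
    then have "\<bar>u x\<bar> \<le> A * (D1 + 1) * (1 + w) powr (1 / q)"
      using A_nonneg D1 by (simp add: ennreal_mult[symmetric] mult.assoc)
    then have "\<bar>u x\<bar> powr t \<le> (A * (D1 + 1) * (1 + w) powr (1 / q)) powr t"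
      using t0 by (intro powr_mono2) auto
    also have "\<dots> = c1 * (1 + w) powr \<sigma>"
      using A_nonneg D1 w by (simp add: powr_mult powr_powr c1_def \<sigma>_def)
    also have "\<dots> \<le> c1 * (2 powr \<sigma> * (1 powr \<sigma> + w powr \<sigma>))"
      using w \<sigma> c_nn by (intro mult_left_mono powr_add_le) auto
    also have "\<dots> = c3 * (1 + c2) + c3 * c2 * z" by (simp add: w c3_def algebra_simps)
    finally show ?case
      using z c_nn by (simp add: ennreal_mult[symmetric] ennreal_plus[symmetric] ennreal_leI del: ennreal_plus)
  qed
  have "(\<integral>\<^sup>+x. ennreal (\<bar>u x\<bar> powr t) \<partial>M) \<le> (\<integral>\<^sup>+x. ennreal (c3 * (1 + c2)) + ennreal (c3 * c2) * Z x \<partial>M)"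
    by (rule nn_integral_mono_AE[OF bound])
  also have "\<dots> = ennreal (c3 * (1 + c2)) * emeasure M (space M) + ennreal (c3 * c2) * (\<integral>\<^sup>+x. Z x \<partial>M)"
    by (simp add: nn_integral_add nn_integral_cmult)
  also have "\<dots> < \<infinity>"
    using Zfin by (auto simp: ennreal_mult_eq_top_iff less_top[symmetric])
  finally show ?thesis
    by (intro integrableI_bounded) (auto simp: t_def)
qed

lemma bounded_of_integrable:
  assumes int: "integrable M (\<lambda>x. \<bar>u x\<bar> powr (2 * R))"
  shows "\<exists>C. AE x in M. \<bar>u x\<bar> \<le> C"
proof (rule ccontr)
  assume nb: "\<not> ?thesis"
  \<comment> \<open>Here \<mu> < 1 by subcriticality, and 1 / \<kappa> = (1 + \<mu>) / 2 lies
    strictly between \<mu> and 1. This gives \<kappa> > 1 and s < 2 R - 2 + 1 / \<kappa>,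
    independently of the stage.\<close>
  define \<mu> where "\<mu> = max 0 (s - 2 * R + 2)"
  have \<mu>: "0 \<le> \<mu>" "\<mu> < 1" "s - 2 * R + 2 \<le> \<mu>" using s by (auto simp: \<mu>_def)
  define \<kappa> where "\<kappa> = 2 / (1 + \<mu>)"
  have \<kappa>: "\<kappa> > 1" using \<mu> by (simp add: \<kappa>_def)
  have "s \<le> 2 * R - 2 + \<mu>" using \<mu> by simp
  also have "\<dots> < 2 * R - 2 + (1 + \<mu>) / 2"
    using \<mu> by (intro add_strict_left_mono) (simp add: field_simps)
  also have "(1 + \<mu>) / 2 = 1 / \<kappa>" by (simp add: \<kappa>_def)
  finally have \<kappa>s: "s < 2 * R - 2 + 1 / \<kappa>" .
  have step: "integrable M (\<lambda>x. \<bar>u x\<bar> powr (\<kappa> ^ n * (2 * R))) \<and> \<kappa> ^ n * (2 * R) \<ge> 2 * R" for n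
  proof (induction n)
    case (Suc n)
    let ?p = "\<kappa> ^ n * (2 * R)"
    have p: "?p \<ge> 2 * R" and ip: "integrable M (\<lambda>x. \<bar>u x\<bar> powr ?p)" using Suc by auto
    have "\<not> ?p / (?p - s) < R" using bounded_of_large_exponent[OF p ip] nb by blast
    then have "integrable M (\<lambda>x. \<bar>u x\<bar> powr (\<kappa> * ?p))"
      by (intro gain_of_integrability[OF p ip _ \<kappa> \<kappa>s]) simp
    moreover have "2 * R \<le> \<kappa> * ?p" using p \<kappa> R mult_mono[of 1 \<kappa> "2 * R" ?p] by simp
    ultimately show ?case by (simp add: mult.assoc)
  qed (use int in simp)
  \<comment> \<open>For p > s the condition p / (p - s) < R reads p > s R / (R - 1).\<close>
  obtain n where n: "s * R / (R - 1) < \<kappa> ^ n" using real_arch_pow[OF \<kappa>] by blast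
  let ?p = "\<kappa> ^ n * (2 * R)"
  have "\<kappa> ^ n \<le> ?p" using \<kappa> R by simp
  then have "s * R / (R - 1) < ?p" using n by linarith
  then have "s * R < ?p * (R - 1)" using R by (simp add: divide_less_eq)
  moreover have "?p > s" using step[of n] s by linarith
  ultimately have "?p / (?p - s) < R" by (simp add: divide_less_eq algebra_simps)
  then show False using bounded_of_large_exponent step[of n] nb by blast
qed

end

section \<open>Regularity of weak solutions\<close>

context heis_weight
begin

text \<open>Capping the kernel near its pole gives continuous potentials by dominated convergence.
  As |h| is at most H g \<le> H G, the error is controlled by the integral of the kernel over a
  small gauge ball, uniformly in the pole.\<close>

lemma bounded_potential_continuous:
  assumes [measurable]: "h \<in> borel_measurable borel"
    and h: "AE \<eta> in lborel. \<bar>h \<eta>\<bar> \<le> H * g \<eta>" and H: "H \<ge> 0"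
  shows "continuous_on UNIV (\<lambda>\<xi>::'n heis. LINT \<eta>|lborel. h \<eta> * hker 0 \<xi> \<eta>)"
proof -
  define m d where "m = real CARD('n) / 2" and "d = (real CARD('n) + 1) / 2"
  \<comment> \<open>The difference d - m is the power of the ball height in the error estimate,
    hence the square root below.\<close>
  have md: "0 \<le> m" "m < d" "d - m = 1/2" by (auto simp: m_def d_def field_simps)
  define L where "L k = 1 / real (Suc k)" for k
  have L: "L k > 0" for k by (simp add: L_def)
  define E where "E = hvol TYPE('n) * 2 powr m / (1 - 2 powr (m - d))"
  have "2 powr (m - d) < 1" using md by (auto simp: powr_less_one)
  then have E: "E \<ge> 0" using hvol_nonneg[of "TYPE('n)"] by (simp add: E_def)
  define T where "T k \<xi> \<eta> = max (hgauge 0 (hdiff \<xi> \<eta>)) (L k) powr - m" for k and \<xi> \<eta> :: "'n heis"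
  have [measurable]: "T k \<xi> \<in> borel_measurable borel" for k \<xi>
    unfolding T_def[abs_def] by measurable
  have T: "0 \<le> T k \<xi> \<eta>" "T k \<xi> \<eta> \<le> L k powr - m" for k \<xi> \<eta>
    using L[of k] md by (auto simp: T_def intro!: powr_mono2')
  have hi: "integrable lborel h"
    by (rule Bochner_Integration.integrable_bound[of _ "\<lambda>\<eta>. H * g \<eta>"])
       (use h g_int H g_pos in \<open>auto elim!: eventually_mono simp: less_imp_le\<close>)
  have Ti: "integrable lborel (\<lambda>\<eta>. h \<eta> * T k \<xi> \<eta>)" for k \<xi>
  proof (rule Bochner_Integration.integrable_bound[of _ "\<lambda>\<eta>. L k powr - m * h \<eta>"])
    show "AE \<eta> in lborel. norm (h \<eta> * T k \<xi> \<eta>) \<le> norm (L k powr - m * h \<eta>)"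
      using mult_left_mono[OF T(2)[of k \<xi>], of "\<bar>h \<eta>\<bar>" for \<eta>] T(1)[of k \<xi>]
      by (intro AE_I2) (simp add: abs_mult mult.commute)
  qed (use hi in auto)
  define W where "W k \<xi> = (LINT \<eta>|lborel. h \<eta> * T k \<xi> \<eta>)" for k \<xi>
  have Wc: "continuous_on UNIV (W k)" for k
    unfolding continuous_on_sequentially comp_def
  proof (intro allI impI ballI)
    fix x :: "nat \<Rightarrow> 'n heis" and \<xi> assume "(\<forall>n. x n \<in> UNIV) \<and> x \<longlonglongrightarrow> \<xi>"
    then have x: "x \<longlonglongrightarrow> \<xi>" by simp
    show "(\<lambda>n. W k (x n)) \<longlonglongrightarrow> W k \<xi>"
      unfolding W_def
    proof (rule integral_dominated_convergence)
      show "integrable lborel (\<lambda>\<eta>. L k powr - m * \<bar>h \<eta>\<bar>)" using hi by simp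
      show "AE \<eta> in lborel. norm (h \<eta> * T k (x n) \<eta>) \<le> L k powr - m * \<bar>h \<eta>\<bar>" for n
      using mult_left_mono[OF T(2)[of k "x n"], of "\<bar>h \<eta>\<bar>" for \<eta>] T(1)[of k "x n"]
      by (intro AE_I2) (simp add: abs_mult mult.commute)
      show "AE \<eta> in lborel. (\<lambda>n. h \<eta> * T k (x n) \<eta>) \<longlonglongrightarrow> h \<eta> * T k \<xi> \<eta>"
      proof (rule AE_I2)
        fix \<eta>
        have "(\<lambda>n. hgauge 0 (hdiff (x n) \<eta>)) \<longlonglongrightarrow> hgauge 0 (hdiff \<xi> \<eta>)"
          by (rule continuous_on_tendsto_compose[OF continuous_hgauge_hdiff(2) x]) auto
        moreover have "max (hgauge 0 (hdiff \<xi> \<eta>)) (L k) \<noteq> 0" using L[of k] by (auto simp: max_def)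
        ultimately show "(\<lambda>n. h \<eta> * T k (x n) \<eta>) \<longlonglongrightarrow> h \<eta> * T k \<xi> \<eta>"
          unfolding T_def by (intro tendsto_intros) simp_all
      qed
    qed simp_all
  qed
  have near: "(\<integral>\<^sup>+\<eta>. ennreal (indicator {\<eta>. hgauge 0 (hdiff \<xi> \<eta>) < L k} \<eta> * hgauge 0 (hdiff \<xi> \<eta>) powr - m) \<partial>lborel)
      \<le> ennreal (E * L k powr (1/2))" for k and \<xi> :: "'n heis"
    using nn_integral_powr_near[OF _ _ vol_hgauge[of _ \<xi>] hvol_nonneg md(1) md(2)[unfolded d_def] L[of k]]
    by (simp add: hgauge_nonneg E_def d_def[symmetric] md(3))
  have diff: "\<bar>(LINT \<eta>|lborel. h \<eta> * hker 0 \<xi> \<eta>) - W k \<xi>\<bar> \<le> H * G * E * L k powr (1/2)" for k \<xi>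
  proof -
    have ne: "AE \<eta> in lborel. \<xi> \<noteq> \<eta>" using AE_lborel_singleton[of \<xi>] by eventually_elim simp
    have le: "AE \<eta> in lborel. ennreal \<bar>h \<eta> * hker 0 \<xi> \<eta> - h \<eta> * T k \<xi> \<eta>\<bar> \<le> ennreal (H * G) *
        ennreal (indicator {\<eta>. hgauge 0 (hdiff \<xi> \<eta>) < L k} \<eta> * hgauge 0 (hdiff \<xi> \<eta>) powr - m)"
      using ne h
    proof eventually_elim
      case (elim \<eta>)
      let ?P = "hgauge 0 (hdiff \<xi> \<eta>)"
      have P: "?P > 0" using elim hgauge_nonneg[of 0 "hdiff \<xi> \<eta>"] hgauge_0_eq_0_iff[of \<xi> \<eta>] by linarith
      have k: "\<bar>hker 0 \<xi> \<eta> - T k \<xi> \<eta>\<bar> \<le> indicator {\<eta>. hgauge 0 (hdiff \<xi> \<eta>) < L k} \<eta> * ?P powr - m"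
      proof (cases "?P < L k")
        case True
        then have "L k powr - m \<le> ?P powr - m" using P md by (intro powr_mono2') auto
        then show ?thesis using True by (simp add: hker_def T_def m_def[symmetric] max_def)
      qed (auto simp: hker_def T_def m_def[symmetric] max_def)
      have "\<bar>h \<eta>\<bar> \<le> H * G" using elim H g_le[of \<eta>] mult_left_mono[of "g \<eta>" G H] by linarith
      then have "\<bar>h \<eta> * hker 0 \<xi> \<eta> - h \<eta> * T k \<xi> \<eta>\<bar> \<le> (H * G) * (indicator {\<eta>. hgauge 0 (hdiff \<xi> \<eta>) < L k} \<eta> * ?P powr - m)"
        unfolding right_diff_distrib[symmetric] abs_mult using k H G_pos by (intro mult_mono) auto
      then show ?case using H G_pos by (simp add: ennreal_mult[symmetric] ennreal_leI)
    qed
    have "(\<integral>\<^sup>+\<eta>. ennreal \<bar>h \<eta> * hker 0 \<xi> \<eta> - h \<eta> * T k \<xi> \<eta>\<bar> \<partial>lborel) \<le> ennreal (H * G) * (\<integral>\<^sup>+\<eta>.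
        ennreal (indicator {\<eta>. hgauge 0 (hdiff \<xi> \<eta>) < L k} \<eta> * hgauge 0 (hdiff \<xi> \<eta>) powr - m) \<partial>lborel)"
      using nn_integral_mono_AE[OF le] by (subst (asm) nn_integral_cmult) auto
    also have "\<dots> \<le> ennreal (H * G) * ennreal (E * L k powr (1/2))" by (intro mult_left_mono near) auto
    also have "\<dots> = ennreal (H * G * E * L k powr (1/2))"
      using H G_pos E by (simp add: ennreal_mult[symmetric] mult.assoc)
    finally have nn: "(\<integral>\<^sup>+\<eta>. ennreal \<bar>h \<eta> * hker 0 \<xi> \<eta> - h \<eta> * T k \<xi> \<eta>\<bar> \<partial>lborel) \<le> ennreal (H * G * E * L k powr (1/2))" .
    have di: "integrable lborel (\<lambda>\<eta>. h \<eta> * hker 0 \<xi> \<eta> - h \<eta> * T k \<xi> \<eta>)"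
      using le_less_trans[OF nn] by (intro integrableI_bounded) auto
    have "integrable lborel (\<lambda>\<eta>. h \<eta> * hker 0 \<xi> \<eta>)"
      using Bochner_Integration.integrable_add[OF di Ti[of k \<xi>]] by simp
    then have "(LINT \<eta>|lborel. h \<eta> * hker 0 \<xi> \<eta>) - W k \<xi> = (LINT \<eta>|lborel. h \<eta> * hker 0 \<xi> \<eta> - h \<eta> * T k \<xi> \<eta>)"
      using Ti by (simp add: W_def)
    also have "ennreal \<bar>\<dots>\<bar> \<le> (\<integral>\<^sup>+\<eta>. ennreal \<bar>h \<eta> * hker 0 \<xi> \<eta> - h \<eta> * T k \<xi> \<eta>\<bar> \<partial>lborel)"
      using integral_norm_bound_ennreal[OF di] by simp
    also note nn
    finally show ?thesis
      using H G_pos E by (simp add: ennreal_le_iff)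
  qed
  show ?thesis
  proof (rule uniform_limit_theorem)
    show "\<forall>\<^sub>F k in sequentially. continuous_on UNIV (W k)" using Wc by simp
    show "uniform_limit UNIV W (\<lambda>\<xi>. LINT \<eta>|lborel. h \<eta> * hker 0 \<xi> \<eta>) sequentially"
    proof (rule uniform_limitI)
      fix \<epsilon> :: real assume \<epsilon>: "\<epsilon> > 0"
      have "L \<longlonglongrightarrow> 0" unfolding L_def using LIMSEQ_inverse_real_of_nat by (simp add: inverse_eq_divide)
      then have "(\<lambda>k. H * G * E * sqrt (L k)) \<longlonglongrightarrow> H * G * E * sqrt 0" by (intro tendsto_intros)
      then have "\<forall>\<^sub>F k in sequentially. H * G * E * sqrt (L k) < \<epsilon>"
        using \<epsilon> by (intro order_tendstoD) auto
      then show "\<forall>\<^sub>F k in sequentially. \<forall>\<xi>\<in>UNIV. dist (W k \<xi>) (LINT \<eta>|lborel. h \<eta> * hker 0 \<xi> \<eta>) < \<epsilon>"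
      proof eventually_elim
        case (elim k)
        then have "H * G * E * L k powr (1/2) < \<epsilon>" using L[of k] by (simp add: powr_half_sqrt)
        show ?case
          proof
            fix \<xi> :: "'n heis"
            show "dist (W k \<xi>) (LINT \<eta>|lborel. h \<eta> * hker 0 \<xi> \<eta>) < \<epsilon>"
              using diff[of \<xi> k] \<open>H * G * E * L k powr (1/2) < \<epsilon>\<close> by (simp add: dist_real_def abs_minus_commute)
          qed
      qed
    qed
  qed simp
qed

text \<open>Instantiates the abstract iteration with M = g d\<xi> and R = 1 + 1 / N, so that 2 R is
  the given exponent of u. Once u is bounded, the density g F is bounded by a multiple of g and the
  potential is continuous.\<close>

lemma potential_regularity:
  fixes u F :: "'n heis \<Rightarrow> real"
  assumes u [measurable]: "u \<in> borel_measurable borel" and F [measurable]: "F \<in> borel_measurable borel"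
    and up: "integrable lborel (\<lambda>\<eta>. \<bar>u \<eta>\<bar> powr (2 + 2 / real CARD('n)))"
    and F_le: "\<And>\<eta>. \<bar>F \<eta>\<bar> \<le> A * (1 + \<bar>u \<eta>\<bar> powr s)" and A: "A \<ge> 0"
    and s: "1 < s" "s < 1 + 2 / real CARD('n)"
    and rep: "AE \<xi> in lborel. integrable lborel (\<lambda>\<eta>. g \<eta> * F \<eta> * hker 0 \<xi> \<eta>) \<and>
      hmass TYPE('n) * u \<xi> = (LINT \<eta>|lborel. g \<eta> * F \<eta> * hker 0 \<xi> \<eta>)"
  shows "\<exists>C. AE \<xi> in lborel. \<bar>u \<xi>\<bar> \<le> C"
    and "\<exists>w. continuous_on UNIV w \<and> (AE \<xi> in lborel. u \<xi> = w \<xi>)"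
proof -
  let ?c = "hmass TYPE('n)"
  have c: "?c > 0" by (rule hmass_pos)
  define M where "M = density lborel (\<lambda>\<xi>. ennreal (g \<xi>))"
  define R where "R = 1 + 1 / real CARD('n)"
  have sM [measurable_cong]: "sets M = sets borel" by (simp add: M_def)
  have nnM: "(\<integral>\<^sup>+y. f y \<partial>M) = (\<integral>\<^sup>+y. ennreal (g y) * f y \<partial>lborel)" if "f \<in> borel_measurable borel" for f
    unfolding M_def using that by (subst nn_integral_density) auto
  \<comment> \<open>Positivity of g makes the null sets of M and of Lebesgue measure the same, so
    bounds obtained for M hold for the original measure.\<close>
  have AE_M: "(AE x in M. P x) \<longleftrightarrow> (AE x in lborel. P x)" for P
    unfolding M_def using g_pos by (subst AE_density) (auto simp: ennreal_less_zero_iff)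
  have R2: "2 * R = 2 + 2 / real CARD('n)" by (simp add: R_def)
  have fin: "finite_measure M"
  proof (rule finite_measureI)
    have "emeasure M (space M) = (\<integral>\<^sup>+x. 1 \<partial>M)" by simp
    also have "\<dots> = (\<integral>\<^sup>+x. ennreal (g x) \<partial>lborel)" by (subst nnM) auto
    also have "\<dots> = ennreal (integral\<^sup>L lborel g)"
      using g_int g_pos by (intro nn_integral_eq_integral) (auto simp: less_imp_le)
    finally show "emeasure M (space M) \<noteq> \<infinity>" by simp
  qed
  interpret subcritical_kernel M "hker 0" u R s "A / ?c"
  proof (intro subcritical_kernel.intro fin subcritical_kernel_axioms.intro)
    show "(\<lambda>z. hker 0 (fst z) (snd z)) \<in> borel_measurable (M \<Otimes>\<^sub>M M)"
      using measurable_hker(2)[of 0] measurable_cong_sets[OF sets_pair_measure_cong[OF sM sM] refl] by blast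
    show "hker 0 x \<in> borel_measurable M" for x by measurable
    show "0 \<le> hker 0 x y" for x y :: "'n heis" by (rule hker_nonneg)
    show "hker 0 x y = hker 0 y x" for x y :: "'n heis" by (rule hker_commute)
    show "u \<in> borel_measurable M" by measurable
    show "0 \<le> A / ?c" using A c by simp
    show "1 < R" by (simp add: R_def)
    show "1 < s" "s < 2 * R - 1" using s by (auto simp: R2)
    show "\<exists>C\<ge>0. \<forall>x. (\<integral>\<^sup>+y. ennreal (hker 0 x y powr r) \<partial>M) \<le> ennreal C" if r: "0 < r" "r < R" for r
    proof -
      \<comment> \<open>The r-th power of the kernel has gauge exponent N r / 2, which is below the
        volume exponent (N + 1) / 2 exactly for r < R.\<close>
      have "real CARD('n) * r < real CARD('n) * R" using r by (intro mult_strict_left_mono) auto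
      also have "\<dots> = real CARD('n) + 1" by (simp add: R_def algebra_simps)
      finally have "real CARD('n) / 2 * r < (real CARD('n) + 1) / 2" by simp
      then obtain C where C: "C \<ge> 0" "\<And>\<xi>. (\<integral>\<^sup>+\<eta>. ennreal (hgauge 0 (hdiff \<xi> \<eta>) powr - (real CARD('n) / 2 * r) * g \<eta>) \<partial>lborel) \<le> ennreal C"
        using kernel_bound[of "real CARD('n) / 2 * r"] r by auto
      have "(\<integral>\<^sup>+y. ennreal (hker 0 x y powr r) \<partial>M) \<le> ennreal C" for x
      proof -
        have "(\<integral>\<^sup>+y. ennreal (hker 0 x y powr r) \<partial>M) = (\<integral>\<^sup>+\<eta>. ennreal (hgauge 0 (hdiff x \<eta>) powr - (real CARD('n) / 2 * r) * g \<eta>) \<partial>lborel)"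
          using g_pos by (subst nnM) (auto intro!: nn_integral_cong simp: hker_def powr_powr ennreal_mult[symmetric] less_imp_le mult.commute)
        then show ?thesis using C(2) by simp
      qed
      then show ?thesis using C(1) by blast
    qed
    show "AE x in M. ennreal \<bar>u x\<bar> \<le> ennreal (A / ?c) * (\<integral>\<^sup>+y. ennreal (hker 0 x y * (1 + \<bar>u y\<bar> powr s)) \<partial>M)"
      unfolding AE_M using rep
    proof eventually_elim
      case (elim \<xi>)
      have "ennreal \<bar>?c * u \<xi>\<bar> \<le> (\<integral>\<^sup>+\<eta>. ennreal \<bar>g \<eta> * F \<eta> * hker 0 \<xi> \<eta>\<bar> \<partial>lborel)"
        using elim integral_norm_bound_ennreal[of lborel "\<lambda>\<eta>. g \<eta> * F \<eta> * hker 0 \<xi> \<eta>"] by simp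
      also have "\<dots> \<le> (\<integral>\<^sup>+\<eta>. ennreal A * (ennreal (g \<eta>) * ennreal (hker 0 \<xi> \<eta> * (1 + \<bar>u \<eta>\<bar> powr s))) \<partial>lborel)"
      proof (rule nn_integral_mono)
        fix \<eta>
        have "\<bar>g \<eta> * F \<eta> * hker 0 \<xi> \<eta>\<bar> = g \<eta> * hker 0 \<xi> \<eta> * \<bar>F \<eta>\<bar>"
          using g_pos[of \<eta>] by (simp add: abs_mult hker_nonneg)
        also have "\<dots> \<le> g \<eta> * hker 0 \<xi> \<eta> * (A * (1 + \<bar>u \<eta>\<bar> powr s))"
          using g_pos[of \<eta>] by (intro mult_left_mono F_le) (simp add: hker_nonneg)
        finally show "ennreal \<bar>g \<eta> * F \<eta> * hker 0 \<xi> \<eta>\<bar> \<le> ennreal A * (ennreal (g \<eta>) * ennreal (hker 0 \<xi> \<eta> * (1 + \<bar>u \<eta>\<bar> powr s)))"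
          using g_pos[of \<eta>] A by (simp add: ennreal_mult[symmetric] hker_nonneg ennreal_leI mult_ac)
      qed
      also have "\<dots> = ennreal A * (\<integral>\<^sup>+y. ennreal (hker 0 \<xi> y * (1 + \<bar>u y\<bar> powr s)) \<partial>M)"
        by (subst nnM) (auto simp: nn_integral_cmult)
      finally have "ennreal (1 / ?c) * ennreal \<bar>?c * u \<xi>\<bar> \<le> ennreal (1 / ?c) * (ennreal A * (\<integral>\<^sup>+y. ennreal (hker 0 \<xi> y * (1 + \<bar>u y\<bar> powr s)) \<partial>M))"
        by (rule mult_left_mono) simp
      moreover have "ennreal (1 / ?c) * ennreal \<bar>?c * u \<xi>\<bar> = ennreal \<bar>u \<xi>\<bar>"
        using c by (simp add: ennreal_mult[symmetric] abs_mult)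
      moreover have "ennreal (1 / ?c) * ennreal A = ennreal (A / ?c)"
        using c A by (simp add: ennreal_mult[symmetric])
      ultimately show ?case by (simp add: mult.assoc[symmetric])
    qed
  qed
  have "integrable M (\<lambda>x. \<bar>u x\<bar> powr (2 * R))"
  proof -
    have "integrable lborel (\<lambda>x. g x *\<^sub>R \<bar>u x\<bar> powr (2 * R))"
      by (rule Bochner_Integration.integrable_bound[of _ "\<lambda>x. G * \<bar>u x\<bar> powr (2 * R)"])
         (use up R2 g_le g_pos G_pos in \<open>auto simp: less_imp_le intro!: mult_right_mono\<close>)
    then show ?thesis unfolding M_def using g_pos by (subst integrable_density) (auto simp: less_imp_le)
  qed
  from bounded_of_integrable[OF this] obtain C where C: "AE \<xi> in lborel. \<bar>u \<xi>\<bar> \<le> C" unfolding AE_M by blast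
  then show "\<exists>C. AE \<xi> in lborel. \<bar>u \<xi>\<bar> \<le> C" by blast
  let ?H = "A * (1 + max C 0 powr s)"
  have "AE \<eta> in lborel. \<bar>g \<eta> * F \<eta>\<bar> \<le> ?H * g \<eta>"
    using C
  proof eventually_elim
    case (elim \<eta>)
    have "\<bar>u \<eta>\<bar> powr s \<le> max C 0 powr s" using elim s by (intro powr_mono2) auto
    then have "\<bar>F \<eta>\<bar> \<le> ?H"
      using F_le[of \<eta>] A mult_left_mono[of "1 + \<bar>u \<eta>\<bar> powr s" "1 + max C 0 powr s" A] by linarith
    then show ?case using g_pos[of \<eta>] by (simp add: abs_mult mult.commute mult_left_mono)
  qed
  then have "continuous_on UNIV (\<lambda>\<xi>::'n heis. LINT \<eta>|lborel. g \<eta> * F \<eta> * hker 0 \<xi> \<eta>)"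
    using A by (intro bounded_potential_continuous[where H="?H"]) auto
  then have "continuous_on UNIV (\<lambda>\<xi>::'n heis. (LINT \<eta>|lborel. g \<eta> * F \<eta> * hker 0 \<xi> \<eta>) / ?c)"
    using c by (intro continuous_intros) auto
  moreover have "AE \<xi> in lborel. u \<xi> = (LINT \<eta>|lborel. g \<eta> * F \<eta> * hker 0 \<xi> \<eta>) / ?c"
    using rep by eventually_elim (use c in \<open>auto simp: field_simps\<close>)
  ultimately show "\<exists>w. continuous_on UNIV w \<and> (AE \<xi> in lborel. u \<xi> = w \<xi>)" by blast
qed

end

section \<open>The nonlinearity and Borel representatives\<close>

text \<open>The limit controls f for large arguments and compactness on the remaining interval; on
  the negative side the shifted nonlinearity lies between - a and 0.\<close>

lemma f_shift_growth:
  fixes f :: "real \<Rightarrow> real"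
  assumes cont: "continuous_on {0..} f" and nonneg: "\<And>r. r \<ge> 0 \<Longrightarrow> f r \<ge> 0"
    and lim: "((\<lambda>r. f r / r powr s) \<longlongrightarrow> L) at_top" and a: "a > 0"
  obtains A where "A \<ge> 0" "\<And>r. \<bar>f_shift f a r\<bar> \<le> A * (1 + \<bar>r\<bar> powr s)"
proof -
  have "\<forall>\<^sub>F r in at_top. f r / r powr s < \<bar>L\<bar> + 1"
    using order_tendstoD(2)[OF lim, of "\<bar>L\<bar> + 1"] by linarith
  then obtain r0 where r0: "\<And>r. r \<ge> r0 \<Longrightarrow> f r / r powr s < \<bar>L\<bar> + 1"
    by (auto simp: eventually_at_top_linorder)
  have "compact (f ` {0..max r0 1})"
    by (intro compact_continuous_image continuous_on_subset[OF cont]) auto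
  then obtain B where B: "\<And>r. r \<in> {0..max r0 1} \<Longrightarrow> \<bar>f r\<bar> \<le> B"
    by (force dest!: compact_imp_bounded simp: bounded_iff)
  have B0: "B \<ge> 0" using order_trans[OF abs_ge_zero B[of 0]] by simp
  have f_le: "f r \<le> B + (\<bar>L\<bar> + 1) * r powr s" if "r \<ge> 0" for r
  proof (cases "r \<le> max r0 1")
    case True
    then show ?thesis using B[of r] that by (auto intro: order_trans add_increasing2)
  next
    case False
    then have "f r < (\<bar>L\<bar> + 1) * r powr s" using r0[of r] by (simp add: divide_less_eq)
    then show ?thesis using B0 by linarith
  qed
  show ?thesis
  proof (rule that[of "B + \<bar>L\<bar> + 1 + a"])
    show "B + \<bar>L\<bar> + 1 + a \<ge> 0" using B0 a by simp
    fix r :: real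
    have le: "B + (\<bar>L\<bar> + 1) * p + a \<le> (B + \<bar>L\<bar> + 1 + a) * (1 + p)" if "p \<ge> 0" for p
    proof -
      have "0 \<le> (B + a) * p" using that B0 a by simp
      then show ?thesis by (simp add: algebra_simps)
    qed
    have "\<bar>f_shift f a r\<bar> \<le> B + (\<bar>L\<bar> + 1) * \<bar>r\<bar> powr s + a"
    proof -
      have nn: "0 \<le> (\<bar>L\<bar> + 1) * \<bar>r\<bar> powr s" by simp
      consider "r \<ge> 0" | "-1 \<le> r" "r < 0" | "r < -1" by linarith
      then show ?thesis
      proof cases
        case 1
        then show ?thesis using f_le[of r] nonneg[of r] a by (simp add: f_shift_def)
      next
        case 2
        then have "\<bar>- a * (r + 1)\<bar> \<le> a" using a by (simp add: abs_mult mult_left_le)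
        moreover have "f_shift f a r = - a * (r + 1)" using 2 by (simp add: f_shift_def)
        ultimately show ?thesis using nn B0 by linarith
      next
        case 3
        then show ?thesis using nn B0 a by (simp add: f_shift_def)
      qed
    qed
    also have "\<dots> \<le> (B + \<bar>L\<bar> + 1 + a) * (1 + \<bar>r\<bar> powr s)" by (rule le) simp
    finally show "\<bar>f_shift f a r\<bar> \<le> (B + \<bar>L\<bar> + 1 + a) * (1 + \<bar>r\<bar> powr s)" .
  qed
qed

lemma borel_measurable_f_shift:
  assumes "continuous_on {0..} f" shows "f_shift f a \<in> borel_measurable borel"
proof -
  \<comment> \<open>Nothing is known about f at negative arguments, so it is frozen at 0 there
    before being used as a function on the line.\<close>
  have "continuous_on UNIV (\<lambda>r. f (max r 0))"
    by (intro continuous_on_compose2[OF assms]) (auto intro!: continuous_intros)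
  then have [measurable]: "(\<lambda>r. f (max r 0)) \<in> borel_measurable borel"
    by (rule borel_measurable_continuous_onI)
  have "f_shift f a = (\<lambda>r. if r \<ge> 0 then f (max r 0) - a else if r \<ge> -1 then - a * (r + 1) else 0)"
    by (auto simp: f_shift_def fun_eq_iff max_def)
  then show ?thesis by simp
qed

lemma lborel_representative:
  fixes u :: "'a::euclidean_space \<Rightarrow> real"
  assumes "u \<in> borel_measurable lebesgue"
  obtains v where "v \<in> borel_measurable borel" "AE x in lebesgue. u x = v x"
  using completion_ex_borel_measurable_real[OF assms] AE_completion by (metis measurable_lborel2)

lemma integral_lebesgue_cong:
  fixes f h :: "'a::euclidean_space \<Rightarrow> real"
  assumes f: "f \<in> borel_measurable lebesgue" and "AE x in lebesgue. f x = h x" "h \<in> borel_measurable borel"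
  shows "integral\<^sup>L lebesgue f = integral\<^sup>L lborel h"
    and "integrable lebesgue f \<Longrightarrow> integrable lborel h"
proof -
  have h: "h \<in> borel_measurable lebesgue" using assms(3) by (simp add: measurable_completion)
  show "integral\<^sup>L lebesgue f = integral\<^sup>L lborel h"
    using integral_cong_AE[OF f h assms(2)] assms(3) by (simp add: integral_completion)
  show "integrable lborel h" if "integrable lebesgue f"
    using integrable_cong_AE[OF f h assms(2)] that assms(3) by (simp add: integrable_completion)
qed

lemma integrable_powr_diff:
  fixes u v :: "'a \<Rightarrow> real"
  assumes [measurable]: "u \<in> borel_measurable M" "v \<in> borel_measurable M" and p: "p \<ge> 0"
    and "integrable M (\<lambda>x. \<bar>u x\<bar> powr p)" "integrable M (\<lambda>x. \<bar>v x\<bar> powr p)"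
  shows "integrable M (\<lambda>x. \<bar>u x - v x\<bar> powr p)"
proof (rule Bochner_Integration.integrable_bound)
  show "integrable M (\<lambda>x. 2 powr p * (\<bar>u x\<bar> powr p + \<bar>v x\<bar> powr p))" using assms by simp
  show "AE x in M. norm (\<bar>u x - v x\<bar> powr p) \<le> norm (2 powr p * (\<bar>u x\<bar> powr p + \<bar>v x\<bar> powr p))"
  proof (rule AE_I2)
    fix x
    have "\<bar>u x - v x\<bar> powr p \<le> (\<bar>u x\<bar> + \<bar>v x\<bar>) powr p" using p by (intro powr_mono2) auto
    also have "\<dots> \<le> 2 powr p * (\<bar>u x\<bar> powr p + \<bar>v x\<bar> powr p)" using p by (intro powr_add_le) auto
    finally show "norm (\<bar>u x - v x\<bar> powr p) \<le> norm (2 powr p * (\<bar>u x\<bar> powr p + \<bar>v x\<bar> powr p))" by simp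
  qed
qed simp

lemma weight_representative:
  fixes g :: "'n::finite heis \<Rightarrow> real"
  assumes pos: "\<And>\<xi>. g \<xi> > 0" and int: "integrable lebesgue g" and bdd: "Linf_fun g"
  obtains g' G where "heis_weight g' G" "AE \<xi> in lebesgue. g \<xi> = g' \<xi>"
proof -
  obtain C where C: "AE \<xi> in lebesgue. \<bar>g \<xi>\<bar> \<le> C" using bdd by (auto simp: Linf_fun_def)
  obtain g0 where g0 [measurable]: "g0 \<in> borel_measurable borel" and eq: "AE \<xi> in lebesgue. g \<xi> = g0 \<xi>"
    using lborel_representative[OF borel_measurable_integrable[OF int]] .
  define G where "G = max C 1"
  \<comment> \<open>The Borel representative leaves (0, G] only on a null set; the value G there
    makes positivity and boundedness hold everywhere.\<close>
  define g' where "g' \<xi> = (if 0 < g0 \<xi> \<and> g0 \<xi> \<le> G then g0 \<xi> else G)" for \<xi>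
  have [measurable]: "g' \<in> borel_measurable borel" unfolding g'_def[abs_def] by measurable
  have eq': "AE \<xi> in lebesgue. g \<xi> = g' \<xi>"
    using eq C
  proof eventually_elim
    case (elim \<xi>)
    then show ?case using pos[of \<xi>] by (auto simp: g'_def G_def)
  qed
  have "heis_weight g' G"
  proof
    show "integrable lborel g'"
      by (rule integral_lebesgue_cong(2)[OF borel_measurable_integrable[OF int] eq' _ int]) simp
  qed (auto simp: g'_def G_def)
  from that[OF this eq'] show ?thesis .
qed

text \<open>The equation is transferred to Borel representatives v of u and g' of g, because the
  potential estimates use product measurability. The conclusions then return to u through almost
  everywhere equality.\<close>

theorem weak_solution_regularity:
  fixes g :: "'n::finite heis \<Rightarrow> real"
  assumes g: "\<And>\<xi>. g \<xi> > 0" "integrable lebesgue g" "Linf_fun g"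
    and f: "continuous_on {0..} f" "\<And>r. r \<ge> 0 \<Longrightarrow> f r \<ge> 0" "((\<lambda>r. f r / r powr (\<gamma> - 1)) \<longlongrightarrow> L) at_top"
    and \<gamma>: "2 < \<gamma>" "\<gamma> < crit_exp TYPE('n)" and a: "a > 0"
    and sol: "weak_solution g f a u"
  shows "Linf_fun u" "has_continuous_rep u"
proof -
  define p where "p = crit_exp TYPE('n)"
  have p: "p = 2 + 2 / real CARD('n)" "p > 1" "p > 0" by (auto simp: p_def crit_exp_eq add_pos_nonneg)
  have um: "u \<in> borel_measurable lebesgue" and up: "integrable lebesgue (\<lambda>\<xi>. \<bar>u \<xi>\<bar> powr p)"
    using sol by (auto simp: weak_solution_def D12_def Lp_fun_def p_def)
  \<comment> \<open>The approximating sequence in the definition of \<open>D12\<close> supplies the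
    continuous functions needed to identify the limit of the approximate identity.\<close>
  obtain \<phi> where \<phi>: "\<And>k::nat. test_fun (\<phi> k)"
    "(\<lambda>k. LINT \<xi>|lebesgue. \<bar>\<phi> k \<xi> - u \<xi>\<bar> powr p) \<longlonglongrightarrow> 0"
    using sol by (auto simp: weak_solution_def D12_def p_def)
  obtain v where v [measurable]: "v \<in> borel_measurable borel" and uv: "AE \<xi> in lebesgue. u \<xi> = v \<xi>"
    using lborel_representative[OF um] .
  obtain g' G where "heis_weight g' G" and gg: "AE \<xi> in lebesgue. g \<xi> = g' \<xi>"
    using weight_representative[OF g] .
  interpret heis_weight g' G by fact
  have gm: "g \<in> borel_measurable lebesgue" by (rule borel_measurable_integrable[OF g(2)])
  have cm: "w \<in> borel_measurable lebesgue" if "w \<in> borel_measurable borel" for w :: "'n heis \<Rightarrow> real"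
    using that by (simp add: measurable_completion)
  have tm [measurable]: "w \<in> borel_measurable borel" if "test_fun w" for w :: "'n heis \<Rightarrow> real"
    by (rule borel_measurable_continuous_onI[OF test_fun_continuous[OF that]])
  have [measurable]: "f_shift f a \<in> borel_measurable borel" by (rule borel_measurable_f_shift[OF f(1)])
  define F where "F \<xi> = f_shift f a (v \<xi>)" for \<xi>
  have [measurable]: "F \<in> borel_measurable borel" unfolding F_def[abs_def] by measurable
  have Fu: "(\<lambda>\<xi>. f_shift f a (u \<xi>)) \<in> borel_measurable lebesgue"
    using um by measurable
  obtain A where A: "A \<ge> 0" "\<And>r. \<bar>f_shift f a r\<bar> \<le> A * (1 + \<bar>r\<bar> powr (\<gamma> - 1))"
    using f_shift_growth[OF f a] by blast
  have vp: "integrable lborel (\<lambda>\<xi>. \<bar>v \<xi>\<bar> powr p)"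
    by (rule integral_lebesgue_cong(2)[OF _ _ _ up]) (use um uv in \<open>auto elim!: eventually_mono\<close>)
  \<comment> \<open>Since \<gamma> - 1 is below p, |v|^(\<gamma> - 1) \<le> 1 + |v|^p: the constants
    are integrated by g itself, the power by the bound G on g.\<close>
  have hint: "integrable lborel (\<lambda>\<xi>. g' \<xi> * F \<xi>)"
  proof (rule Bochner_Integration.integrable_bound)
    show "integrable lborel (\<lambda>\<xi>. A * (2 * g' \<xi> + G * \<bar>v \<xi>\<bar> powr p))" using g_int vp by simp
    show "AE \<xi> in lborel. norm (g' \<xi> * F \<xi>) \<le> norm (A * (2 * g' \<xi> + G * \<bar>v \<xi>\<bar> powr p))"
    proof (rule AE_I2)
      fix \<xi>
      have "\<bar>v \<xi>\<bar> powr (\<gamma> - 1) \<le> 1 + \<bar>v \<xi>\<bar> powr p"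
      proof (cases "\<bar>v \<xi>\<bar> \<le> 1")
        case True
        then have "\<bar>v \<xi>\<bar> powr (\<gamma> - 1) \<le> 1" using \<gamma> by (intro powr_le1) auto
        then show ?thesis by (simp add: add_increasing2)
      next
        case False
        then have "\<bar>v \<xi>\<bar> powr (\<gamma> - 1) \<le> \<bar>v \<xi>\<bar> powr p" using \<gamma> by (intro powr_mono) (auto simp: p_def)
        then show ?thesis by simp
      qed
      then have "\<bar>F \<xi>\<bar> \<le> A * (2 + \<bar>v \<xi>\<bar> powr p)"
        unfolding F_def using A(1) by (intro order_trans[OF A(2)] mult_left_mono) auto
      then have "g' \<xi> * \<bar>F \<xi>\<bar> \<le> g' \<xi> * (A * (2 + \<bar>v \<xi>\<bar> powr p))"
        using g_pos[of \<xi>] by (intro mult_left_mono) auto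
      also have "\<dots> = A * (2 * g' \<xi> + g' \<xi> * \<bar>v \<xi>\<bar> powr p)" by (simp add: algebra_simps)
      also have "\<dots> \<le> A * (2 * g' \<xi> + G * \<bar>v \<xi>\<bar> powr p)"
        using A(1) g_le[of \<xi>] by (intro mult_left_mono add_left_mono mult_right_mono) auto
      finally show "norm (g' \<xi> * F \<xi>) \<le> norm (A * (2 * g' \<xi> + G * \<bar>v \<xi>\<bar> powr p))"
        using g_pos[of \<xi>] A(1) G_pos by (simp add: abs_mult)
    qed
  qed simp
  have weak: "(LINT \<eta>|lborel. v \<eta> * hlap \<psi> \<eta>) = - (LINT \<eta>|lborel. g' \<eta> * F \<eta> * \<psi> \<eta>)"
    if \<psi>: "test_fun \<psi>" for \<psi> :: "'n heis \<Rightarrow> real"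
  proof -
    have [measurable]: "\<psi> \<in> borel_measurable borel" "hlap \<psi> \<in> borel_measurable borel"
      by (intro tm test_fun_hlap \<psi>)+
    have "(LINT \<eta>|lebesgue. u \<eta> * hlap \<psi> \<eta>) = (LINT \<eta>|lborel. v \<eta> * hlap \<psi> \<eta>)"
    proof (rule integral_lebesgue_cong(1))
      show "(\<lambda>\<eta>. u \<eta> * hlap \<psi> \<eta>) \<in> borel_measurable lebesgue" by (intro borel_measurable_times um cm) simp
      show "AE \<eta> in lebesgue. u \<eta> * hlap \<psi> \<eta> = v \<eta> * hlap \<psi> \<eta>" using uv by eventually_elim simp
    qed simp
    moreover have "(LINT \<eta>|lebesgue. g \<eta> * f_shift f a (u \<eta>) * \<psi> \<eta>) = (LINT \<eta>|lborel. g' \<eta> * F \<eta> * \<psi> \<eta>)"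
    proof (rule integral_lebesgue_cong(1))
      show "(\<lambda>\<eta>. g \<eta> * f_shift f a (u \<eta>) * \<psi> \<eta>) \<in> borel_measurable lebesgue"
        by (intro borel_measurable_times gm Fu cm) simp
      show "AE \<eta> in lebesgue. g \<eta> * f_shift f a (u \<eta>) * \<psi> \<eta> = g' \<eta> * F \<eta> * \<psi> \<eta>"
        using uv gg by eventually_elim (simp add: F_def)
    qed simp
    ultimately show ?thesis using weak_solution_hlap[OF sol \<psi>] by simp
  qed
  have rep0: "(LINT \<eta>|lborel. v \<eta> * happrox e \<xi> \<eta>) = (LINT \<eta>|lborel. g' \<eta> * F \<eta> * hker e \<xi> \<eta>)" if "e > 0" for e \<xi>
  proof -
    have "(LINT \<eta>|lborel. v \<eta> * happrox e \<xi> \<eta>) = (LINT \<eta>|lborel. (4 * (real CARD('n))\<^sup>2 * e) * (v \<eta> * hgauge e (hdiff \<xi> \<eta>) powr (- (real CARD('n) / 2) - 1)))"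
      by (simp add: happrox_def mult_ac)
    also have "\<dots> = 4 * (real CARD('n))\<^sup>2 * e * (LINT \<eta>|lborel. v \<eta> * hgauge e (hdiff \<xi> \<eta>) powr (- (real CARD('n) / 2) - 1))"
      by (rule integral_mult_right_zero)
    also have "\<dots> = (LINT \<eta>|lborel. g' \<eta> * F \<eta> * hker e \<xi> \<eta>)"
      unfolding hker_def by (rule regularized_representation[OF weak v p(2) vp hint that])
    finally show ?thesis .
  qed
  have wi: "integrable lborel (\<lambda>\<eta>. \<bar>\<phi> j \<eta> - v \<eta>\<bar> powr p)" for j
  proof (rule integrable_powr_diff)
    have "integrable lebesgue (\<lambda>\<eta>. \<bar>\<phi> j \<eta>\<bar> powr p)" by (rule test_fun_Lp[OF \<phi>(1) p(3)])
    then show "integrable lborel (\<lambda>\<eta>. \<bar>\<phi> j \<eta>\<bar> powr p)"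
      using tm[OF \<phi>(1)] by (subst (asm) integrable_completion) simp_all
  qed (use tm[OF \<phi>(1)] vp p in auto)
  have wl: "(\<lambda>j. LINT \<eta>|lborel. \<bar>\<phi> j \<eta> - v \<eta>\<bar> powr p) \<longlonglongrightarrow> 0"
  proof -
    have "(LINT \<xi>|lebesgue. \<bar>\<phi> j \<xi> - u \<xi>\<bar> powr p) = (LINT \<eta>|lborel. \<bar>\<phi> j \<eta> - v \<eta>\<bar> powr p)" for j
    proof (rule integral_lebesgue_cong(1))
      have "(\<lambda>\<xi>. \<phi> j \<xi> - u \<xi>) \<in> borel_measurable lebesgue"
        by (intro borel_measurable_diff um cm tm \<phi>)
      then show "(\<lambda>\<xi>. \<bar>\<phi> j \<xi> - u \<xi>\<bar> powr p) \<in> borel_measurable lebesgue" by (rule measurable_abs_powr)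
      show "AE \<xi> in lebesgue. \<bar>\<phi> j \<xi> - u \<xi>\<bar> powr p = \<bar>\<phi> j \<xi> - v \<xi>\<bar> powr p"
        using uv by eventually_elim simp
      show "(\<lambda>\<eta>. \<bar>\<phi> j \<eta> - v \<eta>\<bar> powr p) \<in> borel_measurable borel"
        using tm[OF \<phi>(1)[of j]] by measurable
    qed
    then show ?thesis using \<phi>(2) by simp
  qed
  have rep: "AE \<xi> in lborel. integrable lborel (\<lambda>\<eta>. g' \<eta> * F \<eta> * hker 0 \<xi> \<eta>) \<and>
      hmass TYPE('n) * v \<xi> = (LINT \<eta>|lborel. g' \<eta> * F \<eta> * hker 0 \<xi> \<eta>)"
    by (rule potential_representation[OF v p(2) vp hint rep0 _ _ wi wl])
       (auto intro: test_fun_continuous test_fun_bounded_support \<phi>)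
  have s: "1 < \<gamma> - 1" "\<gamma> - 1 < 1 + 2 / real CARD('n)" using \<gamma> by (auto simp: crit_exp_eq)
  have F_le: "\<bar>F \<eta>\<bar> \<le> A * (1 + \<bar>v \<eta>\<bar> powr (\<gamma> - 1))" for \<eta> unfolding F_def by (rule A(2))
  note reg = potential_regularity[OF v _ vp[unfolded p(1)] F_le A(1) s rep]
  obtain C where "AE \<xi> in lborel. \<bar>v \<xi>\<bar> \<le> C" using reg(1) by auto
  then have "AE \<xi> in lebesgue. \<bar>v \<xi>\<bar> \<le> C" by (rule AE_completion)
  with uv have "AE \<xi> in lebesgue. \<bar>u \<xi>\<bar> \<le> C" by eventually_elim simp
  then show "Linf_fun u" using um by (auto simp: Linf_fun_def)
  obtain w where w: "continuous_on UNIV w" "AE \<xi> in lborel. v \<xi> = w \<xi>" using reg(2) by auto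
  from w(2) have "AE \<xi> in lebesgue. v \<xi> = w \<xi>" by (rule AE_completion)
  with uv have "AE \<xi> in lebesgue. u \<xi> = w \<xi>" by eventually_elim simp
  with w(1) show "has_continuous_rep u" by (auto simp: has_continuous_rep_def)
qed

theorem theorem1p2:
  fixes g :: "'n::finite heis \<Rightarrow> real"
    and f :: "real \<Rightarrow> real"
    and \<gamma> Cf \<theta> s0 \<beta> \<delta> a1 s :: real
    and \<phi> v :: "'n heis \<Rightarrow> real"
    and u :: "real \<Rightarrow> 'n heis \<Rightarrow> real"
  assumes g_pos: "\<And>\<xi>. g \<xi> > 0"
    and g_L1: "integrable lebesgue g"
    and g_Linf: "Linf_fun g"
    and f_cont: "continuous_on {0..} f"
    and f_nonneg: "\<And>r. r \<ge> 0 \<Longrightarrow> f r \<ge> 0"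
    and f_zero: "f 0 = 0"
    and f_at_0: "((\<lambda>r. f r / r) \<longlongrightarrow> 0) (at_right 0)"
    and gamma: "2 < \<gamma>" "\<gamma> < crit_exp TYPE('n)"
    and Cf: "Cf > 0"
    and f_growth: "\<exists>L\<le>Cf. ((\<lambda>r. f r / r powr (\<gamma> - 1)) \<longlongrightarrow> L) at_top"
    and AR_const: "\<theta> > 2" "s0 > 0"
    and AR: "\<And>r. r > s0 \<Longrightarrow> 0 < \<theta> * antideriv f r \<and> \<theta> * antideriv f r \<le> r * f r"
    and mp_const: "\<beta> > 0" "\<delta> > 0" "a1 > 0"
    and mp_sphere: "\<And>a w. 0 < a \<Longrightarrow> a < a1 \<Longrightarrow> w \<in> D12 \<Longrightarrow> D_norm w = \<beta> \<Longrightarrow> energy g f a w \<ge> \<delta>"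
    and phi: "test_fun \<phi>" "\<phi> \<noteq> (\<lambda>_. 0)" "\<And>\<xi>. \<phi> \<xi> \<ge> 0" "D_norm \<phi> = 1"
    and v_def: "s > 0" "v = (\<lambda>\<xi>. s * \<phi> \<xi>)"
    and v_far: "D_norm v > \<beta>"
    and v_neg: "\<And>a. 0 < a \<Longrightarrow> a < a1 \<Longrightarrow> energy g f a v < 0"
    and u_sol: "\<And>a. 0 < a \<Longrightarrow> a < a1 \<Longrightarrow> weak_solution g f a (u a)"
    and u_crit: "\<And>a. 0 < a \<Longrightarrow> a < a1 \<Longrightarrow> critical_point (energy g f a) (u a)"
    and u_level: "\<And>a. 0 < a \<Longrightarrow> a < a1 \<Longrightarrow> energy g f a (u a) = mp_level (energy g f a) v"
    and u_delta: "\<And>a. 0 < a \<Longrightarrow> a < a1 \<Longrightarrow> mp_level (energy g f a) v \<ge> \<delta>"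
  shows "\<exists>a2. 0 < a2 \<and> a2 < a1 \<and>
           (\<forall>a. 0 < a \<and> a < a2 \<longrightarrow> Linf_fun (u a) \<and> has_continuous_rep (u a))"
\<comment> \<open>The regularity theorem applies to each a in (0, a1) separately, so any point
  strictly inside the interval can serve as a2.\<close>
proof (intro exI[of _ "a1 / 2"] conjI allI impI)
  obtain L where L: "((\<lambda>r. f r / r powr (\<gamma> - 1)) \<longlongrightarrow> L) at_top" using f_growth by blast
  fix a assume "0 < a \<and> a < a1 / 2"
  then have a: "0 < a" "a < a1" using mp_const by auto
  note * = weak_solution_regularity[OF g_pos g_L1 g_Linf f_cont f_nonneg L gamma a(1) u_sol[OF a]]
  show "Linf_fun (u a)" "has_continuous_rep (u a)" using * by blast+
qed (use mp_const in auto)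

end
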